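(* Let $F\in\mathcal{S}^{\sharp}$ and let $k$ be a non-negative integer. Under the assumption of the Riemann Hypothesis for $F(s)$, all non-real zeros of $F_k(s)$ in the region $\mathscr{R}=\{s=\sigma+it\mid 1-\sigma_{F,k}<\sigma<\sigma_{F,k},\ 0<t<T\}$, where $\sigma_{F,k}$ is a sufficiently large positive number, lie on the critical line $\sigma=1/2$, with at most finitely many exceptions.
   Context: Write $s=\sigma+it$. The extended Selberg class $\mathcal{S}^{\sharp}$ is the set of functions $F$ such that: (S1) $F(s)=\sum_{n\ge1}a_F(n)n^{-s}$, absolutely convergent for $\sigma>1$, with $a_F(1)=1$; (S2) there is an integer $m\ge0$ such that $(s-1)^mF(s)$ extends to an entire function of finite order; the smallest such $m$ is denoted $m_F$; (S3) there exist an integer $r\ge0$, real numbers $Q>0$, $\lambda_j>0$, complex numbers $\mu_j$ with $\Re\mu_j\ge0$ $(1\le j\le r)$ and $\omega\in\mathbb{C}$ with $|\omega|=1$ such that, with the gamma factor $\gamma(s)=Q^s\prod_{j=1}^r\Gamma(\lambda_js+\mu_j)$, the function $\xi_F(s)=s^{m_F}(s-1)^{m_F}\gamma(s)F(s)$ satisfies $\xi_F(s)=\omega\overline{\xi_F(1-\overline{s})}$. Put $H(s)=\omega\overline{\gamma(1-\overline{s})}/\gamma(s)$ and $\psi_F(s)=H'(s)/H(s)$. The meromorphic functions $F_k$ are defined by $F_0=F$ and $F_{k+1}(s)=F_k'(s)-\tfrac12\psi_F(s)F_k(s)$ for $k\ge0$. The Riemann Hypothesis (RH) for $F$: every non-trivial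 zero of $F$, i.e. every zero of $\xi_F$, lies on the line $\Re s=1/2$. The height $T$ of the region $\mathscr{R}$ is arbitrary, and "at most finitely many exceptions" is understood as a bound $O_k(1)$ on the number of exceptions, uniform in $T$. *)

theory Defs
  imports "HOL-Complex_Analysis.Complex_Analysis" "HOL-Library.Landau_Symbols"
begin

text \<open>
  Meromorphic functions on the plane are represented by total functions on \<^typ>\<open>complex\<close> whose
  values on a discrete set of exceptional points (poles, removable singularities) carry no
  information.  Every notion below that refers to values of a meromorphic function therefore goes
  through limits, by \<^const>\<open>remove_sings\<close> or \<^const>\<open>isolated_zero\<close>, or away from the exceptional points.
\<close>

definition finite_order :: "(complex \<Rightarrow> complex) \<Rightarrow> bool" where
  "finite_order g \<longleftrightarrow>
     (\<exists>\<rho>::real. (\<lambda>s. norm (g s)) \<in> O[at_infinity](\<lambda>s. exp (norm s powr \<rho>)))"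

definition dirichlet_series_axiom :: "(complex \<Rightarrow> complex) \<Rightarrow> bool" where
  "dirichlet_series_axiom F \<longleftrightarrow>
     (\<exists>a :: nat \<Rightarrow> complex. a 1 = 1 \<and>
        (\<forall>s. Re s > 1 \<longrightarrow>
           (\<lambda>n. norm (a n / of_nat n powr s)) summable_on {1..} \<and>
           ((\<lambda>n. a n / of_nat n powr s) has_sum F s) {1..}))"

text \<open>The value of \<open>F\<close> at the possible pole \<open>1\<close> is left unconstrained.\<close>

definition pole_order_bound :: "(complex \<Rightarrow> complex) \<Rightarrow> nat \<Rightarrow> bool" where
  "pole_order_bound F m \<longleftrightarrow>
     (\<exists>G. G holomorphic_on UNIV \<and> finite_order G \<and> (\<forall>s. s \<noteq> 1 \<longrightarrow> G s = (s - 1) ^ m * F s))"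

definition pole_order :: "(complex \<Rightarrow> complex) \<Rightarrow> nat" where
  "pole_order F = (LEAST m. pole_order_bound F m)"

definition gamma_factor ::
  "real \<Rightarrow> nat \<Rightarrow> (nat \<Rightarrow> real) \<Rightarrow> (nat \<Rightarrow> complex) \<Rightarrow> complex \<Rightarrow> complex" where
  "gamma_factor Q r lam \<mu> s =
     of_real Q powr s * (\<Prod>j=1..r. Gamma (of_real (lam j) * s + \<mu> j))"

text \<open>
  The library gives \<open>Gamma\<close> the value \<open>0\<close> at its poles, so the bare product would have wrong
  values there; \<^const>\<open>remove_sings\<close> yields the function obtained by continuous extension.
\<close>

definition completed_fn ::
  "(complex \<Rightarrow> complex) \<Rightarrow> real \<Rightarrow> nat \<Rightarrow> (nat \<Rightarrow> real) \<Rightarrow> (nat \<Rightarrow> complex) \<Rightarrow> complex \<Rightarrow> complex" where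
  "completed_fn F Q r lam \<mu> =
     remove_sings (\<lambda>s. s ^ pole_order F * (s - 1) ^ pole_order F * gamma_factor Q r lam \<mu> s * F s)"

definition functional_equation ::
  "(complex \<Rightarrow> complex) \<Rightarrow> real \<Rightarrow> nat \<Rightarrow> (nat \<Rightarrow> real) \<Rightarrow> (nat \<Rightarrow> complex) \<Rightarrow> complex \<Rightarrow> bool" where
  "functional_equation F Q r lam \<mu> \<omega> \<longleftrightarrow>
     Q > 0 \<and> (\<forall>j\<in>{1..r}. lam j > 0 \<and> Re (\<mu> j) \<ge> 0) \<and> norm \<omega> = 1 \<and>
     (\<forall>s. completed_fn F Q r lam \<mu> s = \<omega> * cnj (completed_fn F Q r lam \<mu> (1 - cnj s)))"

definition extended_Selberg_class :: "(complex \<Rightarrow> complex) set" where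
  "extended_Selberg_class =
     {F. dirichlet_series_axiom F \<and> (\<exists>m. pole_order_bound F m) \<and>
         (\<exists>Q r lam \<mu> \<omega>. functional_equation F Q r lam \<mu> \<omega>)}"

definition Riemann_Hypothesis ::
  "(complex \<Rightarrow> complex) \<Rightarrow> real \<Rightarrow> nat \<Rightarrow> (nat \<Rightarrow> real) \<Rightarrow> (nat \<Rightarrow> complex) \<Rightarrow> bool" where
  "Riemann_Hypothesis F Q r lam \<mu> \<longleftrightarrow>
     (\<forall>s. completed_fn F Q r lam \<mu> s = 0 \<longrightarrow> Re s = 1/2)"

definition H_fn ::
  "real \<Rightarrow> nat \<Rightarrow> (nat \<Rightarrow> real) \<Rightarrow> (nat \<Rightarrow> complex) \<Rightarrow> complex \<Rightarrow> complex \<Rightarrow> complex" where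
  "H_fn Q r lam \<mu> \<omega> s = \<omega> * cnj (gamma_factor Q r lam \<mu> (1 - cnj s)) / gamma_factor Q r lam \<mu> s"

definition psi_fn ::
  "real \<Rightarrow> nat \<Rightarrow> (nat \<Rightarrow> real) \<Rightarrow> (nat \<Rightarrow> complex) \<Rightarrow> complex \<Rightarrow> complex \<Rightarrow> complex" where
  "psi_fn Q r lam \<mu> \<omega> s = deriv (H_fn Q r lam \<mu> \<omega>) s / H_fn Q r lam \<mu> \<omega> s"

text \<open>
  As a meromorphic function; the pointwise formula may fail only on the discrete set of
  singularities of \<open>F\<close> and \<open>\<psi>\<close>.
\<close>

primrec F_iter ::
  "(complex \<Rightarrow> complex) \<Rightarrow> (complex \<Rightarrow> complex) \<Rightarrow> nat \<Rightarrow> complex \<Rightarrow> complex" where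
  "F_iter F \<psi> 0 = F"
| "F_iter F \<psi> (Suc k) = (\<lambda>s. deriv (F_iter F \<psi> k) s - 1/2 * \<psi> s * F_iter F \<psi> k s)"

text \<open>
  Zeros of a meromorphic function are its zeros of finite positive order.  The only effect of
  \<^const>\<open>isolated_zero\<close> besides ignoring values at exceptional points is that an identically vanishing
  function has no zeros; this matters for \<open>F = 1\<close>, \<open>Q = 1\<close>, \<open>r = 0\<close>, where \<open>F\<^sub>k\<close> vanishes identically
  for all \<open>k \<ge> 1\<close>.
\<close>

definition off_line_zeros :: "(complex \<Rightarrow> complex) \<Rightarrow> real \<Rightarrow> real \<Rightarrow> complex set" where
  "off_line_zeros f \<sigma> T =
     {s. isolated_zero f s \<and> 1 - \<sigma> < Re s \<and> Re s < \<sigma> \<and> 0 < Im s \<and> Im s < T \<and> Re s \<noteq> 1/2}"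

end

theory Submission
  imports Defs "HOL-Real_Asymp.Real_Asymp"
begin

text \<open>
  Put \<open>s = 1/2 + i w\<close> and write \<open>H = exp (2 l)\<close> on an upper half plane free of poles.  By the functional
  equation \<open>f(w) = F(s) exp (- l(w))\<close> is real on the real axis, and \<open>F\<^sub>k(s) = (- i)\<^sup>k f\<^sup>(\<^sup>k\<^sup>)(w) exp (l(w))\<close>, so
  it suffices to show that the zeros of the derivatives of \<open>f\<close> of large real part in a strip are real.

  If all zeros \<open>\<rho>\<close> of \<open>f\<close> in a disc of radius \<open>R\<close> are real and \<open>log |f|\<close> exceeds its value at the centre
  by at most \<open>M\<close>, then Borel-Caratheodory gives \<open>Im (f'/f)(z) = - Im z (\<Sum> 1/|z - \<rho>|\<^sup>2 + O(M/R\<^sup>2))\<close>, so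
  nearby \<open>f'\<close> has no nonreal zeros once one \<open>\<rho>\<close> is close enough to \<open>z\<close>.  For \<open>r \<ge> 1\<close> Stirling's formula and
  Phragmen-Lindelof give \<open>M = O(R log x)\<close> at \<open>Re w = x\<close>; the same estimate with constant \<open>R\<close> shows that
  the zeros of \<open>f\<close> have bounded gaps, and Rolle carries this over to derivatives.  If \<open>f\<close> has only real
  zeros for \<open>|Im w| \<le> x\<^sup>a\<close>, then \<open>f'\<close> has only real zeros for \<open>|Im w| \<le> x\<^sup>a\<^sup>/\<^sup>4\<close>, and one iterates.  For \<open>r = 0\<close>
  the function \<open>f\<close> is entire of exponential type and \<open>R\<close> tends to infinity.

  The zeros of bounded height are finitely many because \<open>F\<^sub>k\<close> is meromorphic.
\<close>

subsection \<open>The logarithmic derivative near real zeros\<close>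

text \<open>For \<open>r \<ge> 1\<close> the function \<open>f\<close> is only constructed on a half
  plane, so a global product cannot supply the sign of Im (f'/f), and all estimates are made in
  discs. Real zeros in a disc all push Im (f'/f) in the same direction. What lies outside enters as
  an error that must also carry the factor Im z; this factor comes from comparing \<open>z\<close>
  with the real point below it, where the logarithmic derivative of the zero-free part is real. One
  zero near \<open>z\<close> beats an error of size log x / R only if R exceeds (Im z)^2 log x up to
  constants. Hence each differentiation shrinks the strip on which the zeros are known to be real,
  and a fixed strip would be used up at once; strips growing like a power of x survive any number of
  steps. The nearby zero exists because the sum \<open>\<Lambda>\<close> of the \<open>lam j\<close>
  is positive: Im (f'/f) at x + i B is about - \<open>\<Lambda>\<close> log x, which only zeros near
  x can produce. For \<open>r = 0\<close> this sum is 0 and \<open>f\<close> may have no zeros, but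
  \<open>f\<close> is entire and R is free.\<close>

lemma deriv_in_Reals:
  fixes f :: "complex \<Rightarrow> complex"
  assumes "f holomorphic_on U" "open U" "\<And>t. complex_of_real t \<in> U \<Longrightarrow> f (of_real t) \<in> \<real>"
    and x: "complex_of_real x \<in> U"
  shows "deriv f (of_real x) \<in> \<real>"
proof -
  have D: "(f has_field_derivative deriv f (of_real x)) (at (of_real x))"
    using assms holomorphic_derivI by blast
  have lim: "((\<lambda>y. (f y - f (of_real x)) / (y - of_real x)) \<longlongrightarrow> deriv f (of_real x)) (at (of_real x))"
    using D by (simp add: has_field_derivative_iff)
  have fl: "filterlim complex_of_real (at (of_real x)) (at x)"
    unfolding filterlim_at
    by (auto intro!: tendsto_intros simp: eventually_at_filter)
  have lim2: "((\<lambda>t. (f (of_real t) - f (of_real x)) / (of_real t - of_real x)) \<longlongrightarrow> deriv f (of_real x)) (at x)"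
    using filterlim_compose[OF lim fl] .
  have ev: "eventually (\<lambda>t. complex_of_real t \<in> U) (at x)"
    using fl \<open>open U\<close> x unfolding filterlim_at by (metis topological_tendstoD)
  show ?thesis
  proof (rule Lim_in_closed_set[OF closed_complex_Reals _ _ lim2])
    show "\<forall>\<^sub>F t in at x. (f (of_real t) - f (of_real x)) / (of_real t - of_real x) \<in> \<real>"
      using ev by eventually_elim (auto intro!: assms x Reals_divide Reals_diff)
  qed auto
qed

lemma continuous_real_closure:
  fixes f :: "complex \<Rightarrow> complex"
  assumes "open U" "complex_of_real x \<in> U" "isCont f (of_real x)"
    and "\<And>t. complex_of_real t \<in> U \<Longrightarrow> t \<noteq> x \<Longrightarrow> f (of_real t) \<in> \<real>"
  shows "f (of_real x) \<in> \<real>"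
proof -
  have fl: "filterlim complex_of_real (at (of_real x)) (at x)"
    unfolding filterlim_at
    by (auto intro!: tendsto_intros simp: eventually_at_filter)
  have lim: "((\<lambda>t. f (of_real t)) \<longlongrightarrow> f (of_real x)) (at x)"
    using filterlim_compose[OF assms(3)[unfolded isCont_def] fl] .
  have ev: "eventually (\<lambda>t. complex_of_real t \<in> U) (at x)"
    using fl \<open>open U\<close> assms(2) unfolding filterlim_at by (metis topological_tendstoD)
  have ev2: "eventually (\<lambda>t. t \<noteq> x) (at x)" by (simp add: eventually_at_filter)
  show ?thesis
  proof (rule Lim_in_closed_set[OF closed_complex_Reals _ _ lim])
    show "\<forall>\<^sub>F t in at x. f (of_real t) \<in> \<real>"
      using ev ev2 by eventually_elim (use assms(4) in auto)
  qed auto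
qed

text \<open>Away from \<open>x\<close> the quotient is real on the axis as a quotient of reals, and
  at \<open>x\<close> by continuity. Reality must survive the division, because
  \<open>log_deriv_local\<close> uses that the zero-free part has a real logarithmic derivative on
  the axis.\<close>

lemma factor_real_zero:
  fixes f :: "complex \<Rightarrow> complex"
  assumes hol: "f holomorphic_on U" and U: "open U" "connected U"
    and re: "\<And>t. complex_of_real t \<in> U \<Longrightarrow> f (of_real t) \<in> \<real>"
    and x: "complex_of_real x \<in> U" "f (of_real x) = 0"
    and nz: "w0 \<in> U" "f w0 \<noteq> 0"
  obtains g n where "g holomorphic_on U" "n > 0"
    "\<And>w. w \<in> U \<Longrightarrow> f w = (w - of_real x) ^ n * g w"
    "g (of_real x) \<noteq> 0" "\<And>t. complex_of_real t \<in> U \<Longrightarrow> g (of_real t) \<in> \<real>"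
proof -
  let ?x = "complex_of_real x"
  have "\<not> f constant_on U"
    using x nz unfolding constant_on_def by metis
  then obtain h r n where h: "0 < n" "0 < r" "ball ?x r \<subseteq> U" "h holomorphic_on ball ?x r"
     "\<And>w. w \<in> ball ?x r \<Longrightarrow> f w = (w - ?x) ^ n * h w" "\<And>w. w \<in> ball ?x r \<Longrightarrow> h w \<noteq> 0"
    using holomorphic_factor_zero_nonconstant[OF hol U x] by metis
  define g where "g w = (if w = ?x then h ?x else f w / (w - ?x) ^ n)" for w
  have gh: "g w = h w" if "w \<in> ball ?x r" for w
    using h(5)[OF that] by (auto simp: g_def)
  have "g holomorphic_on ball ?x r"
    using h(4) gh by (metis holomorphic_transform)
  moreover have "g holomorphic_on U - {?x}"
    by (rule holomorphic_transform[of "\<lambda>w. f w / (w - ?x) ^ n"])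
       (auto simp: g_def intro!: holomorphic_intros holomorphic_on_subset[OF hol])
  ultimately have "g holomorphic_on (ball ?x r \<union> (U - {?x}))"
    using U by (intro holomorphic_on_Un) (auto intro: open_delete)
  moreover have "U \<subseteq> ball ?x r \<union> (U - {?x})" using h(2) by auto
  ultimately have gU: "g holomorphic_on U" by (rule holomorphic_on_subset)
  have fac: "f w = (w - ?x) ^ n * g w" if "w \<in> U" for w
    using h(5)[of w] gh[of w] h(1) h(2) x by (auto simp: g_def)
  have real1: "g (of_real t) \<in> \<real>" if "complex_of_real t \<in> U" "t \<noteq> x" for t
    using re[OF that(1)] that(2) by (auto simp: g_def intro!: Reals_divide Reals_power)
  have "isCont g ?x"
    using gU U x holomorphic_on_imp_continuous_on continuous_on_eq_continuous_at by blast
  then have real2: "g ?x \<in> \<real>"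
    using continuous_real_closure[OF U(1) x(1)] real1 by blast
  show ?thesis
  proof (rule that[of g n])
    show "g ?x \<noteq> 0" using gh h(6)[of ?x] h(2) by simp
    show "g (of_real t) \<in> \<real>" if "complex_of_real t \<in> U" for t
      using real1 real2 that by (cases "t = x") auto
  qed (use gU h fac in auto)
qed

lemma factor_real_zeros:
  fixes f :: "complex \<Rightarrow> complex"
  assumes "finite S" and U: "open U" "connected U" and "f holomorphic_on U"
    and "\<And>t. complex_of_real t \<in> U \<Longrightarrow> f (of_real t) \<in> \<real>"
    and "of_real ` S \<subseteq> U" "\<And>x. x \<in> S \<Longrightarrow> f (of_real x) = 0" 
    and "w0 \<in> U" "f w0 \<noteq> 0"
  shows "\<exists>g n. g holomorphic_on U \<and> (\<forall>x\<in>S. (n x::nat) > 0) \<and>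
    (\<forall>w\<in>U. f w = (\<Prod>x\<in>S. (w - of_real x) ^ n x) * g w) \<and>
    (\<forall>x\<in>S. g (of_real x) \<noteq> 0) \<and> (\<forall>t. complex_of_real t \<in> U \<longrightarrow> g (of_real t) \<in> \<real>)"
  using assms(1,4-)
proof (induction S arbitrary: f rule: finite_induct)
  case empty
  then show ?case by (intro exI[of _ f]) auto
next
  case (insert a S)
  obtain g k where g: "g holomorphic_on U" "k > 0"
    "\<And>w. w \<in> U \<Longrightarrow> f w = (w - of_real a) ^ k * g w"
    "g (of_real a) \<noteq> 0" "\<And>t. complex_of_real t \<in> U \<Longrightarrow> g (of_real t) \<in> \<real>"
    by (rule factor_real_zero[of f U a w0]) (use insert.prems U in auto)
  have "g (of_real x) = 0" if "x \<in> S" for x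
    using g(3)[of "of_real x"] insert that by auto
  moreover have "g w0 \<noteq> 0" using g(3)[of w0] insert.prems g(2) by auto
  moreover have "complex_of_real ` S \<subseteq> U" using insert.prems by auto
  ultimately obtain h n where h: "h holomorphic_on U" "\<forall>x\<in>S. (n x::nat) > 0"
    "\<forall>w\<in>U. g w = (\<Prod>x\<in>S. (w - of_real x) ^ n x) * h w"
    "\<forall>x\<in>S. h (of_real x) \<noteq> 0" "\<forall>t. complex_of_real t \<in> U \<longrightarrow> h (of_real t) \<in> \<real>"
    using insert.IH[of g] insert.prems g by blast
  have "h (of_real a) \<noteq> 0"
    using g(4) h(3) insert.prems(3) by auto
  moreover have "(\<Prod>x\<in>S. (w - complex_of_real x) ^ (n(a := k)) x) = (\<Prod>x\<in>S. (w - of_real x) ^ n x)" for w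
    using insert.hyps by (intro prod.cong) auto
  ultimately show ?case
    using g h insert.hyps by (intro exI[of _ h] exI[of _ "n(a := k)"]) auto
qed

text \<open>The map u / (2M - u) sends the half plane Re u < M into the unit disc and fixes 0, so
  the Schwarz lemma bounds its composition with \<open>h\<close> by 1/2 on the half disc. Solving
  |h| \<le> (2M + |h|)/2 for |h| gives 2M.\<close>

lemma Borel_Caratheodory_origin:
  fixes h :: "complex \<Rightarrow> complex"
  assumes hol: "h holomorphic_on ball w0 r" and r: "r > 0" and h0: "h w0 = 0"
    and M: "\<And>w. w \<in> ball w0 r \<Longrightarrow> Re (h w) < M"
    and w: "dist w0 w \<le> r / 2"
  shows "norm (h w) \<le> 2 * M"
proof -
  have M0: "M > 0" using M[of w0] r h0 by simp
  have lt: "norm u < norm (2 * of_real M - u)" if "Re u < M" for u :: complex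
  proof -
    have "(norm (2 * of_real M - u))\<^sup>2 - (norm u)\<^sup>2 = 4 * M * (M - Re u)"
      unfolding cmod_power2 by (simp add: power2_eq_square algebra_simps)
    also have "\<dots> > 0" using that M0 by simp
    finally show ?thesis by (simp add: power2_less_imp_less)
  qed
  define \<phi> where "\<phi> z = h (w0 + of_real r * z) / (2 * of_real M - h (w0 + of_real r * z))" for z
  have inb: "w0 + of_real r * z \<in> ball w0 r" if "norm z < 1" for z
    using that r by (simp add: dist_norm norm_mult)
  have nz: "2 * of_real M - h (w0 + of_real r * z) \<noteq> 0" if "norm z < 1" for z
    using lt[OF M[OF inb[OF that]]] by auto
  have hol2: "(\<lambda>z. h (w0 + of_real r * z)) holomorphic_on ball 0 1"
    using inb by (intro holomorphic_on_compose_gen[OF _ hol, unfolded o_def] holomorphic_intros) auto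
  have "\<phi> holomorphic_on ball 0 1"
    unfolding \<phi>_def using nz by (intro holomorphic_intros hol2) auto
  moreover have "\<phi> 0 = 0" by (simp add: \<phi>_def h0)
  moreover have "norm (\<phi> z) < 1" if "norm z < 1" for z
    using lt[OF M[OF inb[OF that]]] by (auto simp: \<phi>_def norm_divide divide_less_eq)
  moreover define z where "z = (w - w0) / of_real r"
  have z: "norm z \<le> 1/2" using w r by (simp add: z_def norm_divide dist_norm norm_minus_commute field_simps)
  ultimately have le: "norm (\<phi> z) \<le> 1/2" using Schwarz_Lemma(1)[of \<phi> z] by force
  have wz: "w0 + of_real r * z = w" using r by (simp add: z_def)
  have "norm (h w) = norm (\<phi> z) * norm (2 * of_real M - h w)"
    using nz[of z] z by (simp add: \<phi>_def wz norm_divide)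
  also have "\<dots> \<le> 1/2 * norm (2 * of_real M - h w)" by (intro mult_right_mono le) auto
  also have "\<dots> \<le> 1/2 * (2 * M + norm (h w))"
    using norm_triangle_ineq4[of "2 * of_real M" "h w"] M0 by (simp add: norm_mult)
  finally show ?thesis by simp
qed

lemma log_deriv_factor:
  fixes g :: "complex \<Rightarrow> complex"
  assumes U: "open U" "z \<in> U" and "g holomorphic_on U" and f: "\<forall>w\<in>U. f w = (\<Prod>x\<in>S. (w - of_real x) ^ n x) * g w"
    and "finite S" "f z \<noteq> 0"
  shows "deriv f z / f z = deriv g z / g z + (\<Sum>x\<in>S. of_nat (n x) / (z - of_real x))"
proof -
  have gz: "g z \<noteq> 0" and pz: "\<And>x. x \<in> S \<Longrightarrow> n x > 0 \<Longrightarrow> z \<noteq> of_real x"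
    using assms by auto
  have main: "((\<lambda>w. (\<Prod>x\<in>S. (w - of_real x) ^ n x)) has_field_derivative
      (\<Prod>x\<in>S. (z - of_real x) ^ n x) * (\<Sum>x\<in>S. of_nat (n x) / (z - of_real x))) (at z)"
    using \<open>finite S\<close> pz
  proof (induction S rule: finite_induct)
    case empty
    then show ?case by simp
  next
    case (insert a S)
    have "((\<lambda>w. (w - of_real a) ^ n a) has_field_derivative (z - of_real a) ^ n a * (of_nat (n a) / (z - of_real a))) (at z)"
    proof (cases "n a")
      case (Suc m)
      then have "z \<noteq> of_real a" using insert by auto
      have "((\<lambda>w. (w - of_real a) ^ Suc m) has_field_derivative
          of_nat (Suc m) * (1 * (z - of_real a) ^ (Suc m - Suc 0))) (at z)"
        by (rule DERIV_power) (auto intro!: derivative_eq_intros)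
      then show ?thesis using Suc \<open>z \<noteq> of_real a\<close> by (simp add: mult_ac)
    qed simp
    from DERIV_mult[OF this insert.IH] insert
    show ?case by (simp add: algebra_simps)
  qed
  have gd: "(g has_field_derivative deriv g z) (at z)"
    using assms holomorphic_derivI by blast
  let ?p = "\<lambda>w. \<Prod>x\<in>S. (w - of_real x) ^ n x"
  have "((\<lambda>w. ?p w * g w) has_field_derivative 
     (?p z * (\<Sum>x\<in>S. of_nat (n x) / (z - of_real x))) * g z + deriv g z * ?p z) (at z)"
    using DERIV_mult[OF main gd] .
  then have "(f has_field_derivative 
     (?p z * (\<Sum>x\<in>S. of_nat (n x) / (z - of_real x))) * g z + deriv g z * ?p z) (at z)"
    by (rule has_field_derivative_transform_within_open[of _ _ _ U]) (use U f in auto)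
  then have "deriv f z = (?p z * (\<Sum>x\<in>S. of_nat (n x) / (z - of_real x))) * g z + deriv g z * ?p z"
    by (rule DERIV_imp_deriv)
  moreover have "f z = ?p z * g z" using f U by auto
  moreover have "?p z \<noteq> 0" using \<open>f z \<noteq> 0\<close> f U by auto
  ultimately show ?thesis using gz by (simp add: field_simps)
qed

text \<open>The sign is opposite to that of Im z for every real zero, so discarding all zeros but
  one still leaves a one-sided bound.\<close>

lemma Im_inverse_diff_real:
  "Im (of_nat n / (z - complex_of_real x)) = - Im z * (real n / (norm (z - of_real x))\<^sup>2)"
  by (simp add: Im_divide cmod_power2)

text \<open>Dividing by the real zeros within R/2 leaves a \<open>g\<close> that is zero-free there
  and still at most exp M times its value at the centre. Its logarithm \<open>h\<close> is
  controlled by Borel-Caratheodory, and \<open>h''\<close> by Cauchy's estimate. Since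
  \<open>h'\<close> is real on the real axis, Im h'(z) is at most |Im z| times the bound for
  \<open>h''\<close>.\<close>

lemma log_deriv_local:
  fixes f :: "complex \<Rightarrow> complex"
  assumes hol: "f holomorphic_on ball w0 R1" and R: "0 < R" "R < R1" and M: "M > 0"
    and real: "\<And>t. complex_of_real t \<in> ball w0 R1 \<Longrightarrow> f (of_real t) \<in> \<real>"
    and bd: "\<And>w. w \<in> cball w0 R \<Longrightarrow> norm (f w) \<le> exp M * norm (f w0)" and nz: "f w0 \<noteq> 0"
    and zeros: "\<And>w. w \<in> cball w0 (R/2) \<Longrightarrow> f w = 0 \<Longrightarrow> Im w = 0"
    and z: "z \<in> ball w0 (R/8)" "complex_of_real (Re z) \<in> ball w0 (R/8)" "f z \<noteq> 0"
  obtains n :: "real \<Rightarrow> nat" and S e where "finite S" 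
    "S = {x. complex_of_real x \<in> cball w0 (R/2) \<and> f (of_real x) = 0}" "\<And>x. x \<in> S \<Longrightarrow> n x > 0"
    "Im (deriv f z / f z) = e - Im z * (\<Sum>x\<in>S. real (n x) / (norm (z - of_real x))\<^sup>2)"
    "\<bar>e\<bar> \<le> \<bar>Im z\<bar> * (512 * M / R\<^sup>2)"
proof -
  define U where "U = ball w0 R1"
  define S where "S = {x. complex_of_real x \<in> cball w0 (R/2) \<and> f (of_real x) = 0}"
  have U: "open U" "connected U" "w0 \<in> U" "cball w0 R \<subseteq> U" "cball w0 (R/2) \<subseteq> U"
    using R by (auto simp: U_def)
  have holU: "f holomorphic_on U" using hol by (simp add: U_def)
  have "finite {w \<in> cball w0 (R/2). f w = 0}"
  proof (cases "f constant_on U")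
    case True
    then have "f w \<noteq> 0" if "w \<in> U" for w
      using that U(3) nz unfolding constant_on_def by metis
    then have "{w \<in> cball w0 (R/2). f w = 0} = {}" using U(5) by auto
    then show ?thesis by (metis finite.emptyI)
  next
    case False
    then show ?thesis
      using holomorphic_compact_finite_zeros[OF holU U(1,2) _ U(5)] by simp
  qed
  then have "finite (complex_of_real ` S)"
    by (rule finite_subset[rotated]) (auto simp: S_def)
  then have fS: "finite S" by (simp add: finite_image_iff inj_on_def)
  obtain g n where g: "g holomorphic_on U" "\<forall>x\<in>S. (n x::nat) > 0"
    "\<forall>w\<in>U. f w = (\<Prod>x\<in>S. (w - of_real x) ^ n x) * g w"
    "\<forall>x\<in>S. g (of_real x) \<noteq> 0" "\<forall>t. complex_of_real t \<in> U \<longrightarrow> g (of_real t) \<in> \<real>"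
  proof -
    have "complex_of_real ` S \<subseteq> U" using U(5) by (auto simp: S_def)
    moreover have "f (of_real x) = 0" if "x \<in> S" for x using that by (simp add: S_def)
    ultimately show ?thesis
      using factor_real_zeros[OF fS U(1,2) holU _ _ _ U(3) nz] real that unfolding U_def by blast
  qed
  let ?P = "\<lambda>w. \<Prod>x\<in>S. (w - complex_of_real x) ^ n x"
  have gnz: "g w \<noteq> 0" if "w \<in> cball w0 (R/2)" for w
  proof
    assume "g w = 0"
    then have "f w = 0" using g(3) that U by auto
    then have "Im w = 0" using zeros that by blast
    then have w: "w = of_real (Re w)" by (simp add: complex_eq_iff)
    then have "Re w \<in> S" using that \<open>f w = 0\<close> by (simp add: S_def)
    then show False using g(4) w \<open>g w = 0\<close> by metis
  qed
  have Pw0: "?P w0 \<noteq> 0" and gw0: "g w0 \<noteq> 0" using g(3) U(3) nz by (auto simp del: prod_zero_iff)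
  have sph: "norm (g w) \<le> exp M * norm (g w0)" if "dist w0 w = R" for w
  proof -
    have wU: "w \<in> cball w0 R" using that by simp
    \<comment> \<open>Zeros lie within R/2 of the centre, hence at distance at least R/2 from the
      circle of radius R: each factor is at least as large there as at the centre.\<close>
    have PP: "norm (?P w0) \<le> norm (?P w)"
      unfolding prod_norm[symmetric] norm_power
    proof (intro prod_mono conjI power_mono)
      fix x assume "x \<in> S"
      then have "dist w0 (of_real x) \<le> R/2" by (simp add: S_def)
      moreover have "R \<le> dist w0 (of_real x) + dist w (of_real x)"
        using that dist_triangle2 by metis
      ultimately show "norm (w0 - of_real x) \<le> norm (w - of_real x)" by (simp add: dist_norm)
    qed auto
    have "norm (?P w) * norm (g w) \<le> exp M * (norm (?P w0) * norm (g w0))"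
      using bd[OF wU] g(3) U(3,4) wU by (auto simp: norm_mult)
    also have "\<dots> \<le> exp M * (norm (?P w) * norm (g w0))"
      by (intro mult_left_mono mult_right_mono PP) auto
    finally have "norm (?P w) * norm (g w) \<le> norm (?P w) * (exp M * norm (g w0))" by (simp add: mult_ac)
    moreover have "norm (?P w) > 0" using PP Pw0 by (metis norm_le_zero_iff not_le order_trans)
    ultimately show ?thesis by (simp add: mult_le_cancel_left_pos)
  qed
  have gbd: "norm (g w) \<le> exp M * norm (g w0)" if "w \<in> ball w0 R" for w
  proof (rule maximum_modulus_frontier[of g "ball w0 R"])
    show "g holomorphic_on interior (ball w0 R)"
      using U by (auto intro!: holomorphic_on_subset[OF g(1)])
    have "closure (ball w0 R) \<subseteq> U" using R U by simp
    then show "continuous_on (closure (ball w0 R)) g"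
      using g(1) holomorphic_on_imp_continuous_on continuous_on_subset by blast
    show "norm (g z) \<le> exp M * norm (g w0)" if "z \<in> frontier (ball w0 R)" for z
      using that R by (intro sph) (auto simp: frontier_ball)
  qed (use that in auto)
  define B where "B = ball w0 (R/2)"
  have BU: "B \<subseteq> U" "open B" "w0 \<in> B" using R by (auto simp: B_def U_def)
  have "(\<lambda>w. g w / g w0) holomorphic_on B" "contractible B"
    using BU gw0 by (auto intro!: holomorphic_intros holomorphic_on_subset[OF g(1)]
        convex_imp_contractible simp: B_def)
  moreover have "g w / g w0 \<noteq> 0" if "w \<in> B" for w using gnz[of w] gw0 that by (simp add: B_def)
  ultimately obtain h0 where h0: "h0 holomorphic_on B" "\<And>w. w \<in> B \<Longrightarrow> g w / g w0 = exp (h0 w)"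
    using contractible_imp_holomorphic_log[of "\<lambda>w. g w / g w0" B] by blast
  define h where "h w = h0 w - h0 w0" for w
  have h: "h holomorphic_on B" "h w0 = 0"
    unfolding h_def by (auto intro!: holomorphic_intros h0)
  have gh: "g w = g w0 * exp (h w)" if "w \<in> B" for w
    using h0(2)[OF that] h0(2)[OF BU(3)] gw0 by (simp add: h_def exp_diff field_simps)
  \<comment> \<open>Re h is at most M; doubling makes the inequality strict, as
    \<open>Borel_Caratheodory_origin\<close> requires, and leads to the bound 4M below.\<close>
  have Reh: "Re (h w) < 2 * M" if "w \<in> ball w0 (R/2)" for w
  proof -
    have "norm (g w0) * exp (Re (h w)) \<le> exp M * norm (g w0)"
      using gbd[of w] that R gh[of w] by (simp add: B_def norm_mult)
    then have "exp (Re (h w)) \<le> exp M" using gw0 by simp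
    then show ?thesis using M by simp
  qed
  have hb: "norm (h w) \<le> 4 * M" if "w \<in> cball w0 (R/4)" for w
    using Borel_Caratheodory_origin[of h w0 "R/2" "2 * M" w] h Reh R that by (simp add: B_def)
  have h2: "norm (deriv (deriv h) w) \<le> 512 * M / R\<^sup>2" if w: "w \<in> ball w0 (R/8)" for w
  proof -
    have sub: "cball w (R/8) \<subseteq> cball w0 (R/4)" "cball w0 (R/4) \<subseteq> B"
      using w R by (auto simp: B_def) (smt (verit) dist_triangle)+
    \<comment> \<open>Cauchy's estimate on a disc of radius R/8: 2 * 4M * 64 / R^2 is the constant
      512 M / R^2.\<close>
    have "norm ((deriv ^^ 2) h w) \<le> fact 2 * (4 * M) / (R/8) ^ 2"
    proof (rule Cauchy_inequality)
      show "h holomorphic_on ball w (R/8)" using sub ball_subset_cball by (intro holomorphic_on_subset[OF h(1)]) blast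
      show "continuous_on (cball w (R/8)) h"
        using sub h(1) holomorphic_on_imp_continuous_on continuous_on_subset by (metis subset_trans)
      show "norm (h x) \<le> 4 * M" if "norm (w - x) = R/8" for x
        using that sub(1) by (intro hb) (auto simp: dist_norm subset_iff)
    qed (use R in auto)
    then show ?thesis by (simp add: eval_nat_numeral field_simps)
  qed
  have dg: "deriv g w / g w = deriv h w" if "w \<in> B" for w
  proof -
    have "(h has_field_derivative deriv h w) (at w)"
      by (rule holomorphic_derivI[OF h(1) BU(2) that])
    then have "((\<lambda>w. g w0 * exp (h w)) has_field_derivative g w0 * (exp (h w) * deriv h w)) (at w)"
      by (auto intro!: derivative_eq_intros)
    then have "(g has_field_derivative g w0 * (exp (h w) * deriv h w)) (at w)"
      by (rule has_field_derivative_transform_within_open[of _ _ _ B])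
         (use BU(2) that gh[symmetric] in auto)
    then show ?thesis using gh[OF that] gw0 by (simp add: DERIV_imp_deriv)
  qed
  let ?x = "complex_of_real (Re z)"
  have zB: "z \<in> B" "?x \<in> B" using z R by (auto simp: B_def)
  have hreal: "Im (deriv h ?x) = 0"
  proof -
    have "deriv g ?x \<in> \<real>" using deriv_in_Reals[OF g(1) U(1)] g(5) zB BU by blast
    moreover have "g ?x \<in> \<real>" using g(5) zB BU by blast
    ultimately have "deriv h ?x \<in> \<real>" using dg[OF zB(2)] by (metis Reals_divide)
    then show ?thesis by (simp add: complex_is_Real_iff)
  qed
  have "norm (deriv h z - deriv h ?x) \<le> 512 * M / R\<^sup>2 * norm (z - ?x)"
  proof (rule field_differentiable_bound[where S = "ball w0 (R/8)" and f = "deriv h" and f' = "deriv (deriv h)"])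
    show "(deriv h has_field_derivative deriv (deriv h) w) (at w within ball w0 (R/8))"
      if "w \<in> ball w0 (R/8)" for w
    proof -
      have "w \<in> B" using that R by (auto simp: B_def)
      from holomorphic_derivI[OF holomorphic_deriv[OF h(1) BU(2)] BU(2) this]
      show ?thesis by (rule has_field_derivative_at_within)
    qed
  qed (fact h2 | fact z | simp)+
  moreover have "norm (z - ?x) = \<bar>Im z\<bar>" by (simp add: cmod_def)
  ultimately have e: "\<bar>Im (deriv h z)\<bar> \<le> \<bar>Im z\<bar> * (512 * M / R\<^sup>2)"
    using abs_Im_le_cmod[of "deriv h z - deriv h ?x"] hreal by (simp add: mult_ac)
  show ?thesis
  proof (rule that[of S n "Im (deriv h z)"])
    have "z \<in> U" using zB BU by auto
    then show "Im (deriv f z / f z) = Im (deriv h z) - Im z * (\<Sum>x\<in>S. real (n x) / (norm (z - of_real x))\<^sup>2)"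
      using log_deriv_factor[OF U(1) _ g(1,3) fS z(3)] dg[OF zB(1)]
      by (simp add: Im_inverse_diff_real sum_negf sum_distrib_left)
  qed (use e fS g(2) in \<open>auto simp: S_def\<close>)
qed

subsection \<open>Real zeros of derivatives in growing strips\<close>

lemma deriv_reflect:
  assumes "open U" "f holomorphic_on U" "w \<in> U" "cnj w \<in> U" "\<And>v. v \<in> U \<Longrightarrow> f (cnj v) = cnj (f v)"
  shows "deriv f (cnj w) = cnj (deriv f w)"
proof -
  have D: "(f has_field_derivative deriv f w) (at w)"
    by (rule holomorphic_derivI[OF assms(2,1,3)])
  have "((cnj \<circ> f \<circ> cnj) has_field_derivative cnj (deriv f w)) (at (cnj w))"
    using has_field_derivative_cnj_cnj[of f "deriv f w" "cnj w"] D by simp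
  moreover have "open (U \<inter> cnj -` U)" 
    by (intro open_Int assms open_vimage continuous_intros)
  ultimately have "(f has_field_derivative cnj (deriv f w)) (at (cnj w))"
    by (rule has_field_derivative_transform_within_open) (use assms in \<open>auto simp: assms(5)\<close>)
  then show ?thesis by (rule DERIV_imp_deriv)
qed

text \<open>
  The lower bound at \<open>x + i B\<close> normalises the growth condition: discs are centred there, since \<open>f\<close>
  may be small near the real axis.
\<close>

definition strip_class :: "real \<Rightarrow> real \<Rightarrow> (complex \<Rightarrow> complex) \<Rightarrow> bool" where
  "strip_class B a f \<longleftrightarrow> (\<exists>T C L. T > 0 \<and> C > 0 \<and> L > 0 \<and>
     f holomorphic_on {w. Re w > T} \<and> (\<forall>w. Re w > T \<longrightarrow> f (cnj w) = cnj (f w)) \<and>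
     (\<forall>w. Re w > T \<and> \<bar>Im w\<bar> \<le> Re w powr a \<longrightarrow> norm (f w) \<le> exp (C * (1 + \<bar>Im w\<bar>) * ln (Re w))) \<and>
     (\<forall>w. Re w > T \<and> \<bar>Im w\<bar> \<le> Re w powr a \<and> f w = 0 \<longrightarrow> Im w = 0) \<and>
     (\<forall>x>T. norm (f (Complex x B)) \<ge> exp (- C * ln x)) \<and>
     (\<forall>x>T. \<exists>t\<in>{x..x+L}. f (of_real t) = 0))"

text \<open>
  With \<open>R = x\<^sup>a/4\<close> the error term is of size \<open>ln x / x\<^sup>a\<close>, whereas for \<open>|Im z| \<le> p = x\<^sup>a\<^sup>/\<^sup>4\<close> the zero in
  \<open>{x..x + L}\<close> contributes at least \<open>1 / (4 p\<^sup>2)\<close>.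
\<close>

lemma Im_log_deriv_strip_class:
  assumes B: "B > 0" and a: "0 < a" "a \<le> 1/2"
    and C: "C > 0" and L: "L > 0" and T: "T > 0"
    and hol: "f holomorphic_on {w. Re w > T}" and cn: "\<And>w. Re w > T \<Longrightarrow> f (cnj w) = cnj (f w)"
    and gr: "\<And>w. Re w > T \<Longrightarrow> \<bar>Im w\<bar> \<le> Re w powr a \<Longrightarrow> norm (f w) \<le> exp (C * (1 + \<bar>Im w\<bar>) * ln (Re w))"
    and zr: "\<And>w. Re w > T \<Longrightarrow> \<bar>Im w\<bar> \<le> Re w powr a \<Longrightarrow> f w = 0 \<Longrightarrow> Im w = 0"
    and lo: "\<And>x. x > T \<Longrightarrow> norm (f (Complex x B)) \<ge> exp (- C * ln x)"
    and ze: "\<And>x. x > T \<Longrightarrow> \<exists>t\<in>{x..x+L}. f (of_real t) = 0"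
    and x: "Re z = x" and p: "p = x powr (a/4)" and y: "0 < Im z" "Im z \<le> p"
    and big: "p \<ge> 32" "p \<ge> 32 * B" "p \<ge> 2 * (1 + B)" "p \<ge> L" "x > 2 * T" "196608 * C * ln x \<le> p\<^sup>2" "x > 2"
    "p ^ 4 \<ge> 8 * (L + B)"
  shows "Im (deriv f z / f z) \<le> - Im z / (8 * p\<^sup>2)"
proof -
  define w0 where "w0 = Complex x B"
  define R where "R = p^4 / 4"
  have R0: "R > 0" using big by (simp add: R_def)
  have xa: "x powr a = p^4" using \<open>x > 2\<close> by (simp add: p powr_powr flip: powr_numeral)
  have p4x: "p^4 \<le> x" using powr_mono[of a 1 x] a \<open>x > 2\<close> by (simp add: xa)
  have p4: "p \<le> p^4/32768" 
  proof -
    have "32 ^ 3 * p \<le> p ^ 3 * p" using big by (intro mult_right_mono power_mono) auto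
    then show ?thesis by (simp add: power_eq_if)
  qed
  have ball: "Re w \<ge> x / 2 \<and> Re w \<le> 2 * x" if "dist w0 w \<le> 2 * R" for w
    using abs_Re_le_cmod[of "w0 - w"] that p4x \<open>x > 2\<close> by (auto simp: w0_def R_def dist_norm abs_if split: if_splits)
  \<comment> \<open>With x^a = p^4 and R = p^4/4, the disc has height at most B + R \<le> x^a/2,
    which is at most (x/2)^a and so fits into the strip even at its left end.\<close>
  have strip: "\<bar>Im w\<bar> \<le> Re w powr a \<and> \<bar>Im w\<bar> \<le> B + R" if "dist w0 w \<le> R" for w
  proof -
    have "\<bar>Im w\<bar> \<le> B + R"
      using abs_Im_le_cmod[of "w0 - w"] that B by (auto simp: w0_def dist_norm abs_if split: if_splits)
    moreover have "B + R \<le> p^4 / 2" using big(2) p4 B by (simp add: R_def)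
    moreover have "p^4 / 2 \<le> (x/2) powr a"
    proof -
      have "(2::real) powr a \<le> 2 powr 1" using a by (intro powr_mono) auto
      then have "x powr a / 2 \<le> x powr a / 2 powr a" by (intro divide_left_mono) auto
      then show ?thesis using \<open>x > 2\<close> by (simp add: powr_divide xa)
    qed
    moreover have "(x/2) powr a \<le> Re w powr a"
      using ball[of w] that R0 \<open>x > 2\<close> a by (intro powr_mono2) auto
    ultimately show ?thesis by linarith
  qed
  \<comment> \<open>Growth costs at most 2 C p^4 ln x on the disc; the remaining C p^4 ln x absorbs
    the lower bound exp (- C ln x) at the centre.\<close>
  define M where "M = 3 * C * p^4 * ln x"
  have lnx: "ln x > 0" using \<open>x > 2\<close> by simp
  have fz: "f z \<noteq> 0"
  proof
    assume "f z = 0"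
    moreover have "\<bar>Im z\<bar> \<le> Re z powr a" using y x xa p4 big(1) by simp
    ultimately show False using zr[of z] y x big T by auto
  qed
  have "f w0 \<noteq> 0" using lo[of x] big(5) T exp_gt_zero[of "- C * ln x"] by (auto simp: w0_def)
  obtain n S e where S: "finite (S::real set)" 
    "S = {x. complex_of_real x \<in> cball w0 (R/2) \<and> f (of_real x) = 0}" "\<And>x. x \<in> S \<Longrightarrow> (n x::nat) > 0"
    "Im (deriv f z / f z) = e - Im z * (\<Sum>x\<in>S. real (n x) / (norm (z - of_real x))\<^sup>2)"
    "\<bar>e\<bar> \<le> \<bar>Im z\<bar> * (512 * M / R\<^sup>2)"
  proof (rule log_deriv_local[of f w0 "2 * R" R M z])
    show "f holomorphic_on ball w0 (2 * R)"
    proof (rule holomorphic_on_subset[OF hol], rule subsetI)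
      fix w assume "w \<in> ball w0 (2 * R)"
      then show "w \<in> {w. Re w > T}" using ball[of w] big by simp
    qed
    show "M > 0" using C lnx big by (simp add: M_def)
    show "f (of_real t) \<in> \<real>" if "complex_of_real t \<in> ball w0 (2 * R)" for t
      using cn[of "of_real t"] ball[of "of_real t"] that big by (simp add: Reals_cnj_iff)
    show "norm (f w) \<le> exp M * norm (f w0)" if "w \<in> cball w0 R" for w
    proof -
      have w: "x/2 \<le> Re w" "Re w \<le> 2 * x" using ball[of w] that R0 by auto
      have "norm (f w) \<le> exp (C * (1 + \<bar>Im w\<bar>) * ln (Re w))"
        using strip[of w] that w big by (intro gr) auto
      also have "C * (1 + \<bar>Im w\<bar>) * ln (Re w) \<le> C * p^4 * (2 * ln x)"
      proof (intro mult_mono)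
        show "1 + \<bar>Im w\<bar> \<le> p^4" using strip[of w] that big(3) p4 big(1) by (auto simp: R_def)
        have "ln (Re w) \<le> ln (2 * x)" using w \<open>x > 2\<close> by simp
        also have "\<dots> = ln 2 + ln x" using \<open>x > 2\<close> by (simp add: ln_mult)
        also have "ln 2 \<le> ln x" using \<open>x > 2\<close> by simp
        finally show "ln (Re w) \<le> 2 * ln x" by simp
        show "0 \<le> ln (Re w)" using w \<open>x > 2\<close> by simp
      qed (use C in auto)
      also have "\<dots> \<le> M - C * ln x"
      proof -
        have "1 * (C * ln x) \<le> p^4 * (C * ln x)" using C lnx big p4 by (intro mult_right_mono) auto
        then show ?thesis by (simp add: M_def algebra_simps)
      qed
      finally have "norm (f w) \<le> exp M * exp (- C * ln x)" by (simp add: exp_diff exp_minus field_simps)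
      also have "\<dots> \<le> exp M * norm (f w0)" using lo[of x] big T by (simp add: w0_def)
      finally show ?thesis .
    qed
    show "Im w = 0" if "w \<in> cball w0 (R/2)" "f w = 0" for w
      using strip[of w] ball[of w] that R0 big T by (intro zr) auto
    have "dist w0 z = \<bar>B - Im z\<bar>" by (simp add: w0_def dist_norm cmod_def x)
    moreover have "\<bar>B - Im z\<bar> \<le> p" using y big(1,2) B by linarith
    ultimately show "z \<in> ball w0 (R/8)" using p4 big(1) by (auto simp: R_def)
    have "dist w0 (of_real (Re z)) = B" using B by (simp add: w0_def dist_norm cmod_def x)
    then show "complex_of_real (Re z) \<in> ball w0 (R/8)" using y p4 big(1,2) B by (auto simp: R_def)
  qed (use R0 fz \<open>f w0 \<noteq> 0\<close> in auto)
  obtain t where t: "t \<in> {x..x+L}" "f (of_real t) = 0" using ze[of x] big T by auto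
  have tS: "t \<in> S"
  proof -
    have "dist w0 (of_real t) \<le> \<bar>x - t\<bar> + \<bar>B\<bar>"
      using cmod_le[of "w0 - of_real t"] by (simp add: w0_def dist_norm)
    also have "\<dots> \<le> L + B" using t B by auto
    also have "\<dots> \<le> R / 2" using big by (simp add: R_def)
    finally show ?thesis using t by (simp add: S)
  qed
  have "norm (z - of_real t) \<le> \<bar>x - t\<bar> + \<bar>Im z\<bar>"
    using cmod_le[of "z - of_real t"] by (simp add: x)
  also have "\<dots> \<le> 2 * p" using t y big by auto
  finally have nz: "norm (z - of_real t) \<le> 2 * p" .
  have "1 / (4 * p\<^sup>2) \<le> real (n t) / (norm (z - of_real t))\<^sup>2"
  proof (intro frac_le)
    show "(norm (z - of_real t))\<^sup>2 \<le> 4 * p\<^sup>2" using power_mono[OF nz, of 2] by simp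
    show "0 < (norm (z - of_real t))\<^sup>2" using y by auto
    show "1 \<le> real (n t)" using S(3)[OF tS] by simp
  qed auto
  also have "\<dots> \<le> (\<Sum>x\<in>S. real (n x) / (norm (z - of_real x))\<^sup>2)"
    using S(1) tS by (intro member_le_sum) auto
  finally have sum: "1 / (4 * p\<^sup>2) \<le> (\<Sum>x\<in>S. real (n x) / (norm (z - of_real x))\<^sup>2)" .
  \<comment> \<open>The constant 196608 is 8 * 24576. It makes the error at most half of the
    contribution 1 / (4 p^2) of the nearby zero, so half of that contribution remains.\<close>
  have "512 * M / R\<^sup>2 \<le> 1 / (8 * p\<^sup>2)"
  proof -
    have "512 * M / R\<^sup>2 = 24576 * C * ln x / p^4"
      using big(1) by (simp add: M_def R_def field_simps power2_eq_square power4_eq_xxxx)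
    also have "\<dots> \<le> (p\<^sup>2 / 8) / p^4" using big by (intro divide_right_mono) auto
    also have "\<dots> = 1 / (8 * p\<^sup>2)" using big(1) by (simp add: field_simps power2_eq_square power4_eq_xxxx)
    finally show ?thesis .
  qed
  then have "e \<le> Im z * (1 / (8 * p\<^sup>2))"
    using S(5) y by (smt (verit) mult_left_mono)
  moreover have "Im z * (1 / (4 * p\<^sup>2)) \<le> Im z * (\<Sum>x\<in>S. real (n x) / (norm (z - of_real x))\<^sup>2)"
    using sum y by (intro mult_left_mono) auto
  ultimately have "Im (deriv f z / f z) \<le> Im z * (1 / (8 * p\<^sup>2)) - Im z * (1 / (4 * p\<^sup>2))"
    unfolding S(4) by linarith
  also have "\<dots> = - Im z / (8 * p\<^sup>2)" using big(1) by (simp add: field_simps)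
  finally show ?thesis .
qed

lemma eventually_strip_constants:
  assumes "a > 0"
  shows "eventually (\<lambda>x::real. x powr (a/4) \<ge> K \<and> D * ln x \<le> (x powr (a/4))\<^sup>2 \<and> (x powr (a/4)) ^ 4 \<ge> K) at_top"
proof -
  have l1: "filterlim (\<lambda>x::real. x powr (a/4)) at_top at_top" 
    by (rule real_powr_at_top) (use assms in auto)
  have l4: "filterlim (\<lambda>x::real. (x powr (a/4)) ^ 4) at_top at_top" 
    by (rule filterlim_pow_at_top[OF _ l1]) auto
  have "((\<lambda>x::real. D * (ln x / x powr (a/2))) \<longlongrightarrow> D * 0) at_top"
    using assms by (intro tendsto_intros) real_asymp
  then have "eventually (\<lambda>x::real. D * (ln x / x powr (a/2)) < 1) at_top"
    by (rule order_tendstoD) auto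
  moreover have "eventually (\<lambda>x::real. x powr (a/4) \<ge> K) at_top" "eventually (\<lambda>x::real. (x powr (a/4)) ^ 4 \<ge> K) at_top" 
    using l1 l4 by (auto simp: filterlim_at_top)
  ultimately show ?thesis using eventually_gt_at_top[of 1]
  proof eventually_elim
    case (elim x)
    have "(x powr (a/4))\<^sup>2 = x powr (a/2)" using elim by (simp add: powr_powr flip: powr_numeral)
    then show ?case using elim by (simp add: field_simps)
  qed
qed

lemma Rolle_complex:
  assumes hol: "f holomorphic_on U" "open U" and sub: "\<And>t. a \<le> t \<Longrightarrow> t \<le> b \<Longrightarrow> complex_of_real t \<in> U"
    and re: "\<And>t. complex_of_real t \<in> U \<Longrightarrow> f (of_real t) \<in> \<real>"
    and ab: "a < b" "f (of_real a) = 0" "f (of_real b) = 0"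
  obtains t where "a < t" "t < b" "deriv f (of_real t) = 0"
proof -
  have D: "((\<lambda>t. Re (f (of_real t))) has_real_derivative Re (deriv f (of_real t))) (at t)" if "a \<le> t" "t \<le> b" for t
  proof -
    have "(f has_field_derivative deriv f (of_real t)) (at (of_real t))"
      using hol sub that by (intro holomorphic_derivI) auto
    moreover have "(complex_of_real has_vector_derivative 1) (at t)"
      using has_vector_derivative_of_real[OF DERIV_ident, where 'a = complex] by simp
    ultimately have "((\<lambda>t. f (of_real t)) has_vector_derivative deriv f (of_real t)) (at t)"
      using field_vector_diff_chain_at[of complex_of_real 1 t f "deriv f (of_real t)"] by (simp add: o_def)
    then show ?thesis by (rule has_field_derivative_Re)
  qed
  have "\<exists>t. a < t \<and> t < b \<and> DERIV (\<lambda>t. Re (f (of_real t))) t :> 0"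
  proof (rule Rolle)
    show "continuous_on {a..b} (\<lambda>t. Re (f (of_real t)))"
      using D by (intro DERIV_continuous_on[where D = "\<lambda>t. Re (deriv f (of_real t))"])
        (auto intro: has_field_derivative_at_within)
    show "(\<lambda>t. Re (f (of_real t))) differentiable at x" if "a < x" "x < b" for x
      using D[of x] that by (auto simp: real_differentiable_def)
  qed (use ab in auto)
  then obtain t where t: "a < t" "t < b" "DERIV (\<lambda>t. Re (f (of_real t))) t :> 0" by blast
  then have "Re (deriv f (of_real t)) = 0" using D[of t] DERIV_unique by force
  moreover have "deriv f (of_real t) \<in> \<real>"
    using t sub by (intro deriv_in_Reals[OF hol re]) auto
  ultimately have "deriv f (of_real t) = 0" by (auto simp: complex_eq_iff complex_is_Real_iff)
  then show ?thesis using that t by blast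
qed

text \<open>In the upper part of the smaller strip Im (f'/f) is strictly negative, so
  \<open>deriv f\<close> does not vanish there; reflection treats the lower part. The same
  inequality at x + i B bounds |f'| below by |f| times a power of 1/x. Growth passes to the
  derivative by Cauchy's estimate on unit discs, and the gaps by Rolle.\<close>

lemma strip_class_deriv:
  assumes B: "B > 0" and a: "0 < a" "a \<le> 1/2" and f: "strip_class B a f"
  shows "strip_class B (a/4) (deriv f)"
proof -
  obtain T C L where CLT: "C > 0" "L > 0" "T > 0"
    and hol: "f holomorphic_on {w. Re w > T}" and cn: "\<And>w. Re w > T \<Longrightarrow> f (cnj w) = cnj (f w)"
    and gr: "\<And>w. Re w > T \<Longrightarrow> \<bar>Im w\<bar> \<le> Re w powr a \<Longrightarrow> norm (f w) \<le> exp (C * (1 + \<bar>Im w\<bar>) * ln (Re w))"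
    and zr: "\<And>w. Re w > T \<Longrightarrow> \<bar>Im w\<bar> \<le> Re w powr a \<Longrightarrow> f w = 0 \<Longrightarrow> Im w = 0"
    and lo: "\<And>x. x > T \<Longrightarrow> norm (f (Complex x B)) \<ge> exp (- C * ln x)"
    and ze: "\<And>x. x > T \<Longrightarrow> \<exists>t\<in>{x..x+L}. f (of_real t) = 0"
    using f unfolding strip_class_def by auto
  define K where "K = Max {32, 32 * B, 2 * (1 + B), L, 8 * (L + B)}"
  obtain T0 where T0: "\<And>x. x \<ge> T0 \<Longrightarrow> x powr (a/4) \<ge> K \<and> 196608 * C * ln x \<le> (x powr (a/4))\<^sup>2 \<and> (x powr (a/4)) ^ 4 \<ge> K"
    using eventually_strip_constants[OF a(1), of K "196608 * C"] unfolding eventually_at_top_linorder by blast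
  \<comment> \<open>The entry 8 / B gives 8 x \<le> B x^2, so that B / (8 p^2) \<ge> 1/x^2 follows
    from p^2 \<le> x. The entry 8 keeps a unit disc about \<open>w\<close> between the abscissae x/2
    and x^2.\<close>
  define T' where "T' = Max {T0, 2 * T, T + 1, 8 / B, 8, 1}"
  have T': "x > T0" "x > 2 * T" "x > T + 1" "x > 8 / B" "x > 8" if "x > T'" for x
    using that by (auto simp: T'_def)
  have K: "K \<ge> 32" "K \<ge> 32 * B" "K \<ge> 2 * (1 + B)" "K \<ge> L" "K \<ge> 8 * (L + B)" by (auto simp: K_def)
  have big: "x powr (a/4) \<ge> 32" "x powr (a/4) \<ge> 32 * B" "x powr (a/4) \<ge> 2 * (1 + B)" "x powr (a/4) \<ge> L"
      "x > 2 * T" "196608 * C * ln x \<le> (x powr (a/4))\<^sup>2" "x > 2" "(x powr (a/4))^4 \<ge> 8 * (L + B)" if "x > T'" for x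
    using T0[of x] T'[OF that] K by linarith+
  have key: "Im (deriv f z / f z) \<le> - Im z / (8 * (Re z powr (a/4))\<^sup>2)"
    if "Re z > T'" "0 < Im z" "Im z \<le> Re z powr (a/4)" for z
    by (rule Im_log_deriv_strip_class[OF B a CLT hol cn gr zr lo ze refl refl that(2,3) big[OF that(1)]])
  define S where "S = {w. Re w > T}"
  have S: "open S" "f holomorphic_on S" using hol by (auto simp: S_def open_halfspace_Re_gt)
  have cnd: "deriv f (cnj w) = cnj (deriv f w)" if "w \<in> S" for w
    by (rule deriv_reflect[OF S]) (use that cn in \<open>auto simp: S_def\<close>)
  have nzd: "deriv f z \<noteq> 0" if "Re z > T'" "0 < Im z" "Im z \<le> Re z powr (a/4)" for z
  proof -
    have "- Im z / (8 * (Re z powr (a/4))\<^sup>2) < 0"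
      using that big[OF that(1)] by (simp add: divide_neg_pos)
    then show ?thesis using key[OF that] by auto
  qed
  have xsq: "(x powr (a/4))\<^sup>2 \<le> x" if "x > T'" for x
  proof -
    have "(x powr (a/4))\<^sup>2 = x powr (a/2)" using T'[OF that] by (simp add: powr_powr flip: powr_numeral)
    also have "\<dots> \<le> x powr 1" using a T'[OF that] by (intro powr_mono) auto
    finally show ?thesis using T'[OF that] by simp
  qed
  have "(\<exists>T C L. T > 0 \<and> C > 0 \<and> L > 0 \<and>
     deriv f holomorphic_on {w. Re w > T} \<and> (\<forall>w. Re w > T \<longrightarrow> deriv f (cnj w) = cnj (deriv f w)) \<and>
     (\<forall>w. Re w > T \<and> \<bar>Im w\<bar> \<le> Re w powr (a/4) \<longrightarrow> norm (deriv f w) \<le> exp (C * (1 + \<bar>Im w\<bar>) * ln (Re w))) \<and>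
     (\<forall>w. Re w > T \<and> \<bar>Im w\<bar> \<le> Re w powr (a/4) \<and> deriv f w = 0 \<longrightarrow> Im w = 0) \<and>
     (\<forall>x>T. norm (deriv f (Complex x B)) \<ge> exp (- C * ln x)) \<and>
     (\<forall>x>T. \<exists>t\<in>{x..x+L}. deriv f (of_real t) = 0))"
  \<comment> \<open>On the unit disc 1 + |Im u| \<le> 2 (1 + |Im w|) and ln (Re u) \<le> 2 ln x,
    which gives 4 C; the factor 1/x^2 in the lower bound costs 2 more. Rolle is applied to zeros in
    the disjoint intervals [x, x + L] and [x + L + 1, x + 2L + 1], whence the new gap 2L +
    1.\<close>
  proof (rule exI[of _ T'], rule exI[of _ "4 * C + 2"], rule exI[of _ "2 * L + 1"],
      intro conjI allI impI; (elim conjE)?)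
    show "T' > 0" by (simp add: T'_def less_max_iff_disj)
    show "deriv f holomorphic_on {w. Re w > T'}"
      by (rule holomorphic_on_subset[OF holomorphic_deriv[OF S(2,1)]]) (use T' S_def in force)
    show "deriv f (cnj w) = cnj (deriv f w)" if "Re w > T'" for w
      by (rule cnd) (use T' that S_def in force)
    show "Im w = 0" if "Re w > T'" "\<bar>Im w\<bar> \<le> Re w powr (a/4)" "deriv f w = 0" for w
    proof (rule ccontr)
      assume "Im w \<noteq> 0"
      moreover have "deriv f (cnj w) = 0" using that T'(3)[of "Re w"] by (subst cnd) (auto simp: S_def)
      ultimately show False using nzd[of w] nzd[of "cnj w"] that by (cases "Im w > 0") auto
    qed
    show "exp (- (4 * C + 2) * ln x) \<le> norm (deriv f (Complex x B))" if x: "x > T'" for x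
    proof -
      let ?z = "Complex x B" and ?p = "x powr (a/4)"
      have "Im (deriv f ?z / f ?z) \<le> - B / (8 * ?p\<^sup>2)"
        using key[of ?z] x B big(2)[OF x] by simp
      then have "B / (8 * ?p\<^sup>2) \<le> norm (deriv f ?z / f ?z)"
        using abs_Im_le_cmod[of "deriv f ?z / f ?z"] by linarith
      moreover have "1 / x\<^sup>2 \<le> B / (8 * ?p\<^sup>2)"
      proof -
        have "8 * ?p\<^sup>2 \<le> 8 * x" using xsq[OF x] by simp
        also have "\<dots> \<le> B * x * x" using T'(4,5)[OF x] B by (intro mult_right_mono) (auto simp: field_simps)
        finally show ?thesis using big(1)[OF x] T'(5)[OF x] by (simp add: field_simps power2_eq_square)
      qed
      moreover have "exp (- C * ln x) \<le> norm (f ?z)" using T'(3)[OF x] by (intro lo) auto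
      ultimately have "1 / x\<^sup>2 * exp (- C * ln x) \<le> norm (deriv f ?z / f ?z) * norm (f ?z)"
        by (intro mult_mono) auto
      also have "\<dots> \<le> norm (deriv f ?z)" by (simp add: norm_divide)
      finally have "1 / x\<^sup>2 * exp (- C * ln x) \<le> norm (deriv f ?z)" .
      moreover have "1 / x\<^sup>2 = exp (- 2 * ln x)"
        using T'(5)[OF x] exp_double[of "ln x"] by (simp add: exp_minus field_simps)
      ultimately have "exp (- 2 * ln x + - C * ln x) \<le> norm (deriv f ?z)" by (simp only: exp_add)
      moreover have "- (4 * C + 2) * ln x \<le> - 2 * ln x + - C * ln x"
        using CLT T'(5)[OF x] by (simp add: algebra_simps)
      ultimately show ?thesis by (meson exp_le_cancel_iff order_trans)
    qed
    show "norm (deriv f w) \<le> exp ((4 * C + 2) * (1 + \<bar>Im w\<bar>) * ln (Re w))"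
      if w: "Re w > T'" "\<bar>Im w\<bar> \<le> Re w powr (a/4)" for w
    proof -
      let ?x = "Re w" and ?p = "Re w powr (a/4)"
      note xb = T'[OF w(1)] big[OF w(1)]
      have bd: "norm (f u) \<le> exp (C * (2 + \<bar>Im w\<bar>) * (2 * ln ?x))" if u: "norm (w - u) \<le> 1" for u
      proof -
        have "8 * ?x \<le> ?x * ?x" using xb by (intro mult_right_mono) auto
        moreover have "?x - 1 \<le> Re u" "Re u \<le> ?x + 1" 
          using abs_Re_le_cmod[of "w - u"] u by auto
        ultimately have ur: "Re u \<ge> ?x / 2" "Re u \<le> ?x * ?x" "Re u > T" "Re u \<ge> 1"
          using xb(3,5) by linarith+
        have ui: "\<bar>Im u\<bar> \<le> \<bar>Im w\<bar> + 1" using abs_Im_le_cmod[of "w - u"] u by auto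
        have "?x powr a = ?p ^ 4" using xb by (simp add: powr_powr flip: powr_numeral)
        moreover have "?p + 1 \<le> ?p ^ 4 / 2"
        proof -
          have "2 ^ 3 * ?p \<le> ?p ^ 3 * ?p" using xb by (intro mult_right_mono power_mono) auto
          also have "?p ^ 3 * ?p = ?p ^ 4" by (simp add: power_eq_if)
          finally show ?thesis using big(1)[OF w(1)] by simp
        qed
        moreover have "?x powr a / 2 \<le> (?x/2) powr a"
        proof -
          have "(2::real) powr a \<le> 2 powr 1" using a by (intro powr_mono) auto
          then have "?x powr a / 2 \<le> ?x powr a / 2 powr a" by (intro divide_left_mono) auto
          then show ?thesis using xb by (simp add: powr_divide)
        qed
        moreover have "(?x/2) powr a \<le> Re u powr a" using ur xb a by (intro powr_mono2) auto
        ultimately have "\<bar>Im u\<bar> \<le> Re u powr a" using ui w by linarith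
        then have "norm (f u) \<le> exp (C * (1 + \<bar>Im u\<bar>) * ln (Re u))" using ur by (intro gr) auto
        also have "C * (1 + \<bar>Im u\<bar>) * ln (Re u) \<le> C * (2 + \<bar>Im w\<bar>) * (2 * ln ?x)"
        proof (intro mult_mono)
          have "ln (Re u) \<le> ln (?x * ?x)" using ur xb by (subst ln_le_cancel_iff) auto
          then show "ln (Re u) \<le> 2 * ln ?x" using xb by (simp add: ln_mult)
        qed (use CLT ui ur in auto)
        finally show ?thesis by simp
      qed
      have "norm ((deriv ^^ 1) f w) \<le> fact 1 * exp (C * (2 + \<bar>Im w\<bar>) * (2 * ln ?x)) / 1 ^ 1"
      proof (rule Cauchy_inequality)
        have sub: "cball w 1 \<subseteq> S"
        proof
          fix u assume "u \<in> cball w 1"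
          then show "u \<in> S" using abs_Re_le_cmod[of "w - u"] xb by (auto simp: S_def dist_norm)
        qed
        then show "f holomorphic_on ball w 1" using ball_subset_cball by (intro holomorphic_on_subset[OF S(2)]) blast
        show "continuous_on (cball w 1) f"
          using sub S(2) holomorphic_on_imp_continuous_on continuous_on_subset by metis
      qed (use bd in auto)
      then have "norm (deriv f w) \<le> exp (C * (2 + \<bar>Im w\<bar>) * (2 * ln ?x))" by simp
      also have "C * (2 + \<bar>Im w\<bar>) * (2 * ln ?x) \<le> (4 * C + 2) * (1 + \<bar>Im w\<bar>) * ln ?x"
      proof -
        have "C * (2 + \<bar>Im w\<bar>) * 2 \<le> (4 * C + 2) * (1 + \<bar>Im w\<bar>)" using CLT by (simp add: algebra_simps)
        then have "C * (2 + \<bar>Im w\<bar>) * 2 * ln ?x \<le> (4 * C + 2) * (1 + \<bar>Im w\<bar>) * ln ?x"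
          using xb by (intro mult_right_mono) auto
        then show ?thesis by (simp only: mult.assoc)
      qed
      finally show ?thesis by simp
    qed
    show "\<exists>t\<in>{x..x + (2 * L + 1)}. deriv f (of_real t) = 0" if x: "x > T'" for x
    proof -
      obtain u where u: "u \<in> {x..x+L}" "f (of_real u) = 0" using ze[of x] T'[OF x] by auto
      obtain v where v: "v \<in> {x+L+1..x+L+1+L}" "f (of_real v) = 0" 
        using ze[of "x+L+1"] T'[OF x] CLT by auto
      obtain t where t: "u < t" "t < v" "deriv f (of_real t) = 0"
      proof (rule Rolle_complex[OF S(2,1), of u v])
        show "complex_of_real t \<in> S" if "u \<le> t" "t \<le> v" for t 
          using that u T'[OF x] by (auto simp: S_def)
        show "f (of_real t) \<in> \<real>" if "complex_of_real t \<in> S" for t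
          using cn[of "of_real t"] that by (simp add: S_def Reals_cnj_iff)
      qed (use u v in auto)
      then show ?thesis using u v by (intro bexI[of _ t]) auto
    qed
  qed (use CLT in auto)
  then show ?thesis unfolding strip_class_def .
qed

lemma strip_class_higher_deriv:
  assumes B: "B > 0" and a: "0 < a" "a \<le> 1/2" and f: "strip_class B a f"
  shows "strip_class B (a / 4 ^ k) ((deriv ^^ k) f)"
proof (induction k)
  case 0
  then show ?case using f by simp
next
  case (Suc k)
  have "a / 4 ^ k \<le> a / 1" using a by (intro divide_left_mono) auto
  then have "a / 4 ^ k \<le> 1/2" using a by linarith
  then have "strip_class B (a / 4 ^ k / 4) (deriv ((deriv ^^ k) f))"
    using a by (intro strip_class_deriv[OF B _ _ Suc]) auto
  then show ?case by (simp add: mult_ac)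
qed

lemma strip_class_real_zeros:
  assumes "0 < a" "strip_class B a f"
  shows "\<exists>T>0. \<forall>w. Re w > T \<and> \<bar>Im w\<bar> \<le> A \<and> f w = 0 \<longrightarrow> Im w = 0"
proof -
  obtain T where T: "T > 0" "\<And>w. Re w > T \<Longrightarrow> \<bar>Im w\<bar> \<le> Re w powr a \<Longrightarrow> f w = 0 \<Longrightarrow> Im w = 0"
    using assms(2) unfolding strip_class_def by auto
  have "filterlim (\<lambda>x::real. x powr a) at_top at_top" by (rule real_powr_at_top) fact
  then obtain T0 where "\<And>x. x \<ge> T0 \<Longrightarrow> x powr a \<ge> A"
    unfolding filterlim_at_top eventually_at_top_linorder by blast
  then have "Im w = 0" if "Re w > max T T0" "\<bar>Im w\<bar> \<le> A" "f w = 0" for w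
    using T(2)[of w] that by (smt (verit))
  then show ?thesis using T(1) by (intro exI[of _ "max T T0"]) auto
qed

subsection \<open>Real entire functions of exponential type\<close>

text \<open>These are functions of the Laguerre-Polya class of exponential type. The zero function
  is excluded, since its zeros are not all real; \<open>real_entire_class_deriv\<close> therefore
  has a separate alternative for a vanishing derivative.\<close>

definition real_entire_class :: "(complex \<Rightarrow> complex) \<Rightarrow> bool" where
  "real_entire_class f \<longleftrightarrow> f holomorphic_on UNIV \<and> (\<forall>w. f (cnj w) = cnj (f w)) \<and>
     (\<forall>w. f w = 0 \<longrightarrow> Im w = 0) \<and> (\<exists>C>0. \<exists>D>0. \<forall>w. norm (f w) \<le> C * exp (D * norm w))"

lemma log_deriv_error_tendsto_0: "((\<lambda>R::real. y * (512 * (D * R + K) / R\<^sup>2)) \<longlongrightarrow> 0) at_top"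
  by real_asymp

text \<open>A substitute for the partial fraction expansion of f'/f: \<open>log_deriv_local\<close>
  is centred at \<open>z\<close> itself, and as M is linear in R, the error has size 1/R.\<close>

lemma real_entire_log_deriv_approx:
  assumes f: "real_entire_class f" and z: "f z \<noteq> 0"
  shows "\<exists>E. (E \<longlongrightarrow> 0) at_top \<and> eventually (\<lambda>R. \<exists>S n. finite S \<and>
       S = {x. complex_of_real x \<in> cball z (R/2) \<and> f (of_real x) = 0} \<and> (\<forall>x\<in>S. (n x :: nat) > 0) \<and>
       \<bar>Im (deriv f z / f z) + Im z * (\<Sum>x\<in>S. real (n x) / (norm (z - of_real x))\<^sup>2)\<bar> \<le> E R) at_top"
proof -
  obtain C D where CD: "C > 0" "D > 0" "\<And>w. norm (f w) \<le> C * exp (D * norm w)"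
    and hol: "f holomorphic_on UNIV" and cn: "\<And>w. f (cnj w) = cnj (f w)" and zr: "\<And>w. f w = 0 \<Longrightarrow> Im w = 0"
    using f unfolding real_entire_class_def by auto
  \<comment> \<open>D |z| moves the growth bound from the origin to the centre \<open>z\<close>; the
    logarithms replace the constant C by |f z|.\<close>
  define K where "K = D * norm z + \<bar>ln C - ln (norm (f z))\<bar>"
  have K: "K \<ge> 0" using CD by (simp add: K_def)
  define E where "E R = \<bar>Im z\<bar> * (512 * (D * R + K) / R\<^sup>2)" for R
  have "eventually (\<lambda>R. \<exists>S n. finite S \<and>
       S = {x. complex_of_real x \<in> cball z (R/2) \<and> f (of_real x) = 0} \<and> (\<forall>x\<in>S. (n x :: nat) > 0) \<and>
       \<bar>Im (deriv f z / f z) + Im z * (\<Sum>x\<in>S. real (n x) / (norm (z - of_real x))\<^sup>2)\<bar> \<le> E R) at_top"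
    using eventually_gt_at_top[of "8 * \<bar>Im z\<bar>"] eventually_gt_at_top[of 0]
  proof eventually_elim
    case (elim R)
    show ?case
    proof (rule log_deriv_local[of f z "2 * R" R "D * R + K" z])
      show "f holomorphic_on ball z (2 * R)" using hol holomorphic_on_subset by blast
      show "f (of_real t) \<in> \<real>" for t using cn[of "of_real t"] by (simp add: Reals_cnj_iff)
      show "D * R + K > 0" using CD elim K by (simp add: add_pos_nonneg)
      show "norm (f w) \<le> exp (D * R + K) * norm (f z)" if "w \<in> cball z R" for w
      proof -
        have "norm w \<le> norm z + R"
          using that norm_triangle_ineq4[of z "z - w"] by (simp add: dist_norm)
        then have "norm (f w) \<le> C * exp (D * (norm z + R))"
          using CD(3)[of w] CD(1,2) by (smt (verit) exp_le_cancel_iff mult_left_mono)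
        also have "\<dots> = exp (D * R + D * norm z + (ln C - ln (norm (f z)))) * norm (f z)"
          using CD z by (simp add: exp_add exp_diff algebra_simps)
        also have "\<dots> \<le> exp (D * R + K) * norm (f z)"
          by (intro mult_right_mono) (auto simp: K_def)
        finally show ?thesis .
      qed
      show "complex_of_real (Re z) \<in> ball z (R / 8)"
        using elim by (simp add: dist_norm cmod_def)
      fix S n e
      assume "finite S" "S = {x. complex_of_real x \<in> cball z (R/2) \<and> f (of_real x) = 0}"
        "\<And>x. x \<in> S \<Longrightarrow> (n x :: nat) > 0"
        "Im (deriv f z / f z) = e - Im z * (\<Sum>x\<in>S. real (n x) / (norm (z - of_real x))\<^sup>2)"
        "\<bar>e\<bar> \<le> \<bar>Im z\<bar> * (512 * (D * R + K) / R\<^sup>2)"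
      then show ?thesis by (intro exI[of _ S] exI[of _ n]) (auto simp: E_def)
    qed (use elim zr z in auto)
  qed
  then show ?thesis using log_deriv_error_tendsto_0 unfolding E_def by blast
qed

text \<open>Once the disc contains \<open>t\<close>, all other terms have the favourable sign and
  are dropped; then R tends to infinity.\<close>

lemma Im_log_deriv_real_entire:
  assumes f: "real_entire_class f" and z: "f z \<noteq> 0" "Im z > 0" and t: "f (of_real t) = 0"
  shows "Im (deriv f z / f z) \<le> - Im z / (norm (z - of_real t))\<^sup>2"
proof -
  obtain E where E: "(E \<longlongrightarrow> 0) at_top" and ev: "eventually (\<lambda>R. \<exists>S n. finite S \<and>
       S = {x. complex_of_real x \<in> cball z (R/2) \<and> f (of_real x) = 0} \<and> (\<forall>x\<in>S. (n x :: nat) > 0) \<and>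
       \<bar>Im (deriv f z / f z) + Im z * (\<Sum>x\<in>S. real (n x) / (norm (z - of_real x))\<^sup>2)\<bar> \<le> E R) at_top"
    using real_entire_log_deriv_approx[OF f z(1)] by blast
  define c where "c = Im (deriv f z / f z) + Im z / (norm (z - of_real t))\<^sup>2"
  have "eventually (\<lambda>R. c \<le> E R) at_top"
    using ev eventually_ge_at_top[of "2 * dist z (of_real t)"]
  proof eventually_elim
    case (elim R)
    then obtain S n where S: "finite S" "S = {x. complex_of_real x \<in> cball z (R/2) \<and> f (of_real x) = 0}"
      "\<forall>x\<in>S. (n x :: nat) > 0"
      "\<bar>Im (deriv f z / f z) + Im z * (\<Sum>x\<in>S. real (n x) / (norm (z - of_real x))\<^sup>2)\<bar> \<le> E R" by blast
    have tS: "t \<in> S" using t elim(2) by (simp add: S(2))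
    then have "1 \<le> real (n t)" using S(3) by (simp add: Suc_le_eq)
    then have "1 / (norm (z - of_real t))\<^sup>2 \<le> real (n t) / (norm (z - of_real t))\<^sup>2"
      by (intro divide_right_mono) auto
    also have "\<dots> \<le> (\<Sum>x\<in>S. real (n x) / (norm (z - of_real x))\<^sup>2)"
      using S(1) tS by (intro member_le_sum) auto
    finally have "Im z * (1 / (norm (z - of_real t))\<^sup>2) \<le> Im z * (\<Sum>x\<in>S. real (n x) / (norm (z - of_real x))\<^sup>2)"
      using z by (intro mult_left_mono) auto
    then show ?case using S(4) by (simp add: c_def)
  qed
  then have "c \<le> 0" by (intro tendsto_lowerbound[OF E]) auto
  then show ?thesis by (simp add: c_def)
qed

lemma Im_log_deriv_real_entire_no_zeros:
  assumes f: "real_entire_class f" and nz: "\<And>z. f z \<noteq> 0"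
  shows "Im (deriv f z / f z) = 0"
proof -
  obtain E where E: "(E \<longlongrightarrow> 0) at_top" and ev: "eventually (\<lambda>R. \<exists>S n. finite S \<and>
       S = {x. complex_of_real x \<in> cball z (R/2) \<and> f (of_real x) = 0} \<and> (\<forall>x\<in>S. (n x :: nat) > 0) \<and>
       \<bar>Im (deriv f z / f z) + Im z * (\<Sum>x\<in>S. real (n x) / (norm (z - of_real x))\<^sup>2)\<bar> \<le> E R) at_top"
    using real_entire_log_deriv_approx[OF f nz] by blast
  have "eventually (\<lambda>R. \<bar>Im (deriv f z / f z)\<bar> \<le> E R) at_top"
    using ev
  proof eventually_elim
    case (elim R)
    then obtain S n where S: "S = {x. complex_of_real x \<in> cball z (R/2) \<and> f (of_real x) = 0}"
      "\<bar>Im (deriv f z / f z) + Im z * (\<Sum>x\<in>S. real (n x :: nat) / (norm (z - of_real x))\<^sup>2)\<bar> \<le> E R" by blast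
    have "S = {}" using S(1) nz by simp
    then show ?case using S(2) by simp
  qed
  then have "\<bar>Im (deriv f z / f z)\<bar> \<le> 0" by (intro tendsto_lowerbound[OF E]) auto
  then show ?thesis by simp
qed

text \<open>If \<open>f\<close> has a zero, Im (f'/f) is nonzero off the real axis. Otherwise f'/f
  is entire and real-valued on the whole plane, hence constant: \<open>deriv f\<close> vanishes
  identically or nowhere.\<close>

lemma real_entire_class_deriv:
  assumes f: "real_entire_class f"
  shows "(\<forall>w. deriv f w = 0) \<or> real_entire_class (deriv f)"
proof -
  obtain C D where CD: "C > 0" "D > 0" "\<And>w. norm (f w) \<le> C * exp (D * norm w)"
    and hol: "f holomorphic_on UNIV" and cn: "\<And>w. f (cnj w) = cnj (f w)" and zr: "\<And>w. f w = 0 \<Longrightarrow> Im w = 0"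
    using f unfolding real_entire_class_def by auto
  have cnd: "deriv f (cnj w) = cnj (deriv f w)" for w
    by (rule deriv_reflect[OF open_UNIV hol]) (use cn in auto)
  have growth: "norm (deriv f w) \<le> (C * exp D) * exp (D * norm w)" for w
  proof -
    have "norm ((deriv ^^ 1) f w) \<le> fact 1 * ((C * exp D) * exp (D * norm w)) / 1 ^ 1"
    proof (rule Cauchy_inequality)
      show "f holomorphic_on ball w 1" using hol holomorphic_on_subset by blast
      show "continuous_on (cball w 1) f"
        using hol holomorphic_on_imp_continuous_on continuous_on_subset by blast
      fix u assume "norm (w - u) = 1"
      then have "norm u \<le> norm w + 1" using norm_triangle_ineq4[of w "w - u"] by simp
      then have "norm (f u) \<le> C * exp (D * (norm w + 1))"
        using CD(3)[of u] CD(1,2) by (smt (verit) exp_le_cancel_iff mult_left_mono)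
      then show "norm (f u) \<le> (C * exp D) * exp (D * norm w)" by (simp add: exp_add algebra_simps)
    qed auto
    then show ?thesis by simp
  qed
  show ?thesis
  proof (cases "\<exists>t. f (of_real t) = 0")
    case True
    then obtain t where t: "f (of_real t) = 0" by blast
    have nz: "deriv f z \<noteq> 0" if y: "Im z > 0" for z
    proof
      assume d0: "deriv f z = 0"
      have fz: "f z \<noteq> 0" using zr[of z] y by auto
      have "z \<noteq> of_real t" using y by auto
      then show False using Im_log_deriv_real_entire[OF f fz y t] y d0 by (simp add: field_simps)
    qed
    have "Im w = 0" if "deriv f w = 0" for w
      using nz[of w] nz[of "cnj w"] cnd[of w] that by (cases "Im w" "0::real" rule: linorder_cases) auto
    then have "real_entire_class (deriv f)"
      unfolding real_entire_class_def using hol cnd growth CD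
      by (intro conjI exI[of _ "C * exp D"] exI[of _ D] holomorphic_deriv) auto
    then show ?thesis ..
  next
    case False
    have fnz: "f z \<noteq> 0" for z
    proof
      assume z: "f z = 0"
      then have "z = of_real (Re z)" using zr[of z] by (simp add: complex_eq_iff)
      then show False using False z by metis
    qed
    define q where "q z = deriv f z / f z" for z
    have Im_q: "Im (q z) = 0" for z
      using Im_log_deriv_real_entire_no_zeros[OF f fnz] by (simp only: q_def)
    have holq: "q holomorphic_on UNIV"
      unfolding q_def using hol fnz by (auto intro!: holomorphic_intros holomorphic_deriv)
    \<comment> \<open>As \<open>q\<close> is real everywhere, q + i stays at distance 1 from 0, so
      its reciprocal is bounded and Liouville's theorem applies.\<close>
    have qi: "norm (q z + \<i>) \<ge> 1" for z using abs_Im_le_cmod[of "q z + \<i>"] Im_q[of z] by simp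
    have qi0: "q z + \<i> \<noteq> 0" for z using qi[of z] by auto
    have "(\<lambda>z. 1 / (q z + \<i>)) holomorphic_on UNIV"
      using qi0 by (intro holomorphic_intros holq) auto
    moreover have "bounded (range (\<lambda>z. 1 / (q z + \<i>)))"
      using qi by (intro boundedI[of _ 1]) (auto simp: norm_divide divide_le_eq_1)
    ultimately have "(\<lambda>z. 1 / (q z + \<i>)) constant_on UNIV" by (rule Liouville_theorem)
    then obtain c where c: "\<And>z. 1 / (q z + \<i>) = c" unfolding constant_on_def by blast
    have qc: "q z = q w" for z w 
    proof -
      have "1 / (q z + \<i>) = 1 / (q w + \<i>)" using c by simp
      then show ?thesis using qi0[of z] qi0[of w] by (simp add: field_simps)
    qed
    show ?thesis
    proof (cases "q 0 = 0")
      case True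
      then have q0: "q w = 0" for w using qc[of w 0] by simp
      have "deriv f w = 0" for w using q0[of w] fnz[of w] by (simp add: q_def)
      then show ?thesis by blast
    next
      case False
      then have "q w \<noteq> 0" for w using qc[of w 0] by simp
      then have "deriv f w \<noteq> 0" for w by (auto simp: q_def)
      then have "real_entire_class (deriv f)"
        unfolding real_entire_class_def using hol cnd growth CD
        by (intro conjI exI[of _ "C * exp D"] exI[of _ D] holomorphic_deriv) auto
      then show ?thesis ..
    qed
  qed
qed

lemma real_entire_class_higher_deriv:
  assumes "real_entire_class f"
  shows "(\<forall>w. (deriv ^^ k) f w = 0) \<or> real_entire_class ((deriv ^^ k) f)"
proof (induction k)
  case (Suc k)
  then show ?case
  proof
    assume "\<forall>w. (deriv ^^ k) f w = 0"
    then have "(deriv ^^ k) f = (\<lambda>_. 0)" by auto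
    then show ?thesis by simp
  next
    assume "real_entire_class ((deriv ^^ k) f)"
    from real_entire_class_deriv[OF this] show ?thesis by simp
  qed
qed (use assms in auto)

subsection \<open>The digamma function, antisymmetric logarithms and a Phragmen-Lindelof principle\<close>

text \<open>
  The arctangent differences are a telescoping majorant of the errors \<open>1 / (1 + (x + n)\<^sup>2)\<close>.
\<close>

lemma ln_norm_step:
  fixes t :: real
  assumes t: "\<bar>t\<bar> \<ge> 1"
  shows "\<bar>ln (cmod (Complex (x + 1) t)) - ln (cmod (Complex x t)) - Re (inverse (Complex x t))\<bar>
           \<le> 3 * (arctan (x + 1) - arctan x)"
proof -
  define p where "p v = ln (v\<^sup>2 + t\<^sup>2) / 2" for v
  define p1 where "p1 v = v / (v\<^sup>2 + t\<^sup>2)" for v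
  define p2 where "p2 v = (t\<^sup>2 - v\<^sup>2) / (v\<^sup>2 + t\<^sup>2)\<^sup>2" for v
  have t1: "t\<^sup>2 \<ge> 1" using power_mono[of 1 "\<bar>t\<bar>" 2] t by simp
  have pos: "v\<^sup>2 + t\<^sup>2 > 0" for v using t1 zero_le_power2[of v] by linarith
  have lnp: "ln (cmod (Complex v t)) = p v" for v
    using pos[of v] by (simp add: p_def cmod_def ln_sqrt)
  have Rep: "Re (inverse (Complex v t)) = p1 v" for v
    by (simp add: p1_def)
  have D1: "(p has_real_derivative p1 v) (at v)" for v
  proof -
    have "((\<lambda>v. ln (v\<^sup>2 + t\<^sup>2)) has_real_derivative 1 / (v\<^sup>2 + t\<^sup>2) * (2 * v)) (at v)"
      using pos[of v] by (auto intro!: derivative_eq_intros)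
    moreover have "1 / S * (2 * v) / 2 = v / S" for S :: real by simp
    ultimately show ?thesis unfolding p_def p1_def by (metis DERIV_cdivide)
  qed
  have D2: "(p1 has_real_derivative p2 v) (at v)" for v
    unfolding p1_def p2_def using pos[of v]
    by (auto intro!: derivative_eq_intros simp: power2_eq_square)
  obtain \<xi> where \<xi>: "x < \<xi>" "\<xi> < x + 1" "p (x+1) - p x = p1 \<xi>"
    using MVT2[of x "x+1" p p1] D1 by auto
  obtain \<eta> where \<eta>: "x < \<eta>" "\<eta> < \<xi>" "p1 \<xi> - p1 x = (\<xi> - x) * p2 \<eta>"
    using MVT2[of x \<xi> p1 p2] D2 \<xi> by auto
  obtain \<zeta> where \<zeta>: "x < \<zeta>" "\<zeta> < x + 1" "arctan (x+1) - arctan x = inverse (1 + \<zeta>\<^sup>2)"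
    using MVT2[of x "x+1" arctan "\<lambda>v. inverse (1 + v\<^sup>2)"] DERIV_arctan by auto
  have "\<bar>p2 \<eta>\<bar> \<le> (\<eta>\<^sup>2 + t\<^sup>2) / (\<eta>\<^sup>2 + t\<^sup>2)\<^sup>2"
  proof -
    have "\<bar>t\<^sup>2 - \<eta>\<^sup>2\<bar> \<le> \<eta>\<^sup>2 + t\<^sup>2" using zero_le_power2[of t] zero_le_power2[of \<eta>] by linarith
    then show ?thesis unfolding p2_def abs_divide using pos[of \<eta>] by (intro frac_le) auto
  qed
  also have "\<dots> = 1 / (\<eta>\<^sup>2 + t\<^sup>2)" using pos[of \<eta>] by (simp add: power2_eq_square)
  also have "\<dots> \<le> 1 / (1 + \<eta>\<^sup>2)" using t1 by (intro frac_le) (auto simp: add_pos_nonneg)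
  \<comment> \<open>Both mean-value points lie in one unit interval, on which 1 + v^2 varies by a
    factor of at most 3.\<close>
  also have "\<dots> \<le> 3 * inverse (1 + \<zeta>\<^sup>2)"
  proof -
    have "\<bar>\<zeta> - \<eta>\<bar> \<le> 1" using \<zeta> \<eta> \<xi> by auto
    then have "(\<zeta> - \<eta>)\<^sup>2 \<le> 1" using power_mono[of "\<bar>\<zeta> - \<eta>\<bar>" 1 2] by simp
    moreover have "\<zeta>\<^sup>2 \<le> 2 * (\<zeta> - \<eta>)\<^sup>2 + 2 * \<eta>\<^sup>2"
      using zero_le_power2[of "\<zeta> - 2 * \<eta>"] by (simp add: power2_eq_square algebra_simps)
    moreover have "d \<le> 1 \<Longrightarrow> z \<le> 2 * d + 2 * u \<Longrightarrow> 0 \<le> u \<Longrightarrow> 1 + z \<le> 3 * (1 + u)" for d z u :: real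
      by simp
    ultimately have "1 + \<zeta>\<^sup>2 \<le> 3 * (1 + \<eta>\<^sup>2)" using zero_le_power2 by blast
    then show ?thesis by (simp add: field_simps add_pos_nonneg)
  qed
  finally have "\<bar>p2 \<eta>\<bar> \<le> 3 * (arctan (x+1) - arctan x)" using \<zeta> by simp
  moreover have "\<bar>p1 \<xi> - p1 x\<bar> \<le> 1 * \<bar>p2 \<eta>\<bar>"
    unfolding \<eta>(3) abs_mult using \<eta> \<xi> by (intro mult_right_mono) auto
  ultimately show ?thesis unfolding lnp Rep \<xi>(3) by linarith
qed

text \<open>Digamma is the limit of ln m minus the sum of 1/(z + n) over n < m. The sum is compared
  term by term with the telescoping increments of ln |z + n|. By \<open>ln_norm_step\<close> the
  total error is at most three times an arctangent difference, uniformly in Re z.\<close>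

lemma Re_Digamma_bound:
  assumes "\<bar>Im z\<bar> \<ge> 1"
  shows "\<bar>Re (Digamma z) - ln (cmod z)\<bar> \<le> 3 * pi"
proof -
  have z: "z \<noteq> 0" using assms by auto
  define A where "A m = Re (of_real (ln (real m)) - (\<Sum>n<m. inverse (z + of_nat n))) - ln (cmod z)" for m :: nat
  define B where "B m = ln (real m) - ln (cmod (z + of_nat m))" for m :: nat
  have "A \<longlonglongrightarrow> Re (Digamma z) - ln (cmod z)"
    unfolding A_def by (intro tendsto_intros Digamma_LIMSEQ z)
  moreover have "B \<longlonglongrightarrow> 0"
  proof -
    have "(\<lambda>m. - ln (cmod (1 + z / of_nat m))) \<longlonglongrightarrow> - ln (cmod (1 + 0))"
      by (intro tendsto_intros lim_const_over_n) auto
    then have "(\<lambda>m. - ln (cmod (1 + z / of_nat m))) \<longlonglongrightarrow> 0" by simp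
    moreover have "eventually (\<lambda>m. - ln (cmod (1 + z / of_nat m)) = B m) sequentially"
      using eventually_gt_at_top[of 0]
    proof eventually_elim
      case (elim m)
      have "z + of_nat m \<noteq> 0" using assms by (auto simp: complex_eq_iff)
      moreover have "1 + z / of_nat m = (z + of_nat m) / of_nat m" using elim by (simp add: field_simps)
      ultimately show ?case using elim by (simp add: B_def norm_divide ln_div)
    qed
    ultimately show ?thesis by (rule Lim_transform_eventually)
  qed
  ultimately have lim: "(\<lambda>m. \<bar>A m - B m\<bar>) \<longlonglongrightarrow> \<bar>Re (Digamma z) - ln (cmod z) - 0\<bar>"
    by (intro tendsto_intros)
  have "\<bar>A m - B m\<bar> \<le> 3 * pi" for m
  proof -
    define L where "L n = ln (cmod (z + of_nat n))" for n :: nat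
    define ac where "ac n = arctan (Re z + real n)" for n :: nat
    have step: "\<bar>(L (Suc n) - L n) - Re (inverse (z + of_nat n))\<bar> \<le> 3 * (ac (Suc n) - ac n)" for n
    proof -
      have "z + of_nat n = Complex (Re z + real n) (Im z)" "z + of_nat (Suc n) = Complex (Re z + real n + 1) (Im z)"
        by (auto simp: complex_eq_iff)
      then show ?thesis using ln_norm_step[OF assms, of "Re z + real n"] by (simp add: L_def ac_def add_ac)
    qed
    have "A m - B m = (L m - L 0) - (\<Sum>n<m. Re (inverse (z + of_nat n)))"
      by (simp add: A_def B_def L_def)
    also have "L m - L 0 = (\<Sum>n<m. L (Suc n) - L n)" by (rule sum_lessThan_telescope[symmetric])
    also have "\<dots> - (\<Sum>n<m. Re (inverse (z + of_nat n))) = (\<Sum>n<m. (L (Suc n) - L n) - Re (inverse (z + of_nat n)))"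
      by (rule sum_subtractf[symmetric])
    also have "\<bar>\<dots>\<bar> \<le> (\<Sum>n<m. \<bar>(L (Suc n) - L n) - Re (inverse (z + of_nat n))\<bar>)" by (rule sum_abs)
    also have "\<dots> \<le> (\<Sum>n<m. 3 * (ac (Suc n) - ac n))" by (intro sum_mono step)
    also have "\<dots> = 3 * (ac m - ac 0)" by (simp only: sum_distrib_left[symmetric] sum_lessThan_telescope)
    also have "\<dots> \<le> 3 * pi" 
      using arctan_bounded[of "Re z + real m"] arctan_bounded[of "Re z"] by (simp add: ac_def)
    finally show ?thesis .
  qed
  then have "\<bar>Re (Digamma z) - ln (cmod z) - 0\<bar> \<le> 3 * pi"
    by (intro LIMSEQ_le_const2[OF lim]) auto
  then show ?thesis by simp
qed

text \<open>The symmetry makes the exponential of l0(w) + cnj (l0(cnj w)) equal to 1, so this sum is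
  a constant \<open>c\<close>. The factor 2 makes exp l a square root of \<open>h\<close>, which is
  what divides the functional equation evenly between the two sides.\<close>

lemma antisymmetric_log:
  fixes h :: "complex \<Rightarrow> complex"
  assumes U: "open U" "convex U" "\<And>w. w \<in> U \<Longrightarrow> cnj w \<in> U" "complex_of_real x0 \<in> U"
    and hol: "h holomorphic_on U" and sym: "\<And>w. w \<in> U \<Longrightarrow> h w * cnj (h (cnj w)) = 1"
  obtains l where "l holomorphic_on U" "\<And>w. w \<in> U \<Longrightarrow> h w = exp (2 * l w)"
    "\<And>w. w \<in> U \<Longrightarrow> l (cnj w) = - cnj (l w)"
proof -
  have nz: "h w \<noteq> 0" if "w \<in> U" for w using sym[OF that] by auto
  obtain l0 where l0: "l0 holomorphic_on U" "\<And>w. w \<in> U \<Longrightarrow> h w = exp (l0 w)"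
    using contractible_imp_holomorphic_log[OF hol convex_imp_contractible[OF U(2)] nz] by blast
  define k where "k w = l0 w + (cnj \<circ> l0 \<circ> cnj) w" for w
  have "cnj ` U = U" using U(3) by (metis complex_cnj_cnj image_eqI subsetI subset_antisym image_subset_iff)
  then have holk: "k holomorphic_on U"
    unfolding k_def using l0 U by (intro holomorphic_intros holomorphic_on_compose_cnj_cnj) auto
  have ek: "exp (k w) = 1" if "w \<in> U" for w
    using sym[OF that] l0(2) that U(3) by (simp add: k_def exp_add exp_cnj)
  have "deriv k w = 0" if "w \<in> U" for w
  proof -
    have "(k has_field_derivative deriv k w) (at w)" by (rule holomorphic_derivI[OF holk U(1) that])
    then have "((\<lambda>w. exp (k w)) has_field_derivative exp (k w) * deriv k w) (at w)"
      by (auto intro!: derivative_eq_intros)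
    then have "((\<lambda>w. 1) has_field_derivative exp (k w) * deriv k w) (at w)"
      by (rule has_field_derivative_transform_within_open[OF _ U(1) that]) (use ek in auto)
    then have "exp (k w) * deriv k w = 0" using DERIV_unique DERIV_const by blast
    then show ?thesis by simp
  qed
  then have "\<exists>c. \<forall>w\<in>U. k w = c"
    using holomorphic_derivI[OF holk U(1)] by (intro has_field_derivative_zero_constant[OF U(2)]) metis
  then obtain c where c: "\<And>w. w \<in> U \<Longrightarrow> k w = c" by blast
  \<comment> \<open>At a real point the sum is twice a real part; a real \<open>c\<close> with exp c
    = 1 is 0.\<close>
  have "c = of_real (2 * Re (l0 (of_real x0)))"
    using c[OF U(4)] by (simp add: k_def complex_eq_iff)
  moreover have "exp c = 1" using ek[OF U(4)] c[OF U(4)] by simp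
  ultimately have "c = 0" by (metis exp_of_real of_real_eq_1_iff exp_eq_one_iff of_real_0)
  then have anti: "l0 (cnj w) = - cnj (l0 w)" if "w \<in> U" for w
    using c[of "cnj w"] U(3)[OF that] by (simp add: k_def add_eq_0_iff2)
  show ?thesis
    by (rule that[of "\<lambda>w. l0 w / 2"]) (use l0 anti in \<open>auto intro!: holomorphic_intros\<close>)
qed

text \<open>In a half strip w / Re w tends to 1, and so does its N-th power. Hence exp (- e w^N)
  decays there for every N, which makes it a convergence factor against any finite order.\<close>

lemma Re_power_strip:
  assumes B: "B > 0"
  shows "\<exists>X\<ge>1. \<forall>w. Re w \<ge> X \<and> \<bar>Im w\<bar> \<le> B \<longrightarrow> Re (w ^ N) \<ge> Re w ^ N / 2"
proof -
  have "isCont (\<lambda>z::complex. (1 + z) ^ N) 0" by (intro continuous_intros)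
  then have "\<exists>d>0. \<forall>z::complex. dist z 0 < d \<longrightarrow> dist ((1 + z) ^ N) ((1 + 0) ^ N) < 1/2"
    unfolding continuous_at_eps_delta by (drule_tac spec[of _ "1/2"]) simp
  then obtain d where d: "d > 0" "\<And>z::complex. dist z 0 < d \<Longrightarrow> dist ((1 + z) ^ N) ((1 + 0) ^ N) < 1/2"
    by blast
  define X where "X = max 1 (2 * B / d)"
  have "Re (w ^ N) \<ge> Re w ^ N / 2" if w: "Re w \<ge> X" "\<bar>Im w\<bar> \<le> B" for w
  proof -
    define z where "z = \<i> * of_real (Im w / Re w)"
    have x: "Re w \<ge> 1" "Re w \<ge> 2 * B / d" using w by (auto simp: X_def)
    have "norm z = \<bar>Im w\<bar> / Re w" using x by (simp add: z_def norm_mult norm_divide)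
    also have "\<dots> \<le> B / Re w" using w x by (intro divide_right_mono) auto
    also have "\<dots> < d" using x d(1) B by (simp add: field_simps)
    finally have "dist ((1 + z) ^ N) 1 < 1/2" using d(2)[of z] by simp
    then have "Re ((1 + z) ^ N) \<ge> 1/2" using abs_Re_le_cmod[of "(1+z)^N - 1"] by (simp add: dist_norm)
    moreover have "w = of_real (Re w) * (1 + z)" using x by (simp add: z_def complex_eq_iff)
    then have "w ^ N = of_real (Re w ^ N) * (1 + z) ^ N" by (metis power_mult_distrib of_real_power)
    then have "Re (w ^ N) = Re w ^ N * Re ((1 + z) ^ N)" by simp
    ultimately show ?thesis using x by (simp add: mult_left_mono)
  qed
  then show ?thesis by (intro exI[of _ X]) (auto simp: X_def)
qed

text \<open>The maximum principle is applied to f(w) w^(-k) exp (- e w^(n+1)) on rectangles, and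
  then e tends to 0. The power n + 1 beats the a priori growth of order n on the far side.\<close>

lemma Phragmen_Lindelof_half_strip:
  assumes hol: "f holomorphic_on {w. Re w > T0}" and T: "T0 < T" "T > 0" and B: "B > 0"
    and fin: "\<And>w. Re w \<ge> T \<Longrightarrow> \<bar>Im w\<bar> \<le> B \<Longrightarrow> norm (f w) \<le> A * exp (D * norm w ^ n)"
    and edge: "\<And>w. Re w \<ge> T \<Longrightarrow> \<bar>Im w\<bar> = B \<Longrightarrow> norm (f w) \<le> E * norm w ^ k"
  shows "\<exists>C. \<forall>w. Re w \<ge> T \<and> \<bar>Im w\<bar> \<le> B \<longrightarrow> norm (f w) \<le> C * norm w ^ k"
proof -
  obtain X0 where X0: "X0 \<ge> 1" "\<And>w. Re w \<ge> X0 \<Longrightarrow> \<bar>Im w\<bar> \<le> B \<Longrightarrow> Re (w ^ Suc n) \<ge> Re w ^ Suc n / 2"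
    using Re_power_strip[OF B, of "Suc n"] by blast
  \<comment> \<open>Left of \<open>X1\<close> the lower bound for Re (w^(n+1)) may fail, but that
    part of the half strip is compact and bounded by \<open>C0\<close>.\<close>
  define X1 where "X1 = max X0 T"
  have X1: "X1 \<ge> X0" "X1 \<ge> T" "X1 > 0" using T by (auto simp: X1_def)
  define g where "g w = f w / w ^ k" for w
  define S where "S = {w. Re w > max T0 0}"
  have S: "open S" unfolding S_def by (rule open_halfspace_Re_gt)
  have holg: "g holomorphic_on S"
    unfolding g_def S_def by (intro holomorphic_intros holomorphic_on_subset[OF hol]) auto
  have "compact (cbox (Complex T (-B)) (Complex X1 B))" by (rule compact_cbox)
  moreover have "continuous_on (cbox (Complex T (-B)) (Complex X1 B)) g"
    using holomorphic_on_imp_continuous_on[OF holg] T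
    by (rule_tac continuous_on_subset) (auto simp: S_def in_cbox_complex_iff)
  ultimately have "bounded (g ` cbox (Complex T (-B)) (Complex X1 B))"
    by (intro compact_imp_bounded compact_continuous_image)
  then obtain C0 where C0: "\<And>w. w \<in> cbox (Complex T (-B)) (Complex X1 B) \<Longrightarrow> norm (g w) \<le> C0"
    unfolding bounded_iff by blast
  define C where "C = Max {1, C0, E}"
  have C: "C \<ge> 1" "C \<ge> C0" "C \<ge> E" by (auto simp: C_def)
  define A' where "A' = max A 1"
  define D' where "D' = max D 0"
  have finA: "norm (f w) \<le> A' * exp (D' * norm w ^ n)" if "Re w \<ge> T" "\<bar>Im w\<bar> \<le> B" for w
  proof -
    have "A * exp (D * norm w ^ n) \<le> A' * exp (D' * norm w ^ n)"
      by (intro mult_mono) (auto simp: A'_def D'_def intro!: mult_right_mono)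
    then show ?thesis using fin[OF that] by linarith
  qed
  have AD: "A' \<ge> 1" "D' \<ge> 0" by (auto simp: A'_def D'_def)
  have edgeg: "norm (g w) \<le> C" if "Re w \<ge> T" "\<bar>Im w\<bar> = B" for w
  proof -
    have "w \<noteq> 0" using that T by auto
    then have "norm (g w) \<le> E" using edge[OF that] by (simp add: g_def norm_divide norm_power field_simps)
    then show ?thesis using C by simp
  qed
  have main: "norm (g w) \<le> C * exp (e * Re (w ^ Suc n))" if w: "Re w \<ge> X1" "\<bar>Im w\<bar> \<le> B" and e: "e > 0" for w e
  proof -
    \<comment> \<open>On the right side |v| \<le> 2X since B \<le> X. The third entry makes e
      X^(n+1) / 2 at least X^n (D' 2^n + ln A'), which dominates the exponent of the a priori
      bound.\<close>
    define X where "X = Max {Re w, B, 2 / e * (D' * 2 ^ n + ln A')}"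
    have X: "X \<ge> Re w" "X \<ge> B" "X \<ge> 2 / e * (D' * 2 ^ n + ln A')" by (auto simp: X_def)
    have Xb: "X \<ge> X1" "X \<ge> 1" using X w X1 X0 by auto
    define R where "R = cbox (Complex X1 (-B)) (Complex X B)"
    define G where "G w = g w * exp (- of_real e * w ^ Suc n)" for w
    have RS: "R \<subseteq> S" using X1 T by (auto simp: R_def S_def in_cbox_complex_iff)
    have holG: "G holomorphic_on S" unfolding G_def by (intro holomorphic_intros holg)
    have nG: "norm (G w) = norm (g w) * exp (- e * Re (w ^ Suc n))" for w
      by (simp add: G_def norm_mult)
    have "norm (G w) \<le> C"
    proof (rule maximum_modulus_frontier[of G R])
      show "G holomorphic_on interior R" using RS interior_subset by (intro holomorphic_on_subset[OF holG]) blast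
      show "continuous_on (closure R) G"
        using RS holomorphic_on_imp_continuous_on[OF holG] by (simp add: R_def continuous_on_subset)
      show "bounded R" by (simp add: R_def)
      show "w \<in> R" using w X by (auto simp: R_def in_cbox_complex_iff)
      fix v assume "v \<in> frontier R"
      then have "v \<in> R - box (Complex X1 (-B)) (Complex X B)"
        by (simp add: R_def frontier_def)
      then have v: "X1 \<le> Re v" "Re v \<le> X" "\<bar>Im v\<bar> \<le> B" and cs: "Re v = X1 \<or> Re v = X \<or> \<bar>Im v\<bar> = B"
        by (auto simp: R_def in_cbox_complex_iff in_box_complex_iff)
      have pw: "Re (v ^ Suc n) \<ge> Re v ^ Suc n / 2" using X0(2)[of v] v X1 by auto
      moreover have "Re v ^ Suc n \<ge> 0" using v X1 by simp
      ultimately have "Re (v ^ Suc n) \<ge> 0" by linarith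
      then have le1: "exp (- e * Re (v ^ Suc n)) \<le> 1" using e by simp
      have small: "norm (G v) \<le> C" if "norm (g v) \<le> C"
        using mult_mono[OF that le1] C by (simp only: nG) auto
      show "norm (G v) \<le> C"
      proof (cases "Re v = X")
        case True
        have nv: "norm v \<le> 2 * X" "norm v \<ge> 1"
          using cmod_le[of v] True v X Xb abs_Re_le_cmod[of v] by auto
        have "norm (g v) \<le> norm (f v) / 1"
          unfolding g_def norm_divide norm_power using nv(2) one_le_power[OF nv(2), of k]
          by (intro divide_left_mono) (auto intro: less_le_trans[of 0 1])
        also have "\<dots> \<le> A' * exp (D' * norm v ^ n)" using finA[of v] v X1 by simp
        also have "\<dots> \<le> A' * exp (D' * (2 * X) ^ n)"
        proof -
          have "norm v ^ n \<le> (2 * X) ^ n" using nv by (intro power_mono) auto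
          then have "D' * norm v ^ n \<le> D' * (2 * X) ^ n" using AD by (intro mult_left_mono) auto
          then show ?thesis using AD by (intro mult_left_mono) auto
        qed
        finally have "norm (G v) \<le> (A' * exp (D' * (2 * X) ^ n)) * exp (- e * (X ^ Suc n / 2))"
          unfolding nG using pw e True AD by (intro mult_mono) auto
        also have "\<dots> = exp (ln A' + D' * (2 * X) ^ n - e * (X ^ Suc n / 2))"
        proof -
          have "(A' * exp u) * exp (- v) = exp (ln A' + u - v)" for u v
            using AD by (simp add: exp_add exp_diff exp_minus divide_inverse)
          then show ?thesis by simp
        qed
        also have "\<dots> \<le> exp 0"
        proof -
          have "1 * ln A' \<le> X ^ n * ln A'" using AD Xb by (intro mult_right_mono) auto
          then have "ln A' + D' * (2 * X) ^ n \<le> X ^ n * (D' * 2 ^ n + ln A')"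
            by (simp add: algebra_simps power_mult_distrib)
          also have "\<dots> \<le> X ^ n * (e / 2 * X)"
            using X(3) e Xb by (intro mult_left_mono) (auto simp: field_simps)
          finally show ?thesis by (simp add: algebra_simps)
        qed
        finally show ?thesis using C by simp
      next
        case False
        then consider "Re v = X1" | "\<bar>Im v\<bar> = B" using cs by blast
        then show ?thesis
        proof cases
          case 1
          then have "norm (g v) \<le> C0" using v X1 by (intro C0) (auto simp: in_cbox_complex_iff)
          then show ?thesis using small C by simp
        next
          case 2
          then show ?thesis using small edgeg[of v] v X1 by simp
        qed
      qed
    qed
    moreover have "norm (g w) * exp (- u) \<le> C \<Longrightarrow> norm (g w) \<le> C * exp u" for u
      by (simp add: exp_minus field_simps)
    from this[of "e * Re (w ^ Suc n)"] have "norm (G w) \<le> C \<Longrightarrow> ?thesis" by (simp only: nG mult_minus_left)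
    ultimately show ?thesis by simp
  qed
  have gb: "norm (g w) \<le> C" if w: "Re w \<ge> T" "\<bar>Im w\<bar> \<le> B" for w
  proof (cases "Re w \<le> X1")
    case True
    then have "norm (g w) \<le> C0" using w by (intro C0) (auto simp: in_cbox_complex_iff)
    then show ?thesis using C by simp
  next
    case False
    have lim: "((\<lambda>e. C * exp (e * Re (w ^ Suc n))) \<longlongrightarrow> C * exp (0 * Re (w ^ Suc n))) (at_right 0)"
      by (intro tendsto_intros)
    have "eventually (\<lambda>e. norm (g w) \<le> C * exp (e * Re (w ^ Suc n))) (at_right 0)"
      using eventually_at_right_less[of 0] by eventually_elim (use main[of w] False w in auto)
    then have "norm (g w) \<le> C * exp (0 * Re (w ^ Suc n))"
      by (intro tendsto_lowerbound[OF lim]) auto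
    then show ?thesis by simp
  qed
  have "norm (f w) \<le> C * norm w ^ k" if w: "Re w \<ge> T" "\<bar>Im w\<bar> \<le> B" for w
  proof -
    have "w \<noteq> 0" using w T by auto
    then show ?thesis using gb[OF w] by (simp add: g_def norm_divide norm_power field_simps)
  qed
  then show ?thesis by blast
qed

subsection \<open>Twisting to a function real on the real axis\<close>

text \<open>In the application \<open>G\<close> is F on the vertical coordinate s = 1/2 + i w and
  exp l is a square root of \<open>H\<close>, so \<open>f\<close> is the analogue of Hardy's
  Z-function. \<open>lder\<close> is Stirling's formula for the gamma factor, with
  \<open>\<Lambda>\<close> the sum of the \<open>lam j\<close>.\<close>

locale antisymmetric_twist =
  fixes G l f :: "complex \<Rightarrow> complex" and T \<Lambda> K :: real
  assumes T: "T \<ge> 1" and \<Lambda>: "\<Lambda> > 0" and K: "K \<ge> 0"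
    and holG: "G holomorphic_on {w. Re w > T}" and holl: "l holomorphic_on {w. Re w > T}"
    and lcn: "\<And>w. Re w > T \<Longrightarrow> l (cnj w) = - cnj (l w)"
    and lder: "\<And>w. Re w > T \<Longrightarrow> \<bar>Im w\<bar> \<le> Re w \<Longrightarrow> \<bar>Im (deriv l w) + \<Lambda> * ln (Re w)\<bar> \<le> K"
    and f_def: "\<And>w. f w = G w * exp (- l w)"
    and fcn: "\<And>w. Re w > T \<Longrightarrow> f (cnj w) = cnj (f w)"
begin

text \<open>Antisymmetry makes Re l vanish on the real axis; \<open>lder\<close> is then integrated
  along the vertical segment to \<open>w\<close>, which yields the factor |Im w| in the
  error.\<close>

lemma Re_l: 
  assumes "Re w > T" "\<bar>Im w\<bar> \<le> Re w"
  shows "\<bar>Re (l w) - Im w * (\<Lambda> * ln (Re w))\<bar> \<le> K * \<bar>Im w\<bar>"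
proof -
  let ?x = "Re w"
  define c where "c v = of_real ?x + \<i> * complex_of_real v" for v
  define \<phi> where "\<phi> v = Re (l (c v)) - v * (\<Lambda> * ln ?x)" for v
  have der: "(\<phi> has_real_derivative - Im (deriv l (c v)) - \<Lambda> * ln ?x) (at v)" for v
  proof -
    have "(l has_field_derivative deriv l (c v)) (at (c v))"
      using assms by (intro holomorphic_derivI[OF holl open_halfspace_Re_gt]) (simp add: c_def)
    moreover have "(c has_vector_derivative \<i>) (at v)"
      unfolding c_def by (auto intro!: derivative_eq_intros)
    ultimately have "((\<lambda>v. l (c v)) has_vector_derivative \<i> * deriv l (c v)) (at v)"
      using field_vector_diff_chain_at[of c \<i> v l "deriv l (c v)"] by (simp add: o_def)
    then have "((\<lambda>v. Re (l (c v))) has_real_derivative Re (\<i> * deriv l (c v))) (at v)"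
      by (rule has_field_derivative_Re)
    moreover have "((\<lambda>v. v * (\<Lambda> * ln ?x)) has_real_derivative 1 * (\<Lambda> * ln ?x)) (at v)"
      by (intro DERIV_cmult_right DERIV_ident)
    ultimately show ?thesis unfolding \<phi>_def by (rule DERIV_cong[OF DERIV_diff]) simp
  qed
  have "norm (\<phi> (Im w) - \<phi> 0) \<le> K * norm (Im w - 0)"
  proof (rule field_differentiable_bound[where S = "{- ?x..?x}" and f = \<phi> and f' = "\<lambda>v. - Im (deriv l (c v)) - \<Lambda> * ln ?x"])
    show "(\<phi> has_field_derivative - Im (deriv l (c v)) - \<Lambda> * ln ?x) (at v within {- ?x..?x})" for v
      using der has_field_derivative_at_within by blast
    show "norm (- Im (deriv l (c v)) - \<Lambda> * ln ?x) \<le> K" if "v \<in> {- ?x..?x}" for v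
    proof -
      have "\<bar>Im (deriv l (c v)) + \<Lambda> * ln (Re (c v))\<bar> \<le> K"
        using assms that by (intro lder) (auto simp: c_def)
      moreover have "Re (c v) = ?x" by (simp add: c_def)
      ultimately show ?thesis unfolding real_norm_def by (metis abs_minus_cancel minus_diff_eq diff_minus_eq_add add.commute)
    qed
  qed (use assms T in auto)
  moreover have "Re (l (c 0)) = 0"
  proof -
    have "Re (l (cnj (c 0))) = Re (- cnj (l (c 0)))" using assms by (subst lcn) (auto simp: c_def)
    then show ?thesis by (simp add: c_def)
  qed
  moreover have "c (Im w) = w" by (simp add: c_def complex_eq_iff)
  ultimately show ?thesis by (simp add: \<phi>_def)
qed

lemma holf: "f holomorphic_on {w. Re w > T}"
  unfolding f_def[abs_def] by (intro holomorphic_intros holG holl)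

lemma norm_f_reflect: "Re w > T \<Longrightarrow> norm (f (cnj w)) = norm (f w)"
  by (simp add: fcn)

text \<open>As Re s = 1/2 - Im w, the region Im w \<le> - B is the half plane in which the Dirichlet
  series is close to its first term. What is known there about \<open>f\<close> is carried to Im w
  \<ge> B by reflection.\<close>

context
  fixes B A D :: real and n :: nat
  assumes B: "B > 0" and A: "A > 0" and D: "D > 0"
    and near1: "\<And>w. Re w > T \<Longrightarrow> Im w \<le> - B \<Longrightarrow> norm (G w) \<ge> 1/2 \<and> norm (G w) \<le> 3/2 \<and> norm (deriv G w / G w) \<le> 3"
    and fin: "\<And>w. Re w > T \<Longrightarrow> norm (G w) \<le> A * exp (D * norm w ^ n)"
    and zeros: "\<And>w. Re w > T \<Longrightarrow> G w = 0 \<Longrightarrow> Im w = 0"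
begin

lemma far_upper:
  assumes w: "Re w > T" "\<bar>Im w\<bar> \<le> Re w" "\<bar>Im w\<bar> \<ge> B"
  shows "norm (f w) \<le> 3/2 * exp (\<bar>Im w\<bar> * (\<Lambda> * ln (Re w) + K))"
proof -
  have *: "norm (f w) \<le> 3/2 * exp (\<bar>Im w\<bar> * (\<Lambda> * ln (Re w) + K))"
    if w: "Re w > T" "\<bar>Im w\<bar> \<le> Re w" "Im w \<le> - B" for w
  proof -
    have "norm (f w) = norm (G w) * exp (- Re (l w))" by (simp add: f_def norm_mult)
    also have "\<dots> \<le> 3/2 * exp (\<bar>Im w\<bar> * (\<Lambda> * ln (Re w) + K))"
      using near1[OF w(1,3)] Re_l[OF w(1,2)] B w by (intro mult_mono) (auto simp: algebra_simps)
    finally show ?thesis .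
  qed
  show ?thesis
  proof (cases "Im w \<le> - B")
    case False
    then have "Im (cnj w) \<le> - B" using w by auto
    then show ?thesis using *[of "cnj w"] w norm_f_reflect[of w] by simp
  qed (use * w in auto)
qed

text \<open>At x - i B the main term of Re l is - B \<open>\<Lambda>\<close> ln x, so exp (- Re l)
  is at least exp (- B K); the remaining constants are paid for by the factor 1/x.\<close>

lemma lower:
  assumes x: "x > T" "x \<ge> B" "x \<ge> 2 * exp (B * K)"
  shows "norm (f (Complex x B)) \<ge> exp (- ln x)"
proof -
  let ?w = "Complex x (- B)"
  have x0: "x > 0" using x T by simp
  have "exp (- ln x) = 1 / x" using x0 by (simp add: exp_minus inverse_eq_divide)
  also have "\<dots> \<le> 1 / (2 * exp (B * K))" using x x0 by (intro divide_left_mono) auto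
  also have "\<dots> = 1/2 * exp (- (B * K))" by (simp add: exp_minus field_simps)
  also have "\<dots> \<le> norm (G ?w) * exp (- Re (l ?w))"
  proof (intro mult_mono)
    have "0 \<le> B * (\<Lambda> * ln x)" using B \<Lambda> x T by simp
    then show "exp (- (B * K)) \<le> exp (- Re (l ?w))"
      using Re_l[of ?w] x B by (simp add: mult.commute[of K])
  qed (use near1[of ?w] x in auto)
  also have "\<dots> = norm (f ?w)" by (simp add: f_def norm_mult)
  also have "\<dots> = norm (f (Complex x B))" using norm_f_reflect[of ?w] x by (simp add: complex_cnj)
  finally show ?thesis .
qed

text \<open>For |Im w| \<ge> B this is \<open>far_upper\<close>. Inside |Im w| \<le> B only a
  finite-order bound is known beforehand; the polynomial bound on the two edges is carried inwards
  by Phragmen-Lindelof.\<close>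

lemma growth:
  "\<exists>C>0. \<exists>T1>T. \<forall>w. Re w > T1 \<and> \<bar>Im w\<bar> \<le> Re w \<longrightarrow> norm (f w) \<le> exp (C * (1 + \<bar>Im w\<bar>) * ln (Re w))"
proof -
  define T1 where "T1 = Max {T + 1, B, 3}"
  have T1: "T1 > T" "T1 \<ge> B" "T1 \<ge> 3" by (auto simp: T1_def less_max_iff_disj)
  \<comment> \<open>On the edges |f| is at most a constant times x^(B \<open>\<Lambda>\<close>);
    rounding up gives the integer power that is divided out.\<close>
  define k where "k = nat \<lceil>B * \<Lambda>\<rceil>"
  have k: "real k \<ge> B * \<Lambda>" by (simp add: k_def real_nat_ceiling_ge)
  define D' where "D' = D + B * (\<Lambda> + K)"
  have lnx: "ln x \<ge> 1" if "x \<ge> 3" for x :: real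
    using exp_le that by (subst ln_ge_iff) auto
  have "\<exists>C. \<forall>w. Re w \<ge> T1 \<and> \<bar>Im w\<bar> \<le> B \<longrightarrow> norm (f w) \<le> C * norm w ^ k"
  proof (rule Phragmen_Lindelof_half_strip[OF holf T1(1) _ B])
    show "norm (f w) \<le> A * exp (D' * norm w ^ Suc n)" if w: "Re w \<ge> T1" "\<bar>Im w\<bar> \<le> B" for w
    proof -
      have wx: "Re w \<le> norm w" using complex_Re_le_cmod by blast
      have w1: "norm w \<ge> 1" using wx w T1 by simp
      have n1: "norm w ^ n \<ge> 1" using w1 by (rule one_le_power)
      have "norm (f w) = norm (G w) * exp (- Re (l w))" by (simp add: f_def norm_mult)
      also have "\<dots> \<le> (A * exp (D * norm w ^ n)) * exp (B * (\<Lambda> + K) * norm w)"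
      proof (intro mult_mono)
        have "- Re (l w) \<le> \<bar>Im w\<bar> * (\<Lambda> * ln (Re w)) + K * \<bar>Im w\<bar>"
        proof -
          have "\<bar>Im w * (\<Lambda> * ln (Re w))\<bar> = \<bar>Im w\<bar> * (\<Lambda> * ln (Re w))"
            using \<Lambda> w T1 by (simp add: abs_mult)
          then show ?thesis using Re_l[of w] w T1 by linarith
        qed
        also have "\<dots> \<le> B * (\<Lambda> * norm w) + K * B"
        proof (intro add_mono mult_mono)
          show "ln (Re w) \<le> norm w" using ln_le_minus_one[of "Re w"] w T1 wx by simp
        qed (use w T1 \<Lambda> K B in auto)
        also have "\<dots> \<le> B * (\<Lambda> * norm w) + K * B * norm w"
          using mult_left_mono[OF w1, of "K * B"] K B by simp
        finally show "exp (- Re (l w)) \<le> exp (B * (\<Lambda> + K) * norm w)" by (simp add: algebra_simps)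
      qed (use fin[of w] w T1 A in auto)
      also have "\<dots> = A * exp (D * norm w ^ n + B * (\<Lambda> + K) * norm w)" by (simp add: exp_add)
      also have "\<dots> \<le> A * exp (D' * norm w ^ Suc n)"
      proof -
        have "norm w ^ n * 1 \<le> norm w ^ n * norm w" using w1 by (intro mult_left_mono) auto
        then have "D * norm w ^ n \<le> D * norm w ^ Suc n" using D by (intro mult_left_mono) (auto simp: mult.commute)
        moreover have "1 * norm w \<le> norm w ^ n * norm w" using n1 by (intro mult_right_mono) auto
        then have "B * (\<Lambda> + K) * norm w \<le> B * (\<Lambda> + K) * norm w ^ Suc n" 
          using B \<Lambda> K by (intro mult_left_mono) (auto simp: mult.commute)
        ultimately have "D * norm w ^ n + B * (\<Lambda> + K) * norm w \<le> D' * norm w ^ Suc n"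
          unfolding D'_def distrib_right by linarith
        then show ?thesis using A by simp
      qed
      finally show ?thesis .
    qed
    show "norm (f w) \<le> (3/2 * exp (B * K)) * norm w ^ k" if w: "Re w \<ge> T1" "\<bar>Im w\<bar> = B" for w
    proof -
      have "norm (f w) \<le> 3/2 * exp (B * (\<Lambda> * ln (Re w) + K))" using far_upper[of w] w T1 by simp
      also have "\<dots> = 3/2 * exp (B * K) * exp (B * \<Lambda> * ln (Re w))" by (simp add: exp_add algebra_simps)
      also have "\<dots> \<le> 3/2 * exp (B * K) * exp (real k * ln (Re w))"
        using k lnx[of "Re w"] w T1 by (intro mult_left_mono) (auto intro!: mult_right_mono)
      also have "exp (real k * ln (Re w)) = Re w ^ k" using w T1 by (simp add: exp_of_nat_mult)
      also have "3/2 * exp (B * K) * Re w ^ k \<le> 3/2 * exp (B * K) * norm w ^ k"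
        using complex_Re_le_cmod[of w] w T1 by (intro mult_left_mono power_mono) auto
      finally show ?thesis .
    qed
  qed (use T1 in auto)
  then obtain C0 where C0: "\<And>w. Re w \<ge> T1 \<Longrightarrow> \<bar>Im w\<bar> \<le> B \<Longrightarrow> norm (f w) \<le> C0 * norm w ^ k" by blast
  define C1 where "C1 = max 1 C0 * 2 ^ k"
  have C1: "C1 \<ge> 1" using mult_mono[of 1 "max 1 C0" 1 "2 ^ k"] by (simp add: C1_def)
  define C where "C = 1 + \<Lambda> + K + ln C1 + k"
  have "norm (f w) \<le> exp (C * (1 + \<bar>Im w\<bar>) * ln (Re w))" if w: "Re w > T1" "\<bar>Im w\<bar> \<le> Re w" for w
  proof (cases "\<bar>Im w\<bar> \<le> B")
    case True
    have lx: "ln (Re w) \<ge> 1" using lnx w T1 by simp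
    have "norm w \<le> 2 * Re w" using cmod_le[of w] w T1 by simp
    then have "norm w ^ k \<le> (2 * Re w) ^ k" by (intro power_mono) auto
    moreover have "C0 * norm w ^ k \<le> max 1 C0 * norm w ^ k" by (intro mult_right_mono) auto
    moreover have "norm (f w) \<le> C0 * norm w ^ k" using C0[of w] True w by simp
    ultimately have "norm (f w) \<le> max 1 C0 * (2 * Re w) ^ k"
      by (smt (verit) mult_left_mono max.cobounded1)
    also have "\<dots> = exp (ln C1) * exp (real k * ln (Re w))"
      using w T1 C1 by (simp add: exp_of_nat_mult C1_def power_mult_distrib)
    also have "\<dots> = exp (ln C1 + real k * ln (Re w))" by (simp add: exp_add)
    also have "\<dots> \<le> exp (C * (1 + \<bar>Im w\<bar>) * ln (Re w))"
    proof -
      have "ln C1 * 1 \<le> ln C1 * ln (Re w)" using C1 lx by (intro mult_left_mono) auto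
      then have "ln C1 + real k * ln (Re w) \<le> (ln C1 + k) * 1 * ln (Re w)" by (simp add: algebra_simps)
      also have "\<dots> \<le> C * (1 + \<bar>Im w\<bar>) * ln (Re w)"
        using \<Lambda> K C1 lx by (intro mult_right_mono mult_mono) (auto simp: C_def)
      finally show ?thesis by simp
    qed
    finally show ?thesis .
  next
    case False
    have lx: "ln (Re w) \<ge> 1" using lnx w T1 by simp
    have "norm (f w) \<le> 3/2 * exp (\<bar>Im w\<bar> * (\<Lambda> * ln (Re w) + K))" using far_upper[of w] w T1 False by simp
    also have "\<dots> \<le> exp 1 * exp (\<bar>Im w\<bar> * (\<Lambda> * ln (Re w) + K))"
      using exp_ge_add_one_self[of 1] by (intro mult_right_mono) auto
    also have "\<dots> = exp (1 + \<bar>Im w\<bar> * (\<Lambda> * ln (Re w) + K))" by (simp add: exp_add)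
    also have "\<dots> \<le> exp (C * (1 + \<bar>Im w\<bar>) * ln (Re w))"
    proof -
      have "K * 1 \<le> K * ln (Re w)" using K lx by (intro mult_left_mono) auto
      then have "\<bar>Im w\<bar> * (\<Lambda> * ln (Re w) + K) \<le> \<bar>Im w\<bar> * ((\<Lambda> + K) * ln (Re w))"
        by (intro mult_left_mono) (auto simp: algebra_simps)
      also have "\<dots> \<le> \<bar>Im w\<bar> * (C * ln (Re w))"
        using \<Lambda> K C1 lx by (intro mult_left_mono mult_right_mono) (auto simp: C_def)
      moreover have "1 * 1 \<le> C * ln (Re w)" using \<Lambda> K C1 lx by (intro mult_mono) (auto simp: C_def)
      ultimately show ?thesis by (simp add: algebra_simps)
    qed
    finally show ?thesis .
  qed
  moreover have "C > 0" using \<Lambda> K C1 by (simp add: C_def add_pos_nonneg)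
  ultimately show ?thesis using T1 by blast
qed

text \<open>At x - i B one has f'/f = G'/G - l', where the first term is at most 3 and the second
  carries the logarithm. Reflection to x + i B changes the sign of the imaginary part.\<close>

lemma log_deriv_line:
  assumes "x > T" "x \<ge> B"
  shows "Im (deriv f (Complex x B) / f (Complex x B)) \<le> K + 3 - \<Lambda> * ln x"
proof -
  let ?w = "Complex x (- B)"
  have S: "open {w. Re w > T}" by (rule open_halfspace_Re_gt)
  have G0: "G ?w \<noteq> 0" using near1[of ?w] assms by auto
  have dG: "(G has_field_derivative deriv G ?w) (at ?w)" 
    using assms by (intro holomorphic_derivI[OF holG S]) simp
  have dl: "(l has_field_derivative deriv l ?w) (at ?w)" 
    using assms by (intro holomorphic_derivI[OF holl S]) simp
  have "(f has_field_derivative (deriv G ?w * exp (- l ?w) - G ?w * (exp (- l ?w) * deriv l ?w))) (at ?w)"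
    unfolding f_def[abs_def] by (auto intro!: derivative_eq_intros dG dl)
  then have "deriv f ?w / f ?w = deriv G ?w / G ?w - deriv l ?w"
    using G0 by (simp add: DERIV_imp_deriv f_def field_simps)
  then have "Im (deriv f ?w / f ?w) = Im (deriv G ?w / G ?w) - Im (deriv l ?w)" by simp
  moreover have "\<bar>Im (deriv G ?w / G ?w)\<bar> \<le> 3"
    using near1[of ?w] abs_Im_le_cmod[of "deriv G ?w / G ?w"] assms by auto
  moreover have "\<bar>Im (deriv l ?w) + \<Lambda> * ln x\<bar> \<le> K" using lder[of ?w] assms B by auto
  ultimately have ge: "Im (deriv f ?w / f ?w) \<ge> \<Lambda> * ln x - K - 3" by linarith
  have "deriv f (cnj ?w) = cnj (deriv f ?w)"
    by (rule deriv_reflect[OF S holf]) (use assms fcn in auto)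
  moreover have "f (cnj ?w) = cnj (f ?w)" using fcn[of ?w] assms by simp
  moreover have "cnj ?w = Complex x B" by (simp add: complex_eq_iff)
  ultimately have "deriv f (Complex x B) / f (Complex x B) = cnj (deriv f ?w / f ?w)" by simp
  then have "Im (deriv f (Complex x B) / f (Complex x B)) = - Im (deriv f ?w / f ?w)" by (simp only: cnj.simps)
  with ge show ?thesis by linarith
qed

text \<open>
  Without a zero near \<open>x + i B\<close> the imaginary part of \<open>f'/f\<close> there would be at most a small multiple
  of \<open>ln x\<close> by \<open>log_deriv_local\<close>, contradicting \<open>log_deriv_line\<close>.
\<close>

lemma zeros_spacing:
  "\<exists>L>0. \<exists>T2>T. \<forall>x>T2. \<exists>t\<in>{x..x+L}. f (of_real t) = 0"
proof -
  obtain C T1 where C: "C > 0" "T1 > T" 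
    and gr0: "\<forall>w. Re w > T1 \<and> \<bar>Im w\<bar> \<le> Re w \<longrightarrow> norm (f w) \<le> exp (C * (1 + \<bar>Im w\<bar>) * ln (Re w))"
    using growth by blast
  have gr: "norm (f w) \<le> exp (C * (1 + \<bar>Im w\<bar>) * ln (Re w))" if "Re w > T1" "\<bar>Im w\<bar> \<le> Re w" for w
    using gr0 that by simp
  \<comment> \<open>16 B puts the foot x of the centre x + i B within R/8; 1 + B gives 1 + |Im w|
    \<le> 2R on the disc; 14336 = 4 * 7 * 512 makes the error at most \<open>\<Lambda>\<close>/4 *
    ln x; 1/C lets ln x be absorbed into \<open>M\<close>.\<close>
  define R where "R = Max {16 * B, 1 + B, 14336 * B * C / \<Lambda>, 1 / C}"
  have R: "R \<ge> 16 * B" "R \<ge> 1 + B" "R \<ge> 14336 * B * C / \<Lambda>" by (auto simp: R_def)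
  have R0: "R > 0" using R B by linarith
  have "1 / C \<le> R" by (auto simp: R_def)
  then have CR: "1 \<le> 3 * C * R" using C by (simp add: field_simps)
  define T2 where "T2 = Max {T1 + 2 * R, 4 * R, 2 * exp (B * K), exp ((4 * K + 16) / \<Lambda>), 3, T}"
  have zero: "\<exists>t. \<bar>x - t\<bar> \<le> R / 2 \<and> f (of_real t) = 0" if x: "x > T2" for x
  proof (rule ccontr)
    assume no: "\<not> ?thesis"
    have xb: "x > T1 + 2 * R" "x > 4 * R" "x > 2 * exp (B * K)" "x > exp ((4 * K + 16) / \<Lambda>)" "x > 3" "x > T"
      using x by (auto simp: T2_def)
    have lnx: "ln x > (4 * K + 16) / \<Lambda>" using xb(4,5) ln_less_cancel_iff[of "exp ((4 * K + 16) / \<Lambda>)" x] by simp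
    have lnx0: "ln x > 0" using xb by simp
    define w0 where "w0 = Complex x B"
    \<comment> \<open>4 C R ln x bounds the growth exponent on the disc, and 3 C R ln x covers the
      lower bound 1/x at the centre.\<close>
    define M where "M = 7 * C * R * ln x"
    have M: "M > 0" using C R0 lnx0 by (simp add: M_def)
    have ball: "Re w > T1" "Re w \<le> x + 2 * R" "Re w \<ge> x - 2 * R" if "dist w0 w \<le> 2 * R" for w
      using abs_Re_le_cmod[of "w0 - w"] that xb by (auto simp: w0_def dist_norm)
    have im: "\<bar>Im w\<bar> \<le> B + R" if "dist w0 w \<le> R" for w
      using abs_Im_le_cmod[of "w0 - w"] that B by (auto simp: w0_def dist_norm)
    have lo: "norm (f w0) \<ge> exp (- ln x)" unfolding w0_def using xb R B by (intro lower) auto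
    then have w0nz: "f w0 \<noteq> 0" using exp_gt_zero[of "- ln x"] by auto
    obtain n S e where S: "finite (S::real set)" 
      "S = {x. complex_of_real x \<in> cball w0 (R/2) \<and> f (of_real x) = 0}" "\<And>x. x \<in> S \<Longrightarrow> (n x::nat) > 0"
      "Im (deriv f w0 / f w0) = e - Im w0 * (\<Sum>x\<in>S. real (n x) / (norm (w0 - of_real x))\<^sup>2)"
      "\<bar>e\<bar> \<le> \<bar>Im w0\<bar> * (512 * M / R\<^sup>2)"
    proof (rule log_deriv_local[of f w0 "2 * R" R M w0])
      show "f holomorphic_on ball w0 (2 * R)"
      proof (rule holomorphic_on_subset[OF holf], rule subsetI)
        fix w assume "w \<in> ball w0 (2 * R)"
        then show "w \<in> {w. Re w > T}" using ball(1)[of w] C by simp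
      qed
      show "f (of_real t) \<in> \<real>" if "complex_of_real t \<in> ball w0 (2 * R)" for t
        using fcn[of "of_real t"] ball(1)[of "of_real t"] that C by (simp add: Reals_cnj_iff)
      show "norm (f w) \<le> exp M * norm (f w0)" if "w \<in> cball w0 R" for w
      proof -
        have dw: "dist w0 w \<le> R" "dist w0 w \<le> 2 * R" using that R0 by auto
        note wb = ball[OF dw(2)] im[OF dw(1)]
        have "norm (f w) \<le> exp (C * (1 + \<bar>Im w\<bar>) * ln (Re w))"
          using wb xb R by (intro gr) auto
        also have "C * (1 + \<bar>Im w\<bar>) * ln (Re w) \<le> C * (2 * R) * (2 * ln x)"
        proof (intro mult_mono)
          show "1 + \<bar>Im w\<bar> \<le> 2 * R" using wb R by simp
          have "ln (Re w) \<le> ln (2 * x)" using wb xb R0 by simp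
          also have "\<dots> = ln 2 + ln x" using xb by (simp add: ln_mult)
          also have "ln 2 \<le> ln x" using xb by simp
          finally show "ln (Re w) \<le> 2 * ln x" by simp
          show "0 \<le> ln (Re w)" using wb xb R0 by simp
        qed (use C R0 in auto)
        also have "\<dots> \<le> M - ln x"
        proof -
          have "1 * ln x \<le> (3 * C * R) * ln x" using CR lnx0 by (intro mult_right_mono) auto
          then show ?thesis by (simp add: M_def algebra_simps)
        qed
        finally have "norm (f w) \<le> exp M * exp (- ln x)" by (simp add: exp_diff exp_minus field_simps)
        also have "\<dots> \<le> exp M * norm (f w0)" using lo by simp
        finally show ?thesis .
      qed
      show "Im w = 0" if "w \<in> cball w0 (R/2)" "f w = 0" for w
        using zeros[of w] ball(1)[of w] that C R0 by (auto simp: f_def)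
      have "dist w0 (complex_of_real (Re w0)) = B" using B by (simp add: w0_def dist_norm cmod_def)
      then show "complex_of_real (Re w0) \<in> ball w0 (R/8)" using R B by auto
    qed (use R0 M w0nz in auto)
    have "S = {}"
    proof (rule ccontr)
      assume "S \<noteq> {}"
      then obtain t where "dist w0 (of_real t) \<le> R / 2" "f (of_real t) = 0" by (auto simp: S(2))
      then show False using no abs_Re_le_cmod[of "w0 - of_real t"] by (auto simp: w0_def dist_norm)
    qed
    then have "\<bar>Im (deriv f w0 / f w0)\<bar> \<le> B * (512 * M / R\<^sup>2)" using S(4,5) B by (simp add: w0_def)
    also have "\<dots> = 3584 * B * C * ln x / R" using R0 by (simp add: M_def power2_eq_square field_simps)
    also have "\<dots> \<le> \<Lambda> / 4 * ln x"
    proof -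
      have "14336 * B * C \<le> R * \<Lambda>" using R(3) \<Lambda> by (simp add: field_simps)
      then have "14336 * B * C * ln x \<le> R * \<Lambda> * ln x" using lnx0 by (intro mult_right_mono) auto
      then show ?thesis using R0 by (simp add: field_simps)
    qed
    finally have "\<bar>Im (deriv f w0 / f w0)\<bar> \<le> \<Lambda> / 4 * ln x" .
    moreover have "Im (deriv f w0 / f w0) \<le> K + 3 - \<Lambda> * ln x"
      unfolding w0_def using xb R B by (intro log_deriv_line) auto
    moreover have "4 * K + 16 < \<Lambda> * ln x" using lnx \<Lambda> by (simp add: field_simps)
    ultimately show False using K by linarith
  qed
  have "\<exists>t\<in>{x..x+R}. f (of_real t) = 0" if x: "x > T2" for x
  proof -
    obtain t where "\<bar>(x + R/2) - t\<bar> \<le> R / 2" "f (of_real t) = 0" using zero[of "x + R/2"] x R0 by auto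
    moreover from this(1) have "x \<le> t" "t \<le> x + R" unfolding abs_le_iff by linarith+
    ultimately show ?thesis by (intro bexI[of _ t]) auto
  qed
  then have "\<forall>x>max T2 (T + 1). \<exists>t\<in>{x..x+R}. f (of_real t) = 0" by simp
  moreover have "max T2 (T + 1) > T" by simp
  ultimately show ?thesis using R0 by blast
qed

lemma strip_class_f: "strip_class B (1/2) f"
proof -
  obtain C T1 where C: "C > 0" "T1 > T" 
    and gr0: "\<forall>w. Re w > T1 \<and> \<bar>Im w\<bar> \<le> Re w \<longrightarrow> norm (f w) \<le> exp (C * (1 + \<bar>Im w\<bar>) * ln (Re w))"
    using growth by blast
  have gr: "norm (f w) \<le> exp (C * (1 + \<bar>Im w\<bar>) * ln (Re w))" if "Re w > T1" "\<bar>Im w\<bar> \<le> Re w" for w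
    using gr0 that by simp
  obtain L T2 where L: "L > 0" "T2 > T" and sp: "\<And>x. x > T2 \<Longrightarrow> \<exists>t\<in>{x..x+L}. f (of_real t) = 0"
    using zeros_spacing by blast
  define T' where "T' = Max {T1, T2, B, 2 * exp (B * K)}"
  have T': "x > T1" "x > T2" "x > T" "x \<ge> B" "x \<ge> 2 * exp (B * K)" "ln x \<ge> 0" "x \<ge> 1" if "x > T'" for x
    using that T C by (auto simp: T'_def)
  have sq: "x powr (1/2) \<le> x" if "x \<ge> 1" for x :: real
    using powr_mono[of "1/2" 1 x] that by simp
  show ?thesis unfolding strip_class_def
  proof (rule exI[of _ T'], rule exI[of _ "C + 1"], rule exI[of _ L],
      intro conjI allI impI; (elim conjE)?)
    show "T' > 0" using C T by (auto simp: T'_def less_max_iff_disj)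
    show "f holomorphic_on {w. Re w > T'}"
      by (rule holomorphic_on_subset[OF holf]) (use T' in auto)
    show "norm (f w) \<le> exp ((C + 1) * (1 + \<bar>Im w\<bar>) * ln (Re w))" 
      if "Re w > T'" "\<bar>Im w\<bar> \<le> Re w powr (1/2)" for w
    proof -
      note t = T'[OF that(1)]
      have "norm (f w) \<le> exp (C * (1 + \<bar>Im w\<bar>) * ln (Re w))"
        using t sq[of "Re w"] that by (intro gr) auto
      also have "C * (1 + \<bar>Im w\<bar>) * ln (Re w) \<le> (C + 1) * (1 + \<bar>Im w\<bar>) * ln (Re w)"
        using t C by (intro mult_right_mono) auto
      finally show ?thesis by simp
    qed
    show "exp (- (C + 1) * ln x) \<le> norm (f (Complex x B))" if "x > T'" for x
    proof -
      have "exp (- (C + 1) * ln x) \<le> exp (- ln x)" using T'[OF that] C by (simp add: algebra_simps)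
      also have "\<dots> \<le> norm (f (Complex x B))" using T'[OF that] by (intro lower) auto
      finally show ?thesis .
    qed
    show "Im w = 0" if "Re w > T'" "f w = 0" for w
      using zeros[of w] T'[OF that(1)] that by (auto simp: f_def)
  qed (use C L T' sp fcn in auto)
qed

end

end

subsection \<open>The gamma factor and the functions in the iteration\<close>

text \<open>For n \<ge> 2 and Re s \<ge> 2 + k the term is at most 2^(-k) times its size at s = 2,
  so the tail is small once 2^k exceeds twice the absolute sum at 2.\<close>

lemma dirichlet_near_one:
  assumes "dirichlet_series_axiom F"
  obtains B where "B \<ge> 2" "\<And>s. Re s \<ge> B \<Longrightarrow> norm (F s - 1) \<le> 1/2"
proof -
  obtain a :: "nat \<Rightarrow> complex" where a1: "a 1 = 1" and
    a: "\<And>s. Re s > 1 \<Longrightarrow> (\<lambda>n. norm (a n / of_nat n powr s)) summable_on {1..} \<and>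
           ((\<lambda>n. a n / of_nat n powr s) has_sum F s) {1..}"
    using assms unfolding dirichlet_series_axiom_def by auto
  define A where "A = infsum (\<lambda>n. norm (a n / of_nat n powr 2)) {1..}"
  have A: "((\<lambda>n. norm (a n / of_nat n powr 2)) has_sum A) {1..}"
    unfolding A_def using a[of 2] by (simp add: has_sum_infsum)
  have "filterlim (\<lambda>x::real. 2 powr x) at_top at_top" by real_asymp
  then obtain k where k: "k \<ge> 0" "2 powr k \<ge> 2 * A"
    unfolding filterlim_at_top eventually_at_top_linorder by (metis le_cases)
  show ?thesis
  proof (rule that[of "2 + k"])
    fix s assume s: "Re s \<ge> 2 + k"
    define g where "g n = a n / of_nat n powr s" for n :: nat
    have gs: "(g has_sum F s) {1..}" and gabs: "(\<lambda>n. norm (g n)) summable_on {1..}"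
      using a[of s] s k by (auto simp: g_def[abs_def])
    have "(g has_sum F s - 1) ({1..} - {1})"
      using has_sum_Diff[OF gs has_sum_finite[of "{1}" g]] a1 by (simp add: g_def)
    moreover have "(\<lambda>n. norm (g n)) summable_on ({1..} - {1})"
      using gabs by (rule summable_on_subset_banach) auto
    then have ns: "((\<lambda>n. norm (g n)) has_sum infsum (\<lambda>n. norm (g n)) ({1..} - {1})) ({1..} - {1})"
      by (rule has_sum_infsum)
    ultimately have "norm (F s - 1) \<le> infsum (\<lambda>n. norm (g n)) ({1..} - {1})"
      by (rule norm_has_sum_bound[rotated])
    also have "\<dots> \<le> 2 powr (- k) * A"
    proof (rule has_sum_mono_neutral[OF ns has_sum_cmult_right[OF A]])
      fix n :: nat assume "n \<in> ({1..} - {1}) \<inter> {1..}"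
      then have n: "n \<ge> 2" by auto
      have np: "norm (of_nat n powr u :: complex) = real n powr Re u" for u
        using n by (subst norm_powr_real_powr) auto
      have "real n powr (- Re s) \<le> real n powr (- 2) * real n powr (- k)"
        using n s by (subst powr_add[symmetric]) (intro powr_mono, auto)
      also have "\<dots> \<le> real n powr (- 2) * 2 powr (- k)"
        using n k by (intro mult_left_mono powr_mono2') auto
      finally have "norm (a n) * real n powr (- Re s) \<le> norm (a n) * (real n powr (- 2) * 2 powr (- k))"
        by (intro mult_left_mono) auto
      then show "norm (g n) \<le> 2 powr (- k) * norm (a n / of_nat n powr 2)"
        by (simp add: g_def norm_divide norm_power np powr_minus field_simps)
    qed auto
    also have "\<dots> \<le> 1/2" using k by (simp add: powr_minus field_simps)
    finally show "norm (F s - 1) \<le> 1/2" .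
  qed (use k in auto)
qed

lemma near_one_log_deriv:
  assumes hol: "F holomorphic_on {s. Re s > B}" and near: "\<And>s. Re s \<ge> B \<Longrightarrow> norm (F s - 1) \<le> 1/2"
    and s: "Re s > B + 1"
  shows "norm (F s) \<ge> 1/2 \<and> norm (F s) \<le> 3/2 \<and> norm (deriv F s / F s) \<le> 3"
proof -
  have bd: "norm (F u) \<le> 3/2" "norm (F u) \<ge> 1/2" if "Re u \<ge> B" for u
    using near[OF that] norm_triangle_ineq2[of "F u" 1] norm_triangle_ineq2[of 1 "F u"]
    by (auto simp: norm_minus_commute)
  have sub: "cball s 1 \<subseteq> {s. Re s > B}"
  proof
    fix u assume "u \<in> cball s 1"
    then show "u \<in> {s. Re s > B}" using abs_Re_le_cmod[of "s - u"] s by (auto simp: dist_norm)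
  qed
  have "norm ((deriv ^^ 1) F s) \<le> fact 1 * (3/2) / 1 ^ 1"
  proof (rule Cauchy_inequality)
    show "F holomorphic_on ball s 1" using sub ball_subset_cball by (intro holomorphic_on_subset[OF hol]) blast
    show "continuous_on (cball s 1) F"
      using sub hol holomorphic_on_imp_continuous_on continuous_on_subset by metis
    show "norm (F u) \<le> 3/2" if "norm (s - u) = 1" for u
    proof -
      have "u \<in> cball s 1" using that by (simp add: dist_norm)
      then have "Re u > B" using sub by blast
      then show ?thesis using bd by simp
    qed
  qed auto
  then have "norm (deriv F s) \<le> 3/2" by simp
  moreover have "norm (F s) \<ge> 1/2" "norm (F s) \<le> 3/2" using bd[of s] s by auto
  moreover have "norm (deriv F s) / norm (F s) \<le> (3/2) / (1/2)"
    using calculation by (intro frac_le) auto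
  ultimately show ?thesis by (simp add: norm_divide)
qed

lemma finite_order_bound:
  assumes "finite_order g" "g holomorphic_on UNIV"
  obtains A n where "A > 0" "\<And>s. norm (g s) \<le> A * exp (norm s ^ n)"
proof -
  obtain \<rho> where "(\<lambda>s. norm (g s)) \<in> O[at_infinity](\<lambda>s. exp (norm s powr \<rho>))"
    using assms unfolding finite_order_def by auto
  then obtain c where c: "eventually (\<lambda>s. norm (norm (g s)) \<le> c * norm (exp (norm s powr \<rho>))) at_infinity"
    unfolding bigo_def by auto
  then obtain R where R: "\<And>s. norm s \<ge> R \<Longrightarrow> norm (g s) \<le> c * exp (norm s powr \<rho>)"
    unfolding eventually_at_infinity by auto
  define R' where "R' = max R 1"
  define n where "n = nat \<lceil>\<rho>\<rceil>"
  have "bounded (g ` cball 0 R')"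
    using assms(2) by (intro compact_imp_bounded compact_continuous_image)
       (auto intro: holomorphic_on_imp_continuous_on holomorphic_on_subset)
  then obtain b where "\<forall>x\<in>g ` cball 0 R'. norm x \<le> b"
    unfolding bounded_iff by blast
  then have b: "norm (g s) \<le> b" if "norm s \<le> R'" for s using that by simp
  define A where "A = max 1 (max b c)"
  show ?thesis
  proof (rule that[of A n])
    fix s
    show "norm (g s) \<le> A * exp (norm s ^ n)"
    proof (cases "norm s \<le> R'")
      case True
      then have "norm (g s) \<le> A * 1" using b[of s] by (simp add: A_def)
      also have "\<dots> \<le> A * exp (norm s ^ n)" by (intro mult_left_mono) (auto simp: A_def)
      finally show ?thesis .
    next
      case False
      then have s: "norm s \<ge> R" "norm s \<ge> 1" by (auto simp: R'_def)
      have "norm s powr \<rho> \<le> norm s powr real n"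
        using s by (intro powr_mono) (auto simp: n_def real_nat_ceiling_ge)
      also have "\<dots> = norm s ^ n" using s by (subst powr_realpow) auto
      finally have "c * exp (norm s powr \<rho>) \<le> A * exp (norm s ^ n)"
        by (intro mult_mono) (auto simp: A_def)
      then show ?thesis using R[OF s(1)] by simp
    qed
  qed (auto simp: A_def)
qed

lemma has_field_derivative_prod_log:
  fixes g :: "'i \<Rightarrow> complex \<Rightarrow> complex"
  assumes "finite J" "\<And>j. j \<in> J \<Longrightarrow> (g j has_field_derivative g j s * d j) (at s)"
  shows "((\<lambda>s. \<Prod>j\<in>J. g j s) has_field_derivative (\<Prod>j\<in>J. g j s) * (\<Sum>j\<in>J. d j)) (at s)"
  using assms
proof (induction J rule: finite_induct)
  case (insert a J)
  have "((\<lambda>s. g a s * (\<Prod>j\<in>J. g j s)) has_field_derivative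
     (g a s * d a) * (\<Prod>j\<in>J. g j s) + ((\<Prod>j\<in>J. g j s) * (\<Sum>j\<in>J. d j)) * g a s) (at s)"
    using insert by (intro DERIV_mult) auto
  then show ?case using insert.hyps by (simp add: algebra_simps)
qed simp

text \<open>In this sector |s| and Im s are comparable, and the last hypothesis makes the shift
  \<open>\<mu>\<close> at most half of lam * Im s.\<close>

lemma ln_norm_linear_bound:
  assumes lam: "lam > 0" and s: "Im s \<ge> 1" "\<bar>Re s\<bar> \<le> 2 * Im s" "Im s \<ge> 2 * norm \<mu> / lam"
  shows "\<bar>ln (norm (of_real lam * s + \<mu>)) - ln (Im s)\<bar> \<le> \<bar>ln lam\<bar> + ln 4"
proof -
  let ?t = "Im s" and ?n = "norm (of_real lam * s + \<mu>)"
  have m: "norm \<mu> \<le> lam * ?t / 2" using s lam by (simp add: field_simps)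
  have "norm (of_real lam * s) = lam * norm s" using lam by (simp add: norm_mult)
  moreover have "?t \<le> norm s" using abs_Im_le_cmod[of s] by simp
  moreover have "norm s \<le> 3 * ?t" using cmod_le[of s] s by simp
  ultimately have b: "lam * ?t \<le> norm (of_real lam * s)" "norm (of_real lam * s) \<le> 3 * (lam * ?t)"
    using lam by simp_all
  have lt: "lam * ?t > 0" using lam s by simp
  have up: "?n \<le> 4 * (lam * ?t)" using norm_triangle_ineq[of "of_real lam * s" \<mu>] b m lt by linarith
  have low: "?n \<ge> (lam * ?t) / 4" using norm_diff_ineq[of "of_real lam * s" \<mu>] b m lt by linarith
  have n0: "?n > 0" using low lt by linarith
  have "ln ?n \<le> ln (4 * (lam * ?t))" using up n0 lt by (subst ln_le_cancel_iff) auto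
  also have "\<dots> = ln 4 + (ln lam + ln ?t)" using lam s by (simp add: ln_mult)
  finally have 1: "ln ?n \<le> ln 4 + (ln lam + ln ?t)" .
  have "ln ((lam * ?t) / 4) \<le> ln ?n" using low n0 lt by (subst ln_le_cancel_iff) auto
  moreover have "ln ((lam * ?t) / 4) = ln lam + ln ?t - ln 4" using lam s by (simp add: ln_mult ln_div)
  ultimately show ?thesis using 1 by linarith
qed

text \<open>\<open>T\<close> is so large that all Gamma arguments have imaginary part at least 1
  above height \<open>T\<close>: no poles occur there, and \<open>Re_Digamma_bound\<close> applies.
  The half plane Im s > T is invariant under the reflection of s to 1 - cnj s.\<close>

locale gamma_half_plane =
  fixes Q :: real and r :: nat and lam :: "nat \<Rightarrow> real" and \<mu> :: "nat \<Rightarrow> complex" and \<omega> :: complex and T :: real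
  assumes Q: "Q > 0" and lam: "\<And>j. j \<in> {1..r} \<Longrightarrow> lam j > 0" and \<omega>: "norm \<omega> = 1"
    and T1: "T \<ge> 1" and T: "\<And>j. j \<in> {1..r} \<Longrightarrow> lam j * T \<ge> norm (\<mu> j) + 1"
begin

abbreviation "\<gamma> \<equiv> gamma_factor Q r lam \<mu>"
abbreviation "H \<equiv> H_fn Q r lam \<mu> \<omega>"
abbreviation "\<psi> \<equiv> psi_fn Q r lam \<mu> \<omega>"

definition "dlog s = of_real (ln Q) + (\<Sum>j=1..r. of_real (lam j) * Digamma (of_real (lam j) * s + \<mu> j))"

lemma Im_arg: "Im s > T \<Longrightarrow> j \<in> {1..r} \<Longrightarrow> Im (of_real (lam j) * s + \<mu> j) \<ge> 1"
proof -
  assume "Im s > T" "j \<in> {1..r}"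
  then have "lam j * T \<le> lam j * Im s" using lam[of j] by (intro mult_left_mono) auto
  then show ?thesis using T[of j] \<open>j \<in> {1..r}\<close> abs_Im_le_cmod[of "\<mu> j"] by simp
qed

lemma arg_nonpos_Ints: "Im s > T \<Longrightarrow> j \<in> {1..r} \<Longrightarrow> of_real (lam j) * s + \<mu> j \<notin> \<int>\<^sub>\<le>\<^sub>0"
proof
  assume "Im s > T" "j \<in> {1..r}" "of_real (lam j) * s + \<mu> j \<in> \<int>\<^sub>\<le>\<^sub>0"
  moreover from this(3) obtain n where "of_real (lam j) * s + \<mu> j = of_int n" by (elim nonpos_Ints_cases)
  then have "Im (of_real (lam j) * s + \<mu> j) = 0" by (simp only: complex_Im_of_int)
  ultimately show False using Im_arg[of s j] by linarith
qed

lemma gamma_deriv: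
  assumes "Im s > T"
  shows "(\<gamma> has_field_derivative \<gamma> s * dlog s) (at s)"
proof -
  have "((\<lambda>s. \<Prod>j=1..r. Gamma (of_real (lam j) * s + \<mu> j)) has_field_derivative
      (\<Prod>j=1..r. Gamma (of_real (lam j) * s + \<mu> j)) * (\<Sum>j=1..r. of_real (lam j) * Digamma (of_real (lam j) * s + \<mu> j))) (at s)"
    using arg_nonpos_Ints[OF assms]
    by (intro has_field_derivative_prod_log) (auto intro!: derivative_eq_intros)
  moreover have "((\<lambda>s. of_real Q powr s) has_field_derivative of_real Q powr s * of_real (ln Q)) (at s)"
    using Q by (auto intro!: derivative_eq_intros simp: Ln_of_real)
  ultimately have "((\<lambda>s. of_real Q powr s * (\<Prod>j=1..r. Gamma (of_real (lam j) * s + \<mu> j))) has_field_derivative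
      (of_real Q powr s * of_real (ln Q)) * (\<Prod>j=1..r. Gamma (of_real (lam j) * s + \<mu> j)) +
      ((\<Prod>j=1..r. Gamma (of_real (lam j) * s + \<mu> j)) * (\<Sum>j=1..r. of_real (lam j) * Digamma (of_real (lam j) * s + \<mu> j)))
       * of_real Q powr s) (at s)"
    by (intro DERIV_mult)
  then show ?thesis by (simp add: gamma_factor_def[abs_def] dlog_def algebra_simps)
qed

lemma gamma_nz: "Im s > T \<Longrightarrow> \<gamma> s \<noteq> 0"
  using arg_nonpos_Ints[of s] Q by (auto simp: gamma_factor_def Gamma_eq_zero_iff)

lemma H_deriv:
  assumes "Im s > T"
  shows "(H has_field_derivative H s * (- dlog s - cnj (dlog (1 - cnj s)))) (at s)"
proof -
  have s': "Im (1 - cnj s) > T" using assms by simp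
  have "((\<lambda>u. \<gamma> (1 - u)) has_field_derivative (\<gamma> (1 - cnj s) * dlog (1 - cnj s)) * (0 - 1)) (at (cnj s))"
    by (rule DERIV_chain2[where f = \<gamma> and g = "\<lambda>u. 1 - u", OF gamma_deriv[OF s']]) (intro derivative_intros)
  then have "((cnj \<circ> (\<lambda>u. \<gamma> (1 - u)) \<circ> cnj) has_field_derivative
       cnj ((\<gamma> (1 - cnj s) * dlog (1 - cnj s)) * (0 - 1))) (at s)"
    by (intro has_field_derivative_cnj_cnj) auto
  then have 1: "((\<lambda>s. cnj (\<gamma> (1 - cnj s))) has_field_derivative
       - cnj (\<gamma> (1 - cnj s)) * cnj (dlog (1 - cnj s))) (at s)"
    by (simp add: o_def)
  show ?thesis unfolding H_fn_def[abs_def]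
    using gamma_nz[OF assms]
    by (auto intro!: derivative_eq_intros 1 gamma_deriv assms simp: field_simps)
qed

lemma H_nz: "Im s > T \<Longrightarrow> H s \<noteq> 0"
  using gamma_nz[of s] gamma_nz[of "1 - cnj s"] \<omega> by (auto simp: H_fn_def)

lemma H_reflect: "Im s > T \<Longrightarrow> H s * cnj (H (1 - cnj s)) = 1"
  using gamma_nz[of s] gamma_nz[of "1 - cnj s"] \<omega> complex_norm_square[of \<omega>] by (simp add: H_fn_def)

lemma psi_eq: "Im s > T \<Longrightarrow> \<psi> s = - dlog s - cnj (dlog (1 - cnj s))"
  unfolding psi_fn_def using DERIV_imp_deriv[OF H_deriv, of s] H_nz[of s] by simp

lemma Re_dlog:
  "\<exists>K\<ge>0. \<exists>T2\<ge>T. \<forall>s. Im s > T2 \<and> \<bar>Re s\<bar> \<le> 2 * Im s \<longrightarrow> \<bar>Re (dlog s) - (\<Sum>j=1..r. lam j) * ln (Im s)\<bar> \<le> K"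
proof -
  define K where "K = \<bar>ln Q\<bar> + (\<Sum>j=1..r. lam j * (3 * pi + (\<bar>ln (lam j)\<bar> + ln 4)))"
  define T2 where "T2 = T + (\<Sum>j=1..r. 2 * norm (\<mu> j) / lam j)"
  have pos: "0 \<le> 2 * norm (\<mu> j) / lam j" if "j \<in> {1..r}" for j using lam[OF that] by simp
  have T2: "T2 \<ge> T" using sum_nonneg[of "{1..r}" "\<lambda>j. 2 * norm (\<mu> j) / lam j", OF pos] unfolding T2_def by simp
  have T2j: "T2 \<ge> 2 * norm (\<mu> j) / lam j" if "j \<in> {1..r}" for j
  proof -
    have "2 * norm (\<mu> j) / lam j \<le> (\<Sum>j=1..r. 2 * norm (\<mu> j) / lam j)"
      using that pos by (intro member_le_sum) auto
    then show ?thesis using T1 by (simp add: T2_def)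
  qed
  have "\<bar>Re (dlog s) - (\<Sum>j=1..r. lam j) * ln (Im s)\<bar> \<le> K" if s: "Im s > T2" "\<bar>Re s\<bar> \<le> 2 * Im s" for s
  proof -
    have "Re (dlog s) - (\<Sum>j=1..r. lam j) * ln (Im s) =
       ln Q + (\<Sum>j=1..r. lam j * (Re (Digamma (of_real (lam j) * s + \<mu> j)) - ln (Im s)))"
      by (simp add: dlog_def right_diff_distrib sum_subtractf sum_distrib_right)
    also have "\<bar>\<dots>\<bar> \<le> \<bar>ln Q\<bar> + (\<Sum>j=1..r. \<bar>lam j * (Re (Digamma (of_real (lam j) * s + \<mu> j)) - ln (Im s))\<bar>)"
      by (intro order_trans[OF abs_triangle_ineq] add_mono sum_abs) auto
    also have "\<dots> \<le> K" unfolding K_def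
    proof (intro add_mono sum_mono order_refl)
      fix j assume j: "j \<in> {1..r}"
      let ?z = "of_real (lam j) * s + \<mu> j"
      have "\<bar>Re (Digamma ?z) - ln (norm ?z)\<bar> \<le> 3 * pi"
        using Im_arg[of s j] s T2 j by (intro Re_Digamma_bound) auto
      moreover have "\<bar>ln (norm ?z) - ln (Im s)\<bar> \<le> \<bar>ln (lam j)\<bar> + ln 4"
        using s T2 T1 T2j[OF j] lam[OF j] by (intro ln_norm_linear_bound) auto
      ultimately have "\<bar>Re (Digamma ?z) - ln (Im s)\<bar> \<le> 3 * pi + (\<bar>ln (lam j)\<bar> + ln 4)" by linarith
      then show "\<bar>lam j * (Re (Digamma ?z) - ln (Im s))\<bar> \<le> lam j * (3 * pi + (\<bar>ln (lam j)\<bar> + ln 4))"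
        using lam[OF j] unfolding abs_mult by (intro mult_mono) auto
    qed
    finally show ?thesis .
  qed
  moreover have "K \<ge> 0" unfolding K_def using lam
    by (intro add_nonneg_nonneg sum_nonneg mult_nonneg_nonneg) (auto intro: less_imp_le)
  ultimately show ?thesis using T2 by blast
qed

text \<open>\<open>\<psi>\<close> involves \<open>dlog\<close> at \<open>s\<close> and at 1 - cnj s;
  the - 1 in the sector condition keeps the second point inside the sector of
  \<open>Re_dlog\<close>.\<close>

lemma Re_psi:
  "\<exists>K\<ge>0. \<exists>T2\<ge>T. \<forall>s. Im s > T2 \<and> \<bar>Re s\<bar> \<le> 2 * Im s - 1 \<longrightarrow> \<bar>Re (\<psi> s) + 2 * (\<Sum>j=1..r. lam j) * ln (Im s)\<bar> \<le> K"
proof -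
  obtain K T2 where K: "K \<ge> 0" "T2 \<ge> T"
    "\<And>s. Im s > T2 \<Longrightarrow> \<bar>Re s\<bar> \<le> 2 * Im s \<Longrightarrow> \<bar>Re (dlog s) - (\<Sum>j=1..r. lam j) * ln (Im s)\<bar> \<le> K"
    using Re_dlog by blast
  have "\<bar>Re (\<psi> s) + 2 * (\<Sum>j=1..r. lam j) * ln (Im s)\<bar> \<le> 2 * K"
    if s: "Im s > T2" "\<bar>Re s\<bar> \<le> 2 * Im s - 1" for s
  proof -
    have "Re (\<psi> s) = - Re (dlog s) - Re (dlog (1 - cnj s))" using s K by (subst psi_eq) auto
    moreover have "\<bar>Re (dlog s) - (\<Sum>j=1..r. lam j) * ln (Im s)\<bar> \<le> K" using s by (intro K) auto
    moreover have "\<bar>Re (dlog (1 - cnj s)) - (\<Sum>j=1..r. lam j) * ln (Im (1 - cnj s))\<bar> \<le> K"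
      using s by (intro K) auto
    moreover have "Im (1 - cnj s) = Im s" by simp
    ultimately show ?thesis by (simp only: mult.assoc)
  qed
  then show ?thesis using K by (intro exI[of _ "2 * K"]) auto
qed

end

lemma gamma_half_plane_exists:
  assumes "Q > 0" "\<forall>j\<in>{1..r}. lam j > 0 \<and> Re (\<mu> j) \<ge> 0" "norm \<omega> = 1"
  obtains T where "gamma_half_plane Q r lam \<mu> \<omega> T"
proof -
  define T where "T = 1 + (\<Sum>j=1..r. (norm (\<mu> j) + 1) / lam j)"
  have "gamma_half_plane Q r lam \<mu> \<omega> T"
  proof
    have pos: "0 \<le> (norm (\<mu> j) + 1) / lam j" if "j \<in> {1..r}" for j using assms(2) that by (auto intro!: divide_nonneg_pos)
    show "T \<ge> 1"
      using sum_nonneg[of "{1..r}" "\<lambda>j. (norm (\<mu> j) + 1) / lam j", OF pos] unfolding T_def by simp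
    fix j assume j: "j \<in> {1..r}"
    then have l: "lam j > 0" using assms by auto
    have "(norm (\<mu> j) + 1) / lam j \<le> (\<Sum>j=1..r. (norm (\<mu> j) + 1) / lam j)"
      using j pos by (intro member_le_sum) auto
    then have "(norm (\<mu> j) + 1) / lam j \<le> T" by (simp add: T_def)
    then show "norm (\<mu> j) + 1 \<le> lam j * T" using l by (simp add: field_simps)
    show "lam j > 0" by (rule l)
  qed (use assms in auto)
  then show ?thesis by (rule that)
qed

text \<open>With H = exp (2 l) and d/ds = - i d/dw, half of \<open>\<psi>\<close> is - i l'.
  Subtracting it removes exactly the derivative of exp l, so each step of the iteration is a plain
  differentiation of \<open>f\<close>.\<close>

lemma F_iter_twisted:
  fixes F \<psi> f l :: "complex \<Rightarrow> complex"
  assumes V: "open V" and holf: "f holomorphic_on V" and holl: "l holomorphic_on V"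
    and F: "\<And>w. w \<in> V \<Longrightarrow> F (1/2 + \<i> * w) = f w * exp (l w)"
    and \<psi>: "\<And>w. w \<in> V \<Longrightarrow> \<psi> (1/2 + \<i> * w) = - 2 * \<i> * deriv l w"
    and w: "w \<in> V"
  shows "F_iter F \<psi> k (1/2 + \<i> * w) = (- \<i>) ^ k * (deriv ^^ k) f w * exp (l w)"
  using w
proof (induction k arbitrary: w)
  case 0
  then show ?case using F by simp
next
  case (Suc k)
  define \<Phi> where "\<Phi> w = (- \<i>) ^ k * (deriv ^^ k) f w * exp (l w)" for w
  define g where "g s = - \<i> * (s - 1/2)" for s :: complex
  define U where "U = g -` V"
  have "open U" unfolding U_def g_def by (intro open_vimage V continuous_intros)
  have gw: "g (1/2 + \<i> * w) = w" by (simp add: g_def)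
  have gs: "1/2 + \<i> * g s = s" for s by (simp add: g_def algebra_simps)
  have eq: "F_iter F \<psi> k s = \<Phi> (g s)" if "s \<in> U" for s
    using Suc.IH[of "g s"] that unfolding gs U_def \<Phi>_def by simp
  have holk: "(deriv ^^ k) f holomorphic_on V" by (rule holomorphic_higher_deriv[OF holf V])
  have D1: "((deriv ^^ k) f has_field_derivative (deriv ^^ Suc k) f w) (at w)"
    using holomorphic_derivI[OF holk V Suc.prems] by simp
  have D2: "(l has_field_derivative deriv l w) (at w)" by (rule holomorphic_derivI[OF holl V Suc.prems])
  have D\<Phi>: "(\<Phi> has_field_derivative (- \<i>) ^ k * (deriv ^^ Suc k) f w * exp (l w) + \<Phi> w * deriv l w) (at (g (1/2 + \<i> * w)))"
    unfolding gw \<Phi>_def by (auto intro!: derivative_eq_intros D1 D2 simp: algebra_simps)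
  have "((\<lambda>s. \<Phi> (g s)) has_field_derivative ((- \<i>) ^ k * (deriv ^^ Suc k) f w * exp (l w) + \<Phi> w * deriv l w) * (- \<i>)) (at (1/2 + \<i> * w))"
    by (rule DERIV_chain2[where f = \<Phi> and g = g, OF D\<Phi>]) (auto simp: g_def[abs_def] intro!: derivative_eq_intros)
  then have "(F_iter F \<psi> k has_field_derivative ((- \<i>) ^ k * (deriv ^^ Suc k) f w * exp (l w) + \<Phi> w * deriv l w) * (- \<i>)) (at (1/2 + \<i> * w))"
    by (rule has_field_derivative_transform_within_open[OF _ \<open>open U\<close>]) (use Suc.prems gw eq in \<open>auto simp: U_def\<close>)
  then have "deriv (F_iter F \<psi> k) (1/2 + \<i> * w) = ((- \<i>) ^ k * (deriv ^^ Suc k) f w * exp (l w) + \<Phi> w * deriv l w) * (- \<i>)"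
    by (rule DERIV_imp_deriv)
  moreover have "F_iter F \<psi> k (1/2 + \<i> * w) = \<Phi> w" using Suc by (simp add: \<Phi>_def)
  ultimately show ?case by (simp only: F_iter.simps \<psi>[OF Suc.prems]) (simp add: algebra_simps)
qed

text \<open>The zero is given as a limit, which continuity turns into a value. The second conclusion
  says that the derivative does not vanish identically; in degree zero it excludes that alternative
  of \<open>real_entire_class_higher_deriv\<close>.\<close>

lemma isolated_zero_F_iter_twisted:
  fixes F \<psi> f l :: "complex \<Rightarrow> complex"
  assumes V: "open V" and holf: "f holomorphic_on V" and holl: "l holomorphic_on V"
    and F: "\<And>w. w \<in> V \<Longrightarrow> F (1/2 + \<i> * w) = f w * exp (l w)"
    and \<psi>: "\<And>w. w \<in> V \<Longrightarrow> \<psi> (1/2 + \<i> * w) = - 2 * \<i> * deriv l w"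
    and w: "w \<in> V" and iso: "isolated_zero (F_iter F \<psi> k) (1/2 + \<i> * w)"
  shows "(deriv ^^ k) f w = 0" and "\<exists>v\<in>V. (deriv ^^ k) f v \<noteq> 0"
proof -
  define s where "s = 1/2 + \<i> * w"
  define g where "g s = - \<i> * (s - 1/2)" for s :: complex
  define \<Psi> where "\<Psi> u = (- \<i>) ^ k * (deriv ^^ k) f (g u) * exp (l (g u))" for u
  define U where "U = g -` V"
  have "open U" unfolding U_def g_def by (intro open_vimage V continuous_intros)
  have gw: "g s = w" by (simp add: g_def s_def)
  have gs: "1/2 + \<i> * g u = u" for u by (simp add: g_def algebra_simps)
  have eq: "F_iter F \<psi> k u = \<Psi> u" if "u \<in> U" for u
    using F_iter_twisted[OF V holf holl F \<psi>, of "g u" k] that unfolding gs U_def \<Psi>_def by simp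
  have evU: "eventually (\<lambda>u. u \<in> U) (at s)"
    using \<open>open U\<close> w gw by (intro eventually_at_in_open') (auto simp: U_def)
  have "g holomorphic_on U" unfolding g_def by (intro holomorphic_intros)
  then have "\<Psi> holomorphic_on U" unfolding \<Psi>_def
    by (intro holomorphic_intros holomorphic_on_compose_gen[OF _ holomorphic_higher_deriv[OF holf V], unfolded o_def]
          holomorphic_on_compose_gen[OF _ holl, unfolded o_def]) (auto simp: U_def)
  moreover have "s \<in> U" using w gw by (simp add: U_def)
  ultimately have "isCont \<Psi> s"
    using \<open>open U\<close> holomorphic_on_imp_continuous_on continuous_on_eq_continuous_at by blast
  then have "(\<Psi> \<longlongrightarrow> \<Psi> s) (at s)" by (simp add: isCont_def)
  moreover have "(\<Psi> \<longlongrightarrow> 0) (at s)"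
  proof (rule Lim_transform_eventually)
    show "(F_iter F \<psi> k \<longlongrightarrow> 0) (at s)" using iso unfolding isolated_zero_def s_def by blast
    show "eventually (\<lambda>u. F_iter F \<psi> k u = \<Psi> u) (at s)" using evU by eventually_elim (rule eq)
  qed
  ultimately have "\<Psi> s = 0" using LIM_unique by blast
  then show "(deriv ^^ k) f w = 0" by (simp add: \<Psi>_def gw)
  have "eventually (\<lambda>u. F_iter F \<psi> k u \<noteq> 0) (at s)" using iso unfolding isolated_zero_def s_def by blast
  with evU have "eventually (\<lambda>u. g u \<in> V \<and> (deriv ^^ k) f (g u) \<noteq> 0) (at s)"
    by eventually_elim (use eq in \<open>auto simp: U_def \<Psi>_def\<close>)
  then show "\<exists>v\<in>V. (deriv ^^ k) f v \<noteq> 0"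
    using eventually_happens'[OF at_neq_bot] by blast
qed

section \<open>Meromorphy of the iterates and finiteness of their zeros in compact sets\<close>

lemma Gamma_meromorphic: "(Gamma :: complex \<Rightarrow> complex) meromorphic_on UNIV"
proof -
  have "(rGamma :: complex \<Rightarrow> complex) analytic_on UNIV" by (rule analytic_rGamma)
  then have "(\<lambda>z. inverse (rGamma z :: complex)) meromorphic_on UNIV"
    by (intro meromorphic_on_inverse analytic_on_imp_meromorphic_on)
  then show ?thesis by (simp add: Gamma_def[abs_def])
qed

lemma gamma_factor_meromorphic:
  assumes "Q > 0"
  shows "gamma_factor Q r lam \<mu> meromorphic_on UNIV"
proof -
  have "(\<lambda>s. of_real Q powr s) analytic_on UNIV"
    using assms by (simp add: powr_def) (intro analytic_intros)
  moreover have "(\<lambda>s. Gamma (of_real (lam j) * s + \<mu> j)) meromorphic_on UNIV" for j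
    by (rule meromorphic_on_compose[OF Gamma_meromorphic]) (auto intro!: analytic_intros)
  ultimately show ?thesis unfolding gamma_factor_def[abs_def]
    by (intro meromorphic_on_mult meromorphic_on_prod) (auto intro: analytic_on_imp_meromorphic_on)
qed

text \<open>Conjugating the parameters removes the two conjugations, so that \<open>H_fn\<close>
  becomes a quotient of meromorphic functions.\<close>

lemma cnj_gamma_factor:
  assumes "Q > 0"
  shows "cnj (gamma_factor Q r lam \<mu> (1 - cnj s)) = gamma_factor Q r lam (\<lambda>j. cnj (\<mu> j)) (1 - s)"
  using assms by (simp add: gamma_factor_def powr_def Ln_of_real exp_cnj cnj_Gamma)

lemma psi_fn_meromorphic:
  assumes "Q > 0"
  shows "psi_fn Q r lam \<mu> \<omega> meromorphic_on UNIV"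
proof -
  have "(\<lambda>s. gamma_factor Q r lam (\<lambda>j. cnj (\<mu> j)) (1 - s)) meromorphic_on UNIV"
    by (rule meromorphic_on_compose[OF gamma_factor_meromorphic[OF assms]]) (auto intro!: analytic_intros)
  then have "H_fn Q r lam \<mu> \<omega> meromorphic_on UNIV"
    unfolding H_fn_def[abs_def] cnj_gamma_factor[OF assms]
    by (intro meromorphic_intros gamma_factor_meromorphic assms)
  then show ?thesis unfolding psi_fn_def[abs_def] by (intro meromorphic_intros)
qed

lemma F_iter_meromorphic:
  assumes "F meromorphic_on UNIV" "\<psi> meromorphic_on UNIV"
  shows "F_iter F \<psi> k meromorphic_on UNIV"
  by (induction k) (auto intro!: meromorphic_intros assms)

lemma finite_isolated_zeros_compact:
  assumes "f meromorphic_on UNIV" "compact K"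
  shows "finite {s \<in> K. isolated_zero f s}"
proof -
  have "{s. isolated_zero f s} sparse_in UNIV"
    using meromorphic_on_imp_not_zero_cosparse[OF assms(1)] by (simp add: eventually_cosparse)
  then have "{s. isolated_zero f s} sparse_in K" using sparse_in_subset by blast
  then have "finite (K \<inter> {s. isolated_zero f s})" using assms(2) by (intro sparse_in_compact_finite) auto
  then show ?thesis by (simp add: Collect_conj_eq)
qed

subsection \<open>Positive degree\<close>

lemma pole_order_bound_pole_order:
  assumes "F \<in> extended_Selberg_class"
  shows "pole_order_bound F (pole_order F)"
  using assms unfolding extended_Selberg_class_def pole_order_def by (auto intro: LeastI)

lemma extended_Selberg_holomorphic:
  assumes "F \<in> extended_Selberg_class"
  shows "F holomorphic_on - {1}"
proof -
  obtain G where G: "G holomorphic_on UNIV" "\<And>s. s \<noteq> 1 \<Longrightarrow> G s = (s - 1) ^ pole_order F * F s"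
    using pole_order_bound_pole_order[OF assms] unfolding pole_order_bound_def by blast
  have "(\<lambda>s. G s / (s - 1) ^ pole_order F) holomorphic_on - {1}"
    by (intro holomorphic_intros holomorphic_on_subset[OF G(1)]) auto
  then show ?thesis by (rule holomorphic_transform) (use G(2) in auto)
qed

lemma extended_Selberg_meromorphic:
  assumes "F \<in> extended_Selberg_class"
  shows "F meromorphic_on UNIV"
proof -
  obtain G where G: "G holomorphic_on UNIV" "\<And>s. s \<noteq> 1 \<Longrightarrow> G s = (s - 1) ^ pole_order F * F s"
    using pole_order_bound_pole_order[OF assms] unfolding pole_order_bound_def by blast
  have "(\<lambda>s. G s / (s - 1) ^ pole_order F) meromorphic_on UNIV"
    by (intro meromorphic_intros analytic_on_imp_meromorphic_on) (use G(1) analytic_on_open in auto)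
  moreover have "eventually (\<lambda>s. G s / (s - 1) ^ pole_order F = F s) (at z)" for z
  proof -
    have "eventually (\<lambda>s. s \<noteq> 1) (at z)" by (rule eventually_neq_at_within)
    then show ?thesis by eventually_elim (simp add: G(2))
  qed
  ultimately show ?thesis using meromorphic_on_cong[of UNIV "\<lambda>s. G s / (s - 1) ^ pole_order F" F UNIV] by simp
qed

context gamma_half_plane
begin

lemma completed_fn_eq:
  assumes F: "F holomorphic_on - {1}" and s: "Im s > T"
  shows "completed_fn F Q r lam \<mu> s = s ^ pole_order F * (s - 1) ^ pole_order F * \<gamma> s * F s"
proof -
  have "\<gamma> holomorphic_on {s. Im s > T}"
    by (rule holomorphic_onI, rule field_differentiable_at_within)
       (use gamma_deriv in \<open>auto simp: field_differentiable_def\<close>)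
  moreover have "F holomorphic_on {s. Im s > T}"
    using T1 by (intro holomorphic_on_subset[OF F]) auto
  ultimately have "(\<lambda>s. s ^ pole_order F * (s - 1) ^ pole_order F * \<gamma> s * F s) holomorphic_on {s. Im s > T}"
    by (intro holomorphic_intros)
  then have "(\<lambda>s. s ^ pole_order F * (s - 1) ^ pole_order F * \<gamma> s * F s) analytic_on {s. Im s > T}"
    by (simp add: analytic_on_open open_halfspace_Im_gt)
  then have "(\<lambda>s. s ^ pole_order F * (s - 1) ^ pole_order F * \<gamma> s * F s) analytic_on {s}"
    by (rule analytic_on_subset) (use s in auto)
  then show ?thesis unfolding completed_fn_def by (rule remove_sings_at_analytic)
qed

text \<open>The polynomial factor s(s - 1) is invariant under s to 1 - s, so its power cancels from
  the functional equation.\<close>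

lemma F_reflect:
  assumes F: "F holomorphic_on - {1}" and fe: "functional_equation F Q r lam \<mu> \<omega>" and s: "Im s > T"
  shows "F s = H s * cnj (F (1 - cnj s))"
proof -
  define m where "m = pole_order F"
  have s0: "s \<noteq> 0" "s \<noteq> 1" using s T1 by auto
  have "completed_fn F Q r lam \<mu> s = \<omega> * cnj (completed_fn F Q r lam \<mu> (1 - cnj s))"
    using fe unfolding functional_equation_def by blast
  then have "s ^ m * (s - 1) ^ m * \<gamma> s * F s =
      \<omega> * cnj ((1 - cnj s) ^ m * ((1 - cnj s) - 1) ^ m * \<gamma> (1 - cnj s) * F (1 - cnj s))"
    using s by (subst (asm) (1 2) completed_fn_eq[OF F]) (auto simp: m_def)
  also have "\<dots> = ((1 - s) * (- s)) ^ m * (\<omega> * cnj (\<gamma> (1 - cnj s)) * cnj (F (1 - cnj s)))"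
  proof -
    have "cnj (1 - cnj s) = 1 - s" "cnj ((1 - cnj s) - 1) = - s" by simp_all
    then show ?thesis by (simp only: complex_cnj_mult complex_cnj_power power_mult_distrib mult_ac)
  qed
  also have "(1 - s) * (- s) = s * (s - 1)" by (simp add: algebra_simps)
  finally have "(s * (s - 1)) ^ m * (\<gamma> s * F s) = (s * (s - 1)) ^ m * (\<omega> * cnj (\<gamma> (1 - cnj s)) * cnj (F (1 - cnj s)))"
    by (simp add: power_mult_distrib mult_ac)
  then have "\<gamma> s * F s = \<omega> * cnj (\<gamma> (1 - cnj s)) * cnj (F (1 - cnj s))" using s0 by simp
  then show ?thesis using gamma_nz[OF s] by (simp add: H_fn_def field_simps)
qed

end

lemma strip_zeros_positive_degree:
  assumes FS: "F \<in> extended_Selberg_class" and fe: "functional_equation F Q r lam \<mu> \<omega>"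
    and RH: "Riemann_Hypothesis F Q r lam \<mu>" and r: "r \<ge> 1"
  shows "\<exists>T>0. \<forall>s. Im s > T \<and> \<bar>Re s - 1/2\<bar> \<le> A \<and> isolated_zero (F_iter F (psi_fn Q r lam \<mu> \<omega>) k) s \<longrightarrow> Re s = 1/2"
proof -
  have holF: "F holomorphic_on - {1}" by (rule extended_Selberg_holomorphic[OF FS])
  obtain T where "gamma_half_plane Q r lam \<mu> \<omega> T"
    using fe gamma_half_plane_exists[of Q r lam \<mu> \<omega>] unfolding functional_equation_def by blast
  then interpret gamma_half_plane Q r lam \<mu> \<omega> T .
  define c where "c w = 1/2 + \<i> * w" for w
  have Imc: "Im (c w) = Re w" and Rec: "Re (c w) = 1/2 - Im w" for w by (auto simp: c_def)
  have crefl: "1 - cnj (c w) = c (cnj w)" for w by (simp add: c_def complex_eq_iff)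
  have dc: "(c has_field_derivative \<i>) (at w)" for w
    unfolding c_def by (auto intro!: derivative_eq_intros)
  have DHc: "((\<lambda>w. H (c w)) has_field_derivative deriv H (c w) * \<i>) (at w)" if "Re w > T" for w
  proof -
    have "(H has_field_derivative deriv H (c w)) (at (c w))"
      using DERIV_imp_deriv[OF H_deriv, of "c w"] H_deriv[of "c w"] that by (simp add: Imc)
    then show ?thesis by (rule DERIV_chain2[where f = H and g = c]) (rule dc)
  qed
  obtain l where l: "l holomorphic_on {w. Re w > T}" "\<And>w. w \<in> {w. Re w > T} \<Longrightarrow> H (c w) = exp (2 * l w)"
    "\<And>w. w \<in> {w. Re w > T} \<Longrightarrow> l (cnj w) = - cnj (l w)"
  proof (rule antisymmetric_log[of "{w. Re w > T}" "T + 1" "\<lambda>w. H (c w)"])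
    show "(\<lambda>w. H (c w)) holomorphic_on {w. Re w > T}"
      by (rule holomorphic_onI, rule field_differentiable_at_within)
         (use DHc in \<open>auto simp: field_differentiable_def\<close>)
    show "H (c w) * cnj (H (c (cnj w))) = 1" if "w \<in> {w. Re w > T}" for w
      using H_reflect[of "c w"] that by (simp add: Imc crefl)
  qed (auto simp: open_halfspace_Re_gt convex_halfspace_Re_gt)
  have psi_l: "\<psi> (c w) = - 2 * \<i> * deriv l w" if "Re w > T" for w
  proof -
    have "(l has_field_derivative deriv l w) (at w)"
      by (rule holomorphic_derivI[OF l(1) open_halfspace_Re_gt]) (use that in auto)
    then have "((\<lambda>w. exp (2 * l w)) has_field_derivative exp (2 * l w) * (2 * deriv l w)) (at w)"
      by (auto intro!: derivative_eq_intros)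
    then have "((\<lambda>w. H (c w)) has_field_derivative exp (2 * l w) * (2 * deriv l w)) (at w)"
      by (rule has_field_derivative_transform_within_open[OF _ open_halfspace_Re_gt[of T]]) (use that l(2) in auto)
    then have "deriv H (c w) * \<i> = H (c w) * (2 * deriv l w)"
      using DHc[OF that] l(2)[of w] that DERIV_unique by fastforce
    then have "deriv H (c w) = - \<i> * (H (c w) * (2 * deriv l w))" by (metis minus_mult_left mult.assoc mult.commute mult_minus_left i_squared mult_1 minus_minus)
    then show ?thesis using H_nz[of "c w"] that by (simp add: psi_fn_def Imc)
  qed
  obtain K T2 where K: "K \<ge> 0" "T2 \<ge> T" and psiK: "\<And>s. Im s > T2 \<Longrightarrow> \<bar>Re s\<bar> \<le> 2 * Im s - 1 \<Longrightarrow>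
       \<bar>Re (\<psi> s) + 2 * (\<Sum>j=1..r. lam j) * ln (Im s)\<bar> \<le> K"
    using Re_psi by blast
  \<comment> \<open>Height 2 turns |Im w| \<le> Re w into the sector condition |Re s| \<le> 2 Im s -
    1, and keeps \<open>c w\<close> at distance at least 1 from the possible pole.\<close>
  define T3 where "T3 = max T2 2"
  define \<Lambda> where "\<Lambda> = (\<Sum>j=1..r. lam j)"
  have \<Lambda>: "\<Lambda> > 0" unfolding \<Lambda>_def using lam r by (intro sum_pos) auto
  have T3: "T3 \<ge> T" "T3 \<ge> T2" "T3 \<ge> 2" using K by (auto simp: T3_def)
  define f where "f w = F (c w) * exp (- l w)" for w
  have holFc: "(\<lambda>w. F (c w)) holomorphic_on {w. Re w > T3}"
    by (rule holomorphic_on_compose_gen[OF _ holF, unfolded o_def])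
       (use T3 in \<open>auto simp: c_def complex_eq_iff intro!: holomorphic_intros\<close>)
  interpret tw: antisymmetric_twist "\<lambda>w. F (c w)" l f T3 \<Lambda> K
  proof
    show "l holomorphic_on {w. Re w > T3}" by (rule holomorphic_on_subset[OF l(1)]) (use T3 in auto)
    show "\<bar>Im (deriv l w) + \<Lambda> * ln (Re w)\<bar> \<le> K" if w: "Re w > T3" "\<bar>Im w\<bar> \<le> Re w" for w
    proof -
      have "\<bar>Re (\<psi> (c w)) + 2 * \<Lambda> * ln (Im (c w))\<bar> \<le> K"
        unfolding \<Lambda>_def using w T3 by (intro psiK) (auto simp: Imc Rec)
      moreover have "Re (\<psi> (c w)) = 2 * Im (deriv l w)" using psi_l[of w] w T3 by simp
      moreover have "2 * \<Lambda> * ln (Im (c w)) = 2 * (\<Lambda> * ln (Re w))" by (simp add: Imc)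
      ultimately show ?thesis using K(1) by linarith
    qed
    show "f (cnj w) = cnj (f w)" if w: "Re w > T3" for w
    proof -
      have "F (c (cnj w)) = H (c (cnj w)) * cnj (F (1 - cnj (c (cnj w))))"
        using F_reflect[OF holF fe, of "c (cnj w)"] w T3 by (simp add: Imc)
      also have "1 - cnj (c (cnj w)) = c w" by (simp add: crefl)
      also have "H (c (cnj w)) = exp (- 2 * cnj (l w))"
        using l(2)[of "cnj w"] l(3)[of w] w T3 by simp
      finally have "f (cnj w) = exp (- 2 * cnj (l w)) * cnj (F (c w)) * exp (cnj (l w))"
        using l(3)[of w] w T3 by (simp add: f_def)
      also have "\<dots> = cnj (F (c w)) * (exp (- 2 * cnj (l w)) * exp (cnj (l w)))" by (simp only: mult_ac)
      also have "exp (- 2 * cnj (l w)) * exp (cnj (l w)) = exp (- cnj (l w))"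
        by (simp add: exp_add[symmetric])
      finally show ?thesis by (simp add: f_def exp_cnj)
    qed
  qed (use T3 \<Lambda> K l holFc f_def in auto)
  obtain B0 where B0: "B0 \<ge> 2" "\<And>s. Re s \<ge> B0 \<Longrightarrow> norm (F s - 1) \<le> 1/2"
    using FS dirichlet_near_one unfolding extended_Selberg_class_def by blast
  obtain G where G: "G holomorphic_on UNIV" "finite_order G" "\<And>s. s \<noteq> 1 \<Longrightarrow> G s = (s - 1) ^ pole_order F * F s"
    using pole_order_bound_pole_order[OF FS] unfolding pole_order_bound_def by blast
  obtain A0 n where A0: "A0 > 0" "\<And>s. norm (G s) \<le> A0 * exp (norm s ^ n)"
    using finite_order_bound[OF G(2,1)] by blast
  have "strip_class (B0 + 1) (1/2) f"
  proof (rule tw.strip_class_f[of _ A0 "2 ^ n" n])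
    show "1/2 \<le> norm (F (c w)) \<and> norm (F (c w)) \<le> 3/2 \<and> norm (deriv (\<lambda>w. F (c w)) w / F (c w)) \<le> 3"
      if w: "Re w > T3" "Im w \<le> - (B0 + 1)" for w
    proof -
      have "F holomorphic_on {s. Re s > B0}" using B0(1) by (intro holomorphic_on_subset[OF holF]) auto
      then have *: "norm (F (c w)) \<ge> 1/2 \<and> norm (F (c w)) \<le> 3/2 \<and> norm (deriv F (c w) / F (c w)) \<le> 3"
        using w by (intro near_one_log_deriv[OF _ B0(2)]) (auto simp: Rec)
      have "(F has_field_derivative deriv F (c w)) (at (c w))"
        using w T3 by (intro holomorphic_derivI[OF holF]) (auto simp: complex_eq_iff Imc)
      then have "((\<lambda>w. F (c w)) has_field_derivative deriv F (c w) * \<i>) (at w)"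
        by (rule DERIV_chain2[where f = F and g = c]) (rule dc)
      then have "deriv (\<lambda>w. F (c w)) w = deriv F (c w) * \<i>" by (rule DERIV_imp_deriv)
      then show ?thesis using * by (simp add: norm_divide norm_mult)
    qed
    show "norm (F (c w)) \<le> A0 * exp (2 ^ n * norm w ^ n)" if w: "Re w > T3" for w
    proof -
      have "Im (c w) \<ge> 1" using w T3 by (simp add: Imc)
      then have n1: "norm (c w - 1) \<ge> 1" using abs_Im_le_cmod[of "c w - 1"] by simp
      then have "c w \<noteq> 1" by auto
      have "1 * norm (F (c w)) \<le> norm (c w - 1) ^ pole_order F * norm (F (c w))"
        using one_le_power[OF n1] by (intro mult_right_mono) auto
      also have "\<dots> = norm (G (c w))" using G(3)[OF \<open>c w \<noteq> 1\<close>] by (simp add: norm_mult norm_power)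
      also have "\<dots> \<le> A0 * exp (norm (c w) ^ n)" by (rule A0)
      also have "\<dots> \<le> A0 * exp ((2 * norm w) ^ n)"
      proof -
        have "norm (c w) \<le> 1/2 + norm w" unfolding c_def by (rule norm_triangle_le) (simp add: norm_mult)
        moreover have "norm w \<ge> 1" using abs_Re_le_cmod[of w] w T3 by simp
        ultimately have "norm (c w) ^ n \<le> (2 * norm w) ^ n" by (intro power_mono) auto
        then show ?thesis using A0 by simp
      qed
      finally show ?thesis by (simp add: power_mult_distrib)
    qed
    show "Im w = 0" if "Re w > T3" "F (c w) = 0" for w
    proof -
      have "completed_fn F Q r lam \<mu> (c w) = 0"
        using that T3 by (subst completed_fn_eq[OF holF]) (auto simp: Imc)
      then have "Re (c w) = 1/2" using RH unfolding Riemann_Hypothesis_def by blast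
      then show ?thesis by (simp add: Rec)
    qed
  qed (use B0 A0 in auto)
  then have "strip_class (B0 + 1) (1/2 / 4 ^ k) ((deriv ^^ k) f)"
    using B0 by (intro strip_class_higher_deriv) auto
  then obtain T4 where T4: "T4 > 0" "\<And>w. Re w > T4 \<Longrightarrow> \<bar>Im w\<bar> \<le> A \<Longrightarrow> (deriv ^^ k) f w = 0 \<Longrightarrow> Im w = 0"
    using strip_class_real_zeros[of "1/2 / 4 ^ k" "B0 + 1" "(deriv ^^ k) f" A] by auto
  have "Re s = 1/2" if s: "Im s > max T3 T4" "\<bar>Re s - 1/2\<bar> \<le> A" "isolated_zero (F_iter F \<psi> k) s" for s
  proof -
    define w where "w = - \<i> * (s - 1/2)"
    have sw: "s = c w" by (simp add: w_def c_def algebra_simps)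
    have w: "Re w > T3" "Re w > T4" "\<bar>Im w\<bar> \<le> A" using s(1,2) by (auto simp: w_def)
    have "(deriv ^^ k) f w = 0"
    proof (rule isolated_zero_F_iter_twisted(1)[of "{w. Re w > T3}"])
      show "isolated_zero (F_iter F \<psi> k) (1/2 + \<i> * w)" using s(3) by (simp add: sw c_def)
      show "F (1/2 + \<i> * w) = f w * exp (l w)" for w
        by (simp add: f_def c_def exp_minus)
      show "\<psi> (1/2 + \<i> * w) = - 2 * \<i> * deriv l w" if "w \<in> {w. Re w > T3}" for w
        using psi_l[of w] that T3 by (simp add: c_def)
    qed (use w tw.holf tw.holl in \<open>auto simp: open_halfspace_Re_gt\<close>)
    then have "Im w = 0" using T4(2) w by blast
    then show ?thesis by (simp add: sw Rec)
  qed
  then show ?thesis using T4(1) by (intro exI[of _ "max T3 T4"]) auto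
qed

subsection \<open>Degree zero\<close>

text \<open>
  A pole of \<open>F\<close> at \<open>1\<close> would be reflected to a pole at \<open>0\<close>; \<open>E\<close> is \<open>F\<close> with its unconstrained value
  at \<open>1\<close> corrected.
\<close>

lemma degree_zero_entire:
  assumes FS: "F \<in> extended_Selberg_class" and fe: "functional_equation F Q 0 lam \<mu> \<omega>"
    and RH: "Riemann_Hypothesis F Q 0 lam \<mu>"
  obtains E A n where "E holomorphic_on UNIV" "\<And>s. s \<noteq> 1 \<Longrightarrow> E s = F s"
    "\<And>s. E s = 0 \<Longrightarrow> Re s = 1/2"
    "\<And>s. E s = \<omega> * exp ((1 - 2 * s) * of_real (ln Q)) * cnj (E (1 - cnj s))"
    "A > 0" "\<And>s. norm (s - 1) \<ge> 1 \<Longrightarrow> norm (E s) \<le> A * exp (norm s ^ n)"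
proof -
  define m where "m = pole_order F"
  define L where "L = complex_of_real (ln Q)"
  have Q: "Q > 0" and \<omega>: "norm \<omega> = 1"
    and feq: "\<And>s. completed_fn F Q 0 lam \<mu> s = \<omega> * cnj (completed_fn F Q 0 lam \<mu> (1 - cnj s))"
    using fe unfolding functional_equation_def by blast+
  obtain G where G: "G holomorphic_on UNIV" "finite_order G" "\<And>s. s \<noteq> 1 \<Longrightarrow> G s = (s - 1) ^ m * F s"
    using pole_order_bound_pole_order[OF FS] unfolding pole_order_bound_def m_def by blast
  obtain A n where A: "A > 0" "\<And>s. norm (G s) \<le> A * exp (norm s ^ n)"
    using finite_order_bound[OF G(2,1)] by blast
  define X where "X s = s ^ m * exp (s * L) * G s" for s
  have completed: "completed_fn F Q 0 lam \<mu> s = X s" for s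
    unfolding completed_fn_def
  proof (rule remove_sings_eqI, rule Lim_transform_eventually)
    have "X holomorphic_on UNIV" unfolding X_def by (intro holomorphic_intros G)
    then show "X \<midarrow>s\<rightarrow> X s"
      using holomorphic_on_imp_continuous_on continuous_on_eq_continuous_at isCont_def open_UNIV UNIV_I by blast
    have "eventually (\<lambda>s. s \<noteq> 1) (at s)" by (rule eventually_neq_at_within)
    then show "eventually (\<lambda>s. X s = s ^ pole_order F * (s - 1) ^ pole_order F * gamma_factor Q 0 lam \<mu> s * F s) (at s)"
      by eventually_elim (use Q in \<open>simp add: X_def G(3) gamma_factor_def powr_def Ln_of_real L_def m_def\<close>)
  qed
  define Gc where "Gc s = cnj (G (1 - cnj s))" for s
  have "(cnj \<circ> (\<lambda>u. G (1 - u)) \<circ> cnj) holomorphic_on UNIV"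
    by (intro holomorphic_on_compose_cnj_cnj holomorphic_on_compose_gen[OF _ G(1), unfolded o_def] holomorphic_intros) auto
  then have holGc: "Gc holomorphic_on UNIV" by (simp add: Gc_def[abs_def] o_def)
  have XX: "s ^ m * exp (s * L) * G s = \<omega> * (1 - s) ^ m * exp ((1 - s) * L) * Gc s" for s
    using feq[of s] unfolding completed X_def by (simp add: Gc_def exp_cnj L_def mult_ac)
  have G1: "G s = \<omega> * (1 - s) ^ m * exp ((1 - 2 * s) * L) * Gc s / s ^ m" if "s \<noteq> 0" for s
  proof -
    have "exp ((1 - s) * L) = exp (s * L) * exp ((1 - 2 * s) * L)"
      by (simp add: exp_add[symmetric] algebra_simps)
    then have "exp (s * L) * (s ^ m * G s) = exp (s * L) * (\<omega> * (1 - s) ^ m * exp ((1 - 2 * s) * L) * Gc s)"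
      using XX[of s] by (simp only: mult_ac)
    then have "s ^ m * G s = \<omega> * (1 - s) ^ m * exp ((1 - 2 * s) * L) * Gc s" by simp
    then show ?thesis using that by (simp add: field_simps)
  qed
  \<comment> \<open>The functional equation gives this second expression for F, holomorphic away
    from 0, whereas the first one is holomorphic away from 1; gluing the two removes the
    pole.\<close>
  define E2 where "E2 s = (- 1) ^ m * \<omega> * exp ((1 - 2 * s) * L) * Gc s / s ^ m" for s
  define E where "E s = (if s = 1 then E2 1 else G s / (s - 1) ^ m)" for s
  have E2: "E s = E2 s" if "s \<noteq> 0" for s
  proof (cases "s = 1")
    case False
    have "(1 - s) ^ m = (- 1) ^ m * (s - 1) ^ m" by (simp flip: power_mult_distrib)
    then show ?thesis using G1[OF that] False by (simp add: E_def E2_def)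
  qed (simp add: E_def)
  have "E holomorphic_on - {1}"
    by (rule holomorphic_transform[of "\<lambda>s. G s / (s - 1) ^ m"])
       (auto simp: E_def intro!: holomorphic_intros holomorphic_on_subset[OF G(1)])
  moreover have "E2 holomorphic_on - {0}"
    unfolding E2_def by (intro holomorphic_intros holomorphic_on_subset[OF holGc]) auto
  then have "E holomorphic_on - {0}" by (rule holomorphic_transform) (simp add: E2)
  ultimately have "E holomorphic_on - {1} \<union> - {0}"
    by (intro holomorphic_on_Un) auto
  moreover have "- {1} \<union> - {0} = (UNIV :: complex set)" by auto
  ultimately have holE: "E holomorphic_on UNIV" by simp
  have refl0: "E s = \<omega> * exp ((1 - 2 * s) * L) * cnj (E (1 - cnj s))" if "s \<noteq> 0" for s
  proof -
    have "1 - cnj s \<noteq> 1" using that by simp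
    then have "cnj (E (1 - cnj s)) = Gc s / (- s) ^ m" by (simp add: E_def Gc_def)
    also have "\<dots> = (- 1) ^ m * Gc s / s ^ m" by (cases "even m") auto
    finally show ?thesis using E2[OF that] by (simp add: E2_def mult_ac)
  qed
  have reflect: "E s = \<omega> * exp ((1 - 2 * s) * L) * cnj (E (1 - cnj s))" for s
  proof (cases "s = 0")
    case True
    have "E 1 = \<omega> * exp (- L) * cnj (E 0)" using refl0[of 1] by simp
    then have "cnj (E 1) = cnj \<omega> * exp (- L) * E 0" by (simp add: exp_cnj L_def)
    then have "\<omega> * exp L * cnj (E 1) = (\<omega> * cnj \<omega>) * (exp L * exp (- L)) * E 0" by (simp add: mult_ac)
    also have "\<dots> = E 0" using \<omega> by (simp add: complex_norm_square[symmetric] exp_minus)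
    finally show ?thesis using True by simp
  qed (rule refl0)
  have zero: "Re s = 1/2" if "E s = 0" for s
  proof (cases "s = 1")
    case True
    \<comment> \<open>A zero at 1 is reflected to 0, where the completed function would vanish, and
      the Riemann Hypothesis rules that out.\<close>
    have "E 0 = 0" using reflect[of 0] that True by simp
    then have "G 0 = 0" by (simp add: E_def)
    then have "X 0 = 0" by (simp add: X_def)
    then show ?thesis using RH completed[of 0] unfolding Riemann_Hypothesis_def by fastforce
  next
    case False
    then have "X s = 0" using that by (auto simp: E_def X_def)
    then show ?thesis using RH completed[of s] unfolding Riemann_Hypothesis_def by simp
  qed
  show ?thesis
  proof (rule that[OF holE _ zero _ A(1)])
    show "E s = F s" if "s \<noteq> 1" for s using that by (simp add: E_def G(3))
    show "E s = \<omega> * exp ((1 - 2 * s) * of_real (ln Q)) * cnj (E (1 - cnj s))" for s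
      using reflect[of s] by (simp add: L_def)
    show "norm (E s) \<le> A * exp (norm s ^ n)" if "norm (s - 1) \<ge> 1" for s
    proof -
      have "s \<noteq> 1" using that by auto
      then have "norm (E s) = norm (G s) / norm (s - 1) ^ m" by (simp add: E_def norm_divide norm_power)
      also have "\<dots> \<le> norm (G s) / 1" using one_le_power[OF that, of m] by (intro divide_left_mono) auto
      finally show ?thesis using A(2)[of s] by simp
    qed
  qed
qed

text \<open>Here \<open>H\<close> is a constant times an exponential, so \<open>l\<close> is linear
  and \<open>f\<close> is entire. For |Im w| \<ge> \<open>B0\<close> it grows at most exponentially
  because F is near 1 on one side; the strip between is handled by Phragmen-Lindelof.\<close>

lemma isolated_zeros_degree_zero:
  assumes FS: "F \<in> extended_Selberg_class" and fe: "functional_equation F Q 0 lam \<mu> \<omega>"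
    and RH: "Riemann_Hypothesis F Q 0 lam \<mu>"
    and s: "Im s > 0" "isolated_zero (F_iter F (psi_fn Q 0 lam \<mu> \<omega>) k) s"
  shows "Re s = 1/2"
proof -
  have Q: "Q > 0" and \<omega>: "norm \<omega> = 1" using fe unfolding functional_equation_def by auto
  define L where "L = ln Q"
  obtain E A n where E: "E holomorphic_on UNIV" "\<And>s. s \<noteq> 1 \<Longrightarrow> E s = F s"
    "\<And>s. E s = 0 \<Longrightarrow> Re s = 1/2"
    "\<And>s. E s = \<omega> * exp ((1 - 2 * s) * of_real L) * cnj (E (1 - cnj s))"
    "A > 0" "\<And>s. norm (s - 1) \<ge> 1 \<Longrightarrow> norm (E s) \<le> A * exp (norm s ^ n)"
    using degree_zero_entire[OF FS fe RH] unfolding L_def by blast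
  obtain B0 where B0: "B0 \<ge> 2" "\<And>s. Re s \<ge> B0 \<Longrightarrow> norm (F s - 1) \<le> 1/2"
    using FS dirichlet_near_one unfolding extended_Selberg_class_def by blast
  define c where "c w = 1/2 + \<i> * w" for w
  have Imc: "Im (c w) = Re w" and Rec: "Re (c w) = 1/2 - Im w" for w by (auto simp: c_def)
  have crefl: "1 - cnj (c w) = c (cnj w)" for w by (simp add: c_def complex_eq_iff)
  define \<theta> where "\<theta> = Arg \<omega>"
  have \<theta>: "\<omega> = exp (\<i> * of_real \<theta>)"
    using \<omega> Arg_eq[of \<omega>] unfolding \<theta>_def by force
  define l where "l w = \<i> * of_real (\<theta> / 2) - \<i> * w * of_real L" for w
  have lcn: "l (cnj w) = - cnj (l w)" for w by (simp add: l_def)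
  have Rel: "Re (l w) = Im w * L" for w by (simp add: l_def)
  have H: "\<omega> * exp ((1 - 2 * c w) * of_real L) = exp (2 * l w)" for w
    unfolding \<theta> by (simp add: exp_add[symmetric] l_def c_def algebra_simps)
  define f where "f w = E (c w) * exp (- l w)" for w
  have holf: "f holomorphic_on UNIV" unfolding f_def l_def c_def
    by (intro holomorphic_intros holomorphic_on_compose_gen[OF _ E(1), unfolded o_def]) auto
  have fcn: "f (cnj w) = cnj (f w)" for w
  proof -
    have "E (c (cnj w)) = exp (2 * l (cnj w)) * cnj (E (c w))"
      using E(4)[of "c (cnj w)"] crefl[of "cnj w"] unfolding H by simp
    then have "f (cnj w) = cnj (E (c w)) * (exp (2 * l (cnj w)) * exp (- l (cnj w)))"
      by (simp add: f_def mult_ac)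
    also have "exp (2 * l (cnj w)) * exp (- l (cnj w)) = exp (- cnj (l w))"
      by (simp add: lcn exp_add[symmetric])
    finally show ?thesis by (simp add: f_def exp_cnj)
  qed
  have nf: "norm (f w) = norm (E (c w)) * exp (- (Im w * L))" for w by (simp add: f_def norm_mult Rel)
  have expL: "exp (- (Im w * L)) \<le> exp (b * \<bar>L\<bar>)" if "\<bar>Im w\<bar> \<le> b" for w b
  proof -
    have "- (Im w * L) \<le> \<bar>Im w\<bar> * \<bar>L\<bar>" by (metis abs_ge_minus_self abs_mult)
    also have "\<dots> \<le> b * \<bar>L\<bar>" using that by (intro mult_right_mono) auto
    finally show ?thesis by simp
  qed
  have far: "norm (f w) \<le> 3/2 * exp (\<bar>Im w\<bar> * \<bar>L\<bar>)" if "\<bar>Im w\<bar> \<ge> B0" for w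
  proof -
    have *: "norm (f w) \<le> 3/2 * exp (\<bar>Im w\<bar> * \<bar>L\<bar>)" if w: "Im w \<le> - B0" for w
    proof -
      have "c w \<noteq> 1" using w B0 Rec[of w] by auto
      moreover have "norm (F (c w) - 1) \<le> 1/2" using w B0 by (intro B0) (simp add: Rec)
      ultimately have "norm (E (c w)) \<le> 3/2" using E(2) norm_triangle_ineq2[of "F (c w)" 1] by simp
      then show ?thesis unfolding nf using expL[of w "\<bar>Im w\<bar>"] by (intro mult_mono) auto
    qed
    show ?thesis
    proof (cases "Im w \<le> - B0")
      case False
      then have "Im (cnj w) \<le> - B0" using that by auto
      then show ?thesis using *[of "cnj w"] fcn[of w] by simp
    qed (use * in auto)
  qed
  \<comment> \<open>Applied to f(w) and f(-w), this covers both ends of the strip; with k = 0 it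
    gives boundedness. The compact part |Re w| \<le> 1 is left to \<open>C3\<close>.\<close>
  have PL: "\<exists>C. \<forall>w. Re w \<ge> 1 \<and> \<bar>Im w\<bar> \<le> B0 \<longrightarrow> norm (g w) \<le> C * norm w ^ 0"
    if g: "g = f \<or> g = (\<lambda>w. f (- w))" for g
  proof (rule Phragmen_Lindelof_half_strip[of g 0])
    show "g holomorphic_on {w. Re w > 0}"
    proof -
      have "(\<lambda>w. - w) holomorphic_on {w. Re w > 0}" by (intro holomorphic_intros)
      then have "(\<lambda>w. f (- w)) holomorphic_on {w. Re w > 0}"
        using holomorphic_on_compose_gen[OF _ holf, of "\<lambda>w. - w"] by (simp add: o_def)
      then show ?thesis using g holomorphic_on_subset[OF holf] by auto
    qed
    have bd: "norm (f w) \<le> (A * exp (B0 * \<bar>L\<bar>)) * exp (2 ^ n * norm w ^ n)" if w: "\<bar>Re w\<bar> \<ge> 1" "\<bar>Im w\<bar> \<le> B0" for w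
    proof -
      have "norm (c w - 1) \<ge> 1" using abs_Im_le_cmod[of "c w - 1"] w by (simp add: Imc)
      then have "norm (E (c w)) \<le> A * exp (norm (c w) ^ n)" by (rule E(6))
      also have "\<dots> \<le> A * exp ((2 * norm w) ^ n)"
      proof -
        have "norm (c w) \<le> 1/2 + norm w" unfolding c_def by (rule norm_triangle_le) (simp add: norm_mult)
        moreover have "norm w \<ge> 1" using abs_Re_le_cmod[of w] w by simp
        ultimately have "norm (c w) ^ n \<le> (2 * norm w) ^ n" by (intro power_mono) auto
        then show ?thesis using E(5) by simp
      qed
      finally have "norm (f w) \<le> (A * exp ((2 * norm w) ^ n)) * exp (B0 * \<bar>L\<bar>)"
        unfolding nf using expL[OF w(2)] E(5) by (intro mult_mono) auto
      then show ?thesis by (simp add: power_mult_distrib mult_ac)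
    qed
    show "norm (g w) \<le> (A * exp (B0 * \<bar>L\<bar>)) * exp (2 ^ n * norm w ^ n)" if "Re w \<ge> 1" "\<bar>Im w\<bar> \<le> B0" for w
      using g bd[of w] bd[of "- w"] that by auto
    show "norm (g w) \<le> (3/2 * exp (B0 * \<bar>L\<bar>)) * norm w ^ 0" if "Re w \<ge> 1" "\<bar>Im w\<bar> = B0" for w
      using g far[of w] far[of "- w"] that by auto
  qed (use B0 in auto)
  obtain C1 where C1: "\<And>w. Re w \<ge> 1 \<Longrightarrow> \<bar>Im w\<bar> \<le> B0 \<Longrightarrow> norm (f w) \<le> C1" using PL[of f] by auto
  obtain C2 where C2: "\<And>w. Re w \<ge> 1 \<Longrightarrow> \<bar>Im w\<bar> \<le> B0 \<Longrightarrow> norm (f (- w)) \<le> C2" 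
    using PL[of "\<lambda>w. f (- w)"] by auto
  have "bounded (f ` cbox (Complex (-1) (- B0)) (Complex 1 B0))"
    using holf by (intro compact_imp_bounded compact_continuous_image compact_cbox)
       (auto intro: holomorphic_on_imp_continuous_on holomorphic_on_subset)
  then obtain C3 where "\<forall>x\<in>f ` cbox (Complex (-1) (- B0)) (Complex 1 B0). norm x \<le> C3"
    unfolding bounded_iff by blast
  then have C3: "norm (f w) \<le> C3" if "\<bar>Re w\<bar> \<le> 1" "\<bar>Im w\<bar> \<le> B0" for w
  proof -
    have "w \<in> cbox (Complex (-1) (- B0)) (Complex 1 B0)" using that by (auto simp: in_cbox_complex_iff abs_le_iff)
    then show ?thesis using \<open>\<forall>x\<in>_. norm x \<le> C3\<close> by simp
  qed
  define C where "C = Max {C1, C2, C3, 2}"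
  have C: "C \<ge> C1" "C \<ge> C2" "C \<ge> C3" "C \<ge> 2" by (auto simp: C_def)
  have growth: "norm (f w) \<le> C * exp ((\<bar>L\<bar> + 1) * norm w)" for w
  proof (cases "\<bar>Im w\<bar> \<le> B0")
    case True
    have "norm (f w) \<le> C"
    proof (cases "\<bar>Re w\<bar> \<le> 1")
      case False
      then consider "Re w \<ge> 1" | "Re (- w) \<ge> 1" by fastforce
      then show ?thesis using C1[of w] C2[of "- w"] C True by cases auto
    qed (use C3[of w] C True in auto)
    also have "C * 1 \<le> C * exp ((\<bar>L\<bar> + 1) * norm w)" using C by (intro mult_left_mono) auto
    finally show ?thesis by simp
  next
    case False
    then have "norm (f w) \<le> 3/2 * exp (\<bar>Im w\<bar> * \<bar>L\<bar>)" by (intro far) auto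
    also have "\<dots> \<le> C * exp ((\<bar>L\<bar> + 1) * norm w)"
    proof (intro mult_mono)
      have "\<bar>Im w\<bar> * \<bar>L\<bar> \<le> norm w * (\<bar>L\<bar> + 1)" by (intro mult_mono abs_Im_le_cmod) auto
      then show "exp (\<bar>Im w\<bar> * \<bar>L\<bar>) \<le> exp ((\<bar>L\<bar> + 1) * norm w)" by (simp add: mult.commute)
    qed (use C in auto)
    finally show ?thesis .
  qed
  have "Im w = 0" if "f w = 0" for w
    using E(3)[of "c w"] that by (simp add: f_def Rec)
  then have "real_entire_class f"
    unfolding real_entire_class_def using holf fcn growth C
    by (intro conjI exI[of _ C] exI[of _ "\<bar>L\<bar> + 1"]) auto
  then have cases: "(\<forall>w. (deriv ^^ k) f w = 0) \<or> real_entire_class ((deriv ^^ k) f)"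
    by (rule real_entire_class_higher_deriv)
  define w where "w = - \<i> * (s - 1/2)"
  have sw: "s = 1/2 + \<i> * w" by (simp add: w_def algebra_simps)
  define V where "V = {w. Re w > 0}"
  have V: "open V" by (simp add: V_def open_halfspace_Re_gt)
  have H_fn: "H_fn Q 0 lam \<mu> \<omega> u = \<omega> * exp ((1 - 2 * u) * of_real L)" for u
  proof -
    have "(1 - 2 * u) * of_real L = (1 - u) * of_real L - u * of_real L" by (simp add: algebra_simps)
    then show ?thesis using Q by (simp add: H_fn_def gamma_factor_def powr_def Ln_of_real exp_cnj exp_diff L_def)
  qed
  have dl: "deriv l v = - \<i> * of_real L" for v
    unfolding l_def by (rule DERIV_imp_deriv) (auto intro!: derivative_eq_intros)
  have psi: "psi_fn Q 0 lam \<mu> \<omega> u = - 2 * of_real L" for u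
  proof -
    have "(H_fn Q 0 lam \<mu> \<omega> has_field_derivative H_fn Q 0 lam \<mu> \<omega> u * (- 2 * of_real L)) (at u)"
      unfolding H_fn by (auto simp: H_fn[abs_def] intro!: derivative_eq_intros)
    then have "deriv (H_fn Q 0 lam \<mu> \<omega>) u = H_fn Q 0 lam \<mu> \<omega> u * (- 2 * of_real L)" by (rule DERIV_imp_deriv)
    moreover have "H_fn Q 0 lam \<mu> \<omega> u \<noteq> 0" using \<omega> by (auto simp: H_fn)
    ultimately show ?thesis by (simp add: psi_fn_def)
  qed
  have F: "F (1/2 + \<i> * v) = f v * exp (l v)" if "v \<in> V" for v
  proof -
    have "c v \<noteq> 1" using that Imc[of v] by (auto simp: V_def)
    then have "F (c v) = E (c v)" using E(2) by simp
    then show ?thesis by (simp add: f_def c_def exp_minus)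
  qed
  have holl: "l holomorphic_on V" unfolding l_def by (intro holomorphic_intros)
  have wV: "w \<in> V" using s(1) by (simp add: V_def w_def)
  have psi': "psi_fn Q 0 lam \<mu> \<omega> (1/2 + \<i> * v) = - 2 * \<i> * deriv l v" if "v \<in> V" for v
    by (simp add: psi dl)
  have holfV: "f holomorphic_on V" using holf holomorphic_on_subset by blast
  note iz = isolated_zero_F_iter_twisted[where F = F and \<psi> = "psi_fn Q 0 lam \<mu> \<omega>",
      OF V holfV holl F psi' wV s(2)[unfolded sw]]
  have "Im w = 0" using cases iz unfolding real_entire_class_def by blast
  then show ?thesis by (simp add: w_def)
qed

subsection \<open>Finitely many exceptions\<close>

theorem theorem1p3:
  fixes F :: "complex \<Rightarrow> complex"
    and Q :: real and r :: nat and lam :: "nat \<Rightarrow> real" and \<mu> :: "nat \<Rightarrow> complex" and \<omega> :: complex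
    and k :: nat
  assumes "F \<in> extended_Selberg_class"
    and "functional_equation F Q r lam \<mu> \<omega>"
    and "Riemann_Hypothesis F Q r lam \<mu>"
  shows "\<exists>\<sigma>\<^sub>0>0. \<forall>\<sigma>\<ge>\<sigma>\<^sub>0. \<exists>C::nat. \<forall>T>0.
           finite (off_line_zeros (F_iter F (psi_fn Q r lam \<mu> \<omega>) k) \<sigma> T) \<and>
           card (off_line_zeros (F_iter F (psi_fn Q r lam \<mu> \<omega>) k) \<sigma> T) \<le> C"
proof -
  let ?f = "F_iter F (psi_fn Q r lam \<mu> \<omega>) k"
  have "\<exists>C::nat. \<forall>T>0. finite (off_line_zeros ?f \<sigma> T) \<and> card (off_line_zeros ?f \<sigma> T) \<le> C" if "\<sigma> \<ge> 1" for \<sigma>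
  proof -
    have "\<exists>T1>0. \<forall>s. Im s > T1 \<and> \<bar>Re s - 1/2\<bar> \<le> \<sigma> \<and> isolated_zero ?f s \<longrightarrow> Re s = 1/2"
    proof (cases "r = 0")
      case True
      then show ?thesis using isolated_zeros_degree_zero[of F Q lam \<mu> \<omega> _ k] assms
        by (intro exI[of _ 1]) (auto intro: order_less_trans)
    next
      case False
      then show ?thesis using strip_zeros_positive_degree[OF assms] by simp
    qed
    then obtain T1 where T1: "\<And>s. Im s > T1 \<Longrightarrow> \<bar>Re s - 1/2\<bar> \<le> \<sigma> \<Longrightarrow> isolated_zero ?f s \<Longrightarrow> Re s = 1/2"
      by blast
    \<comment> \<open>The box ends at \<open>T1\<close>, whatever \<open>T\<close> is, so the
      cardinality of \<open>Z\<close> bounds the exceptions uniformly in \<open>T\<close>.\<close>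
    define Z where "Z = {s \<in> cbox (Complex (1 - \<sigma>) 0) (Complex \<sigma> T1). isolated_zero ?f s}"
    have "?f meromorphic_on UNIV"
      using assms by (intro F_iter_meromorphic extended_Selberg_meromorphic psi_fn_meromorphic)
        (auto simp: functional_equation_def)
    then have Z: "finite Z" unfolding Z_def by (rule finite_isolated_zeros_compact) auto
    have sub: "off_line_zeros ?f \<sigma> T \<subseteq> Z" for T
    proof
      fix s assume "s \<in> off_line_zeros ?f \<sigma> T"
      then have s: "isolated_zero ?f s" "1 - \<sigma> < Re s" "Re s < \<sigma>" "0 < Im s" "Re s \<noteq> 1/2"
        by (auto simp: off_line_zeros_def)
      have "\<bar>Re s - 1/2\<bar> \<le> \<sigma>" using s by (simp add: abs_le_iff)
      then have "Im s \<le> T1" using T1[of s] s by force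
      then show "s \<in> Z" using s by (simp add: Z_def in_cbox_complex_iff)
    qed
    show ?thesis
      using sub Z by (intro exI[of _ "card Z"] allI impI conjI) (auto intro: finite_subset card_mono)
  qed
  then show ?thesis by (intro exI[of _ 1]) auto
qed

end
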